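(* Let $E$ be an elliptic curve over $\mathbb{Q}$ defined by $y^2=f(x)$, where $f\in\mathbb{Q}[x]$ is a polynomial of degree $3$ or $4$, and assume the Mordell–Weil rank of $E(\mathbb{Q})$ is positive. Let $m_1,m_2,m_3\ge 3$ be odd integers and $a,b,c$ non-zero rational numbers, and consider the hyperelliptic curves $E_1:y^2=x^{m_1}+a^2$, $E_2:y^2=x^{m_2}+b^2$, $E_3:y^2=x^{m_3}+c^2$. Then there exists a rational function $D\in\mathbb{Q}(v_1,v_2,v_3)$ such that the elliptic curve $Dy^2=f(x)$ and the Jacobians of the curves $$y^2=x^{m_1}+a^2D,\quad y^2=x^{m_2}+b^2D,\quad y^2=x^{m_3}+c^2D$$ all have positive Mordell–Weil rank over $\mathbb{Q}(v_1,v_2,v_3)$.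
   Context: $\mathbb{Q}(v_1,v_2,v_3)$ is the rational function field in three independent variables. For a rational function $D$, the quadratic twist of $y^2=f(x)$ by $D$ is $Dy^2=f(x)$, and the $2m$-twist of $y^2=x^m+\alpha$ by $D$ is the curve $y^2=x^m+\alpha D$. *)

theory Defs
  imports
    "HOL-Algebra.Free_Abelian_Groups"
    "HOL-Algebra.Algebraic_Closure_Type"
    "HOL-Computational_Algebra.Computational_Algebra"
    "HOL-Library.Extended_Nat"
begin

section \<open>The smooth projective model of \<open>d y\<^sup>2 = f(x)\<close>\<close>

text \<open>
  Throughout, a pair \<open>(d, f)\<close> with \<open>d \<noteq> 0\<close> and \<open>f\<close> squarefree of degree at least 3, over a field
  of characteristic 0, stands for the smooth projective curve with affine equation
  \<open>d y\<^sup>2 = f(x)\<close>.  With \<open>h = \<lceil>deg f / 2\<rceil>\<close> it is glued from the two affine curves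
  \<open>d y\<^sup>2 = f(x)\<close> and \<open>d w\<^sup>2 = z\<^bsup>2h\<^esup> f(1/z)\<close> along \<open>x = 1/z\<close>, \<open>y = w/z\<^bsup>h\<^esup>\<close>.
  The point \<open>Infinite w\<close> is the point \<open>(z, w) = (0, w)\<close> of the second chart; there is one such
  point (with \<open>w = 0\<close>) if the degree of \<open>f\<close> is odd.
\<close>

datatype 'k curve_point = Affine 'k 'k | Infinite 'k

definition half_degree :: "'k::field poly \<Rightarrow> nat" where
  "half_degree f = (degree f + 1) div 2"

definition curve_points :: "'k::field \<Rightarrow> 'k poly \<Rightarrow> 'k curve_point set" where
  "curve_points d f =
     {Affine x y | x y. d * y\<^sup>2 = poly f x} \<union>
     {Infinite w | w. d * w\<^sup>2 = coeff f (2 * half_degree f)}"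

section \<open>Function field and orders of vanishing over an algebraically closed field\<close>

text \<open>
  The function field \<open>k(x)(y)\<close> is realised inside an algebraic closure of \<open>k(x)\<close>, with \<open>y\<close> a fixed
  root of \<open>d y\<^sup>2 = f(x)\<close>.
\<close>

type_synonym 'k func = "'k poly fract alg_closure"

definition func_const :: "'k::field \<Rightarrow> 'k func" where
  "func_const c = to_ac (to_fract [:c:])"

definition coord_x :: "'k::field func" where
  "coord_x = to_ac (to_fract [:0, 1:])"

definition coord_y :: "'k::field \<Rightarrow> 'k poly \<Rightarrow> 'k func" where
  "coord_y d f = (SOME y. func_const d * y\<^sup>2 = to_ac (to_fract f))"

definition function_field :: "'k::field \<Rightarrow> 'k poly \<Rightarrow> 'k func set" where
  "function_field d f = {to_ac r + to_ac s * coord_y d f | r s. True}"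

text \<open>Evaluation of a bivariate polynomial, the outer variable being the second one.\<close>

definition eval2 :: "('k::field \<Rightarrow> 'l::field) \<Rightarrow> 'k poly poly \<Rightarrow> 'l \<times> 'l \<Rightarrow> 'l" where
  "eval2 \<phi> G p = poly (map_poly (\<lambda>q. poly (map_poly \<phi> q) (fst p)) G) (snd p)"

fun chart_functions :: "'k::field \<Rightarrow> 'k poly \<Rightarrow> 'k curve_point \<Rightarrow> 'k func \<times> 'k func" where
  "chart_functions d f (Affine a b) = (coord_x, coord_y d f)"
| "chart_functions d f (Infinite w) = (1 / coord_x, coord_y d f / coord_x ^ half_degree f)"

fun chart_values :: "'k::field curve_point \<Rightarrow> 'k \<times> 'k" where
  "chart_values (Affine a b) = (a, b)"
| "chart_values (Infinite w) = (0, w)"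

definition uniformizer :: "'k::field \<Rightarrow> 'k poly \<Rightarrow> 'k curve_point \<Rightarrow> 'k func" where
  "uniformizer d f P =
     (if snd (chart_values P) \<noteq> 0
      then fst (chart_functions d f P) - func_const (fst (chart_values P))
      else snd (chart_functions d f P))"

text \<open>
  The units of the local ring at \<open>P\<close> are the quotients of two polynomials in the chart functions
  neither of which vanishes at \<open>P\<close>; the order of \<open>\<phi>\<close> at \<open>P\<close> is the \<open>n\<close> for which \<open>\<phi>\<close> is a unit
  times the \<open>n\<close>-th power of the uniformizer.
\<close>

definition local_unit :: "'k::field \<Rightarrow> 'k poly \<Rightarrow> 'k curve_point \<Rightarrow> 'k func \<Rightarrow> bool" where
  "local_unit d f P u \<longleftrightarrow>
     (\<exists>G H. eval2 id G (chart_values P) \<noteq> 0 \<and> eval2 id H (chart_values P) \<noteq> 0 \<and>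
        u = eval2 func_const G (chart_functions d f P) / eval2 func_const H (chart_functions d f P))"

definition vanishing_order :: "'k::field \<Rightarrow> 'k poly \<Rightarrow> 'k curve_point \<Rightarrow> 'k func \<Rightarrow> int" where
  "vanishing_order d f P \<phi> =
     (THE n. \<exists>u. local_unit d f P u \<and> \<phi> = u * uniformizer d f P powi n)"

section \<open>Divisor classes of degree zero\<close>

type_synonym 'k divisor = "'k curve_point \<Rightarrow>\<^sub>0 int"

definition divisor_degree :: "'k divisor \<Rightarrow> int" where
  "divisor_degree \<Delta> = (\<Sum>P\<in>Poly_Mapping.keys \<Delta>. Poly_Mapping.lookup \<Delta> P)"

definition principal_divisors :: "'k::alg_closed_field \<Rightarrow> 'k poly \<Rightarrow> 'k divisor set" where
  "principal_divisors d f =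
     {\<Delta> \<in> carrier (free_Abelian_group (curve_points d f)).
        \<exists>\<phi>\<in>function_field d f - {0}.
          \<forall>P\<in>curve_points d f. Poly_Mapping.lookup \<Delta> P = vanishing_order d f P \<phi>}"

definition Div0 :: "'k::alg_closed_field \<Rightarrow> 'k poly \<Rightarrow> 'k divisor monoid" where
  "Div0 d f = (free_Abelian_group (curve_points d f))
     \<lparr>carrier := {\<Delta> \<in> carrier (free_Abelian_group (curve_points d f)). divisor_degree \<Delta> = 0}\<rparr>"

definition Pic0 :: "'k::alg_closed_field \<Rightarrow> 'k poly \<Rightarrow> 'k divisor set monoid" where
  "Pic0 d f = Div0 d f Mod principal_divisors d f"

definition divisor_class :: "'k::alg_closed_field \<Rightarrow> 'k poly \<Rightarrow> 'k divisor \<Rightarrow> 'k divisor set" where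
  "divisor_class d f \<Delta> = principal_divisors d f #>\<^bsub>Div0 d f\<^esub> \<Delta>"

section \<open>Rank\<close>

definition int_independent :: "('g, 'm) monoid_scheme \<Rightarrow> 'g set \<Rightarrow> bool" where
  "int_independent G S \<longleftrightarrow> finite S \<and> S \<subseteq> carrier G \<and>
     (\<forall>c :: 'g \<Rightarrow> int. (\<Otimes>\<^bsub>G\<^esub>s\<in>S. s [^]\<^bsub>G\<^esub> c s) = \<one>\<^bsub>G\<^esub> \<longrightarrow> (\<forall>s\<in>S. c s = 0))"

text \<open>The rank of a subgroup \<open>H\<close> of the commutative group \<open>G\<close>.\<close>

definition subgroup_rank :: "('g, 'm) monoid_scheme \<Rightarrow> 'g set \<Rightarrow> enat" where
  "subgroup_rank G H = (SUP S\<in>{S. S \<subseteq> H \<and> int_independent G S}. enat (card S))"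

section \<open>Mordell--Weil groups over a field \<open>K\<close> of characteristic 0\<close>

abbreviation geom_Pic0 ::
    "'a::field_char_0 \<Rightarrow> 'a poly \<Rightarrow> 'a alg_closure divisor set monoid" where
  "geom_Pic0 d f \<equiv> Pic0 (to_ac d) (map_poly to_ac f)"

definition galois_group :: "('a::field_char_0 alg_closure \<Rightarrow> 'a alg_closure) set" where
  "galois_group =
     {\<sigma>. bij \<sigma> \<and> (\<forall>x y. \<sigma> (x + y) = \<sigma> x + \<sigma> y) \<and> (\<forall>x y. \<sigma> (x * y) = \<sigma> x * \<sigma> y) \<and>
         (\<forall>c. \<sigma> (to_ac c) = to_ac c)}"

definition map_divisor :: "('k \<Rightarrow> 'l) \<Rightarrow> 'k divisor \<Rightarrow> 'l divisor" where
  "map_divisor \<sigma> = frag_extend (\<lambda>P. frag_of (map_curve_point \<sigma> P))"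

text \<open>
  The \<open>K\<close>-rational points of the Jacobian: the Galois-invariant divisor classes of degree 0 of the
  curve over the algebraic closure.
\<close>

definition jacobian_points ::
    "'a::field_char_0 \<Rightarrow> 'a poly \<Rightarrow> 'a alg_closure divisor set set" where
  "jacobian_points d f =
     {C \<in> carrier (geom_Pic0 d f). \<forall>\<sigma>\<in>galois_group. map_divisor \<sigma> ` C = C}"

definition jacobian_rank :: "'a::field_char_0 \<Rightarrow> 'a poly \<Rightarrow> enat" where
  "jacobian_rank d f = subgroup_rank (geom_Pic0 d f) (jacobian_points d f)"

text \<open>
  An elliptic curve \<open>d y\<^sup>2 = f(x)\<close> over \<open>K\<close> comes with a \<open>K\<close>-rational point as origin, which for
  quartic \<open>f\<close> need not lie at infinity.
\<close>

definition elliptic_curve :: "'a::field_char_0 \<Rightarrow> 'a poly \<Rightarrow> 'a curve_point \<Rightarrow> bool" where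
  "elliptic_curve d f P0 \<longleftrightarrow>
     d \<noteq> 0 \<and> degree f \<in> {3, 4} \<and> squarefree f \<and> P0 \<in> curve_points d f"

text \<open>
  The group law on the set of \<open>K\<close>-rational points is the one transported along the injection
  \<open>P \<mapsto> [P] - [P0]\<close> into the group of divisor classes of degree 0.  The group of rational points is
  represented by its image.
\<close>

definition elliptic_group ::
    "'a::field_char_0 \<Rightarrow> 'a poly \<Rightarrow> 'a curve_point \<Rightarrow> 'a alg_closure divisor set set" where
  "elliptic_group d f P0 =
     (\<lambda>P. divisor_class (to_ac d) (map_poly to_ac f)
            (frag_of (map_curve_point to_ac P) - frag_of (map_curve_point to_ac P0)))
       ` curve_points d f"

definition elliptic_rank :: "'a::field_char_0 \<Rightarrow> 'a poly \<Rightarrow> 'a curve_point \<Rightarrow> enat" where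
  "elliptic_rank d f P0 = subgroup_rank (geom_Pic0 d f) (elliptic_group d f P0)"

section \<open>The field \<open>\<rat>(v\<^sub>1, v\<^sub>2, v\<^sub>3)\<close> and twists\<close>

type_synonym ratfun3 = "rat poly poly poly fract"

text \<open>The right-hand side of the \<open>2m\<close>-twist \<open>y\<^sup>2 = x\<^sup>m + \<alpha> D\<close> of \<open>y\<^sup>2 = x\<^sup>m + \<alpha>\<close>.\<close>

definition twist_poly :: "nat \<Rightarrow> rat \<Rightarrow> ratfun3 \<Rightarrow> ratfun3 poly" where
  "twist_poly m \<alpha> D = monom 1 m + [:of_rat \<alpha> * D:]"

end

theory Submission
  imports Defs "Jordan_Normal_Form.Char_Poly" "HOL-Library.Product_Plus"
begin

text \<open>
  Fix a variable \<open>t\<close>, put \<open>u = a t ^ m1\<close> and let \<open>\<xi>\<close> be the rational function, given by a variant of Heron's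
  formula, for which \<open>\<xi> + u\<^sup>2\<close>, \<open>\<xi> + b\<^sup>2\<close> and \<open>\<xi> + c\<^sup>2\<close> are all squares. With \<open>M = m1 m2 m3\<close>, take
  \<open>D = \<xi> ^ (M - 1)\<close>. Multiplying \<open>\<xi> + \<alpha>\<^sup>2 = \<beta>\<^sup>2\<close> by \<open>D\<close> turns it into a point on each of the three
  twisted curves, because \<open>D \<xi>\<close> is a power of \<open>\<xi>\<close> whose exponent \<open>M\<close> is divisible by every \<open>m\<^sub>i\<close>.

  Such a point \<open>(x\<^sub>0, y\<^sub>0)\<close> on \<open>y\<^sup>2 = x\<^sup>m + \<delta>\<close> has infinite order modulo the point at infinity. A function
  with divisor \<open>n\<close> times their difference is \<open>p(x) + q(x) y\<close> with \<open>p\<close> and \<open>q\<close> of bounded degree, and its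
  vanishing to order \<open>n\<close> is a homogeneous linear system whose determinant is a rational polynomial in
  \<open>\<theta> = x\<^sub>0\<^sup>m / y\<^sub>0\<^sup>2\<close>. At \<open>\<theta> = 1\<close> the curve degenerates to the cusp \<open>y\<^sup>2 = x\<^sup>m\<close>, where the
  determinant is visibly non-zero; since \<open>\<theta>\<close> specializes to \<open>1\<close> at \<open>t = 0\<close>, it is non-zero for our points as well.

  As \<open>M\<close> is odd, \<open>D\<close> is a square, so the twist of the elliptic curve is isomorphic to the constant curve.
  A function over the big field with divisor \<open>n (P - P\<^sub>0)\<close>, \<open>P\<close> and \<open>P\<^sub>0\<close> rational, yields one over the rationals upon
  applying a \<open>\<rat>\<close>-linear functional to its coefficients: orders at rational points do not drop.
\<close>

text \<open>Why \<theta> is the only parameter: in the coordinates \<open>x / x0\<close> and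
  \<open>y / y0\<close> the curve becomes \<open>Y ^ 2 = \<theta> X ^ m + 1 - \<theta>\<close> with
  marked point (1, 1). A constant point could well be torsion; the variable \<open>t\<close> gives
  \<xi> a pole at \<open>t = 0\<close>, so each
  \<open>\<theta> = \<xi> / (\<xi> + \<alpha> ^ 2)\<close> tends to 1 there. The power of
  \<open>t\<close> in the first constant is undone by rescaling \<open>x\<close> by
  \<open>t ^ 2\<close> and \<open>y\<close> by \<open>t ^ m1\<close>. Since
  \<open>vanishing_order\<close> is a definite description, orders must first be shown to exist.
  They are handled through powers of maximal ideals: membership is a statement about the generators
  of the ideal, and so can be carried along field automorphisms, the hyperelliptic involution and
  \<rat>-linear maps alike. The \<rat>-linear functional controls orders only at points that come
  from rational ones. At the other points the divisor is 0 and regularity is proved by bounding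
  degrees; an inequality between divisors of degree zero is then an equality.\<close>

section \<open>Local rings of \<open>y\<^sup>2 = F(x)\<close>\<close>

text \<open>The pair \<open>(p, q)\<close> stands for \<open>p(x) + q(x) y\<close>.\<close>

definition pair_mult ::
    "'k::comm_ring_1 poly \<Rightarrow> 'k poly \<times> 'k poly \<Rightarrow> 'k poly \<times> 'k poly \<Rightarrow> 'k poly \<times> 'k poly" where
  "pair_mult F u v = (fst u * fst v + snd u * snd v * F, fst u * snd v + snd u * fst v)"

definition pair_val :: "'k::comm_ring_1 \<Rightarrow> 'k \<Rightarrow> 'k poly \<times> 'k poly \<Rightarrow> 'k" where
  "pair_val a b u = poly (fst u) a + b * poly (snd u) a"

text \<open>Powers of the maximal ideal \<open>(x - a, y - b)\<close> of the point \<open>(a, b)\<close>.\<close>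

primrec ideal_power :: "'k::comm_ring_1 poly \<Rightarrow> 'k \<Rightarrow> 'k \<Rightarrow> nat \<Rightarrow> ('k poly \<times> 'k poly) set" where
  "ideal_power F a b 0 = UNIV"
| "ideal_power F a b (Suc n) =
     {pair_mult F ([:-a, 1:], 0) u + pair_mult F ([:-b:], 1) v | u v.
        u \<in> ideal_power F a b n \<and> v \<in> ideal_power F a b n}"

lemma pair_mult_assoc: "pair_mult F (pair_mult F u v) w = pair_mult F u (pair_mult F v w)"
  by (simp add: pair_mult_def algebra_simps)

lemma pair_mult_left_commute: "pair_mult F u (pair_mult F v w) = pair_mult F v (pair_mult F u w)"
  by (simp add: pair_mult_def algebra_simps)

lemma pair_mult_add_right: "pair_mult F u (v + w) = pair_mult F u v + pair_mult F u w"
  by (simp add: pair_mult_def prod_eq_iff algebra_simps)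

lemma pair_mult_add_left: "pair_mult F (v + w) u = pair_mult F v u + pair_mult F w u"
  by (simp add: pair_mult_def prod_eq_iff algebra_simps)

lemma pair_mult_1 [simp]: "pair_mult F (1, 0) u = u" "pair_mult F u (1, 0) = u"
  by (simp_all add: pair_mult_def)

lemma pair_mult_0 [simp]: "pair_mult F 0 u = 0" "pair_mult F u 0 = 0"
  by (simp_all add: pair_mult_def prod_eq_iff)

lemma pair_val_mult:
  assumes "b\<^sup>2 = poly F a"
  shows "pair_val a b (pair_mult F u v) = pair_val a b u * pair_val a b v"
proof -
  have "poly F a = b * b" using assms by (simp add: power2_eq_square)
  then show ?thesis by (simp add: pair_val_def pair_mult_def algebra_simps)
qed

lemma pair_val_add: "pair_val a b (u + v) = pair_val a b u + pair_val a b v"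
  by (simp add: pair_val_def algebra_simps)

lemma pair_val_1 [simp]: "pair_val a b (1, 0) = 1"
  by (simp add: pair_val_def)

lemma ideal_power_SucI:
  "u \<in> ideal_power F a b n \<Longrightarrow> v \<in> ideal_power F a b n \<Longrightarrow>
    pair_mult F ([:-a, 1:], 0) u + pair_mult F ([:-b:], 1) v \<in> ideal_power F a b (Suc n)"
  unfolding ideal_power.simps by blast

lemma ideal_power_SucE:
  assumes "w \<in> ideal_power F a b (Suc n)"
  obtains u v where "w = pair_mult F ([:-a, 1:], 0) u + pair_mult F ([:-b:], 1) v"
    "u \<in> ideal_power F a b n" "v \<in> ideal_power F a b n"
  using assms unfolding ideal_power.simps by blast

lemma ideal_power_add:
  "u \<in> ideal_power F a b n \<Longrightarrow> v \<in> ideal_power F a b n \<Longrightarrow> u + v \<in> ideal_power F a b n"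
proof (induction n arbitrary: u v)
  case (Suc n)
  from Suc.prems obtain u1 u2 v1 v2 where
    "u = pair_mult F ([:-a, 1:], 0) u1 + pair_mult F ([:-b:], 1) u2"
    "v = pair_mult F ([:-a, 1:], 0) v1 + pair_mult F ([:-b:], 1) v2"
    and *: "u1 \<in> ideal_power F a b n" "u2 \<in> ideal_power F a b n"
      "v1 \<in> ideal_power F a b n" "v2 \<in> ideal_power F a b n"
    by auto
  then have eq: "u + v = pair_mult F ([:-a, 1:], 0) (u1 + v1) + pair_mult F ([:-b:], 1) (u2 + v2)"
    by (simp add: pair_mult_add_right algebra_simps)
  show ?case unfolding eq by (intro ideal_power_SucI Suc.IH *)
qed auto

lemma ideal_power_mult:
  "u \<in> ideal_power F a b n \<Longrightarrow> pair_mult F w u \<in> ideal_power F a b n"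
proof (induction n arbitrary: u)
  case (Suc n)
  from Suc.prems obtain u1 u2 where
    "u = pair_mult F ([:-a, 1:], 0) u1 + pair_mult F ([:-b:], 1) u2"
    and *: "u1 \<in> ideal_power F a b n" "u2 \<in> ideal_power F a b n"
    by auto
  then have eq: "pair_mult F w u =
      pair_mult F ([:-a, 1:], 0) (pair_mult F w u1) + pair_mult F ([:-b:], 1) (pair_mult F w u2)"
    by (simp add: pair_mult_add_right pair_mult_left_commute)
  show ?case unfolding eq by (intro ideal_power_SucI Suc.IH *)
qed auto

text \<open>Modulo \<open>x - a\<close> the element becomes \<open>p(a) + q(a) y\<close>, and its
  vanishing at the point makes this \<open>q(a) (y - b)\<close>.\<close>

lemma ideal_power_1:
  assumes "pair_val a b u = 0"
  shows "u \<in> ideal_power F a b (Suc 0)"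
proof -
  obtain p q where u: "u = (p, q)" by fastforce
  define p' q' where "p' = p - [:poly p a:]" and "q' = q - [:poly q a:]"
  have "poly p' a = 0" "poly q' a = 0" by (simp_all add: p'_def q'_def)
  then obtain s t where st: "p' = [:-a, 1:] * s" "q' = [:-a, 1:] * t"
    by (metis dvd_def poly_eq_0_iff_dvd)
  have "[:poly p a:] = - [:b * poly q a:]"
    using assms by (simp add: u pair_val_def add_eq_0_iff2)
  moreover have "p = [:-a, 1:] * s + [:poly p a:]" "q = [:-a, 1:] * t + [:poly q a:]"
    using st by (simp_all add: p'_def q'_def diff_eq_eq)
  ultimately have eq: "u = pair_mult F ([:-a, 1:], 0) (s, t) + pair_mult F ([:-b:], 1) ([:poly q a:], 0)"
    by (simp add: u pair_mult_def prod_eq_iff del: mult_pCons_left)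
  show ?thesis by (subst eq, rule ideal_power_SucI) simp_all
qed

lemma ideal_power_Suc_mult:
  assumes "u \<in> ideal_power F a b n" "pair_val a b v = 0"
  shows "pair_mult F v u \<in> ideal_power F a b (Suc n)"
proof -
  obtain s t where "v = pair_mult F ([:-a, 1:], 0) s + pair_mult F ([:-b:], 1) t"
    using ideal_power_1[OF assms(2), of F] by (rule ideal_power_SucE)
  then have eq: "pair_mult F v u = pair_mult F ([:-a, 1:], 0) (pair_mult F s u)
      + pair_mult F ([:-b:], 1) (pair_mult F t u)"
    by (simp add: pair_mult_add_left pair_mult_assoc)
  show ?thesis unfolding eq by (intro ideal_power_SucI ideal_power_mult assms)
qed

text \<open>If \<open>h'\<close> inverts \<open>h\<close> modulo one power of the ideal, multiplying
  the error by \<open>1 - h i\<close>, with \<open>i\<close> the inverse of the value of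
  \<open>h\<close>, gains one more power. This later removes the denominators of local units without
  leaving the coordinate ring.\<close>

lemma ideal_power_inverse:
  fixes h :: "'k::field poly \<times> 'k poly"
  assumes "b\<^sup>2 = poly F a" "pair_val a b h \<noteq> 0"
  shows "\<exists>h'. (1, 0) - pair_mult F h h' \<in> ideal_power F a b n"
proof (induction n)
  case (Suc n)
  then obtain h' where h': "(1, 0) - pair_mult F h h' \<in> ideal_power F a b n" (is "?r \<in> _") ..
  define e where "e = pair_val a b h"
  define i where "i = ([:1/e:], 0 :: 'k poly)"
  have "pair_val a b ((1, 0) - pair_mult F h i) = 0"
    using assms by (simp add: pair_val_def i_def e_def pair_mult_def field_simps)
  from ideal_power_Suc_mult[OF h' this]
  have "pair_mult F ((1, 0) - pair_mult F h i) ?r \<in> ideal_power F a b (Suc n)" .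
  moreover have "pair_mult F ((1, 0) - pair_mult F h i) ?r
      = (1, 0) - pair_mult F h (h' + pair_mult F i ?r)"
    by (simp add: pair_mult_def prod_eq_iff algebra_simps)
  ultimately have "(1, 0) - pair_mult F h (h' + pair_mult F i ?r) \<in> ideal_power F a b (Suc n)"
    by (simp only:)
  then show ?case ..
qed auto

text \<open>Both affine charts of the curve are instances: \<open>c\<close> embeds the constants
  into the function field, \<open>x\<close> and \<open>y\<close> are the chart functions, and
  independence of 1 and \<open>y\<close> makes the evaluation of pairs injective.\<close>

locale quadratic_chart = comm_ring_hom c
  for c :: "'k::field_char_0 \<Rightarrow> 'l::field" +
  fixes x y :: 'l and F :: "'k poly"
  assumes y_square: "y\<^sup>2 = poly (map_poly c F) x"
    and independent: "poly (map_poly c p) x + poly (map_poly c q) x * y = 0 \<Longrightarrow> p = 0 \<and> q = 0"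
begin

sublocale poly_hom: map_poly_comm_ring_hom c ..

definition ev_poly :: "'k poly \<Rightarrow> 'l" where
  "ev_poly p = poly (map_poly c p) x"

lemma ev_poly_simps [simp]:
  "ev_poly 0 = 0" "ev_poly 1 = 1" "ev_poly (p + q) = ev_poly p + ev_poly q"
  "ev_poly (p - q) = ev_poly p - ev_poly q" "ev_poly (- p) = - ev_poly p"
  "ev_poly (p * q) = ev_poly p * ev_poly q" "ev_poly (p ^ n) = ev_poly p ^ n"
  "ev_poly (pCons r p) = c r + x * ev_poly p" "ev_poly (smult r p) = c r * ev_poly p"
  by (simp_all add: ev_poly_def hom_distribs)

definition ev :: "'k poly \<times> 'k poly \<Rightarrow> 'l" where
  "ev u = ev_poly (fst u) + ev_poly (snd u) * y"

lemma y_square': "y\<^sup>2 = ev_poly F"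
  by (simp add: ev_poly_def y_square)

lemma ev_mult: "ev (pair_mult F u v) = ev u * ev v"
proof -
  have "ev u * ev v = ev_poly (fst u) * ev_poly (fst v) + ev_poly (snd u) * ev_poly (snd v) * y\<^sup>2
      + (ev_poly (fst u) * ev_poly (snd v) + ev_poly (snd u) * ev_poly (fst v)) * y"
    unfolding ev_def by (simp add: algebra_simps power2_eq_square)
  then show ?thesis unfolding y_square' by (simp add: ev_def pair_mult_def)
qed

lemma ev_add: "ev (u + v) = ev u + ev v"
  by (simp add: ev_def algebra_simps)

lemma ev_1 [simp]: "ev (1, 0) = 1" and ev_0 [simp]: "ev 0 = 0"
  by (simp_all add: ev_def)

lemma ev_eq_0_iff [simp]: "ev u = 0 \<longleftrightarrow> u = 0"
  using independent[of "fst u" "snd u"] by (auto simp: ev_def ev_poly_def prod_eq_iff)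

lemma ev_eq_iff [simp]: "ev u = ev v \<longleftrightarrow> u = v"
proof -
  have "ev u - ev v = ev (u - v)" using ev_add[of "u - v" v] by simp
  then show ?thesis using ev_eq_0_iff[of "u - v"] by (metis right_minus_eq)
qed

end

locale smooth_point = quadratic_chart +
  fixes a b
  assumes on_curve: "b\<^sup>2 = poly F a"
    and smooth: "b = 0 \<Longrightarrow> poly (pderiv F) a \<noteq> 0"
begin

definition unif_pair where
  "unif_pair = (if b \<noteq> 0 then ([:-a, 1:], 0) else (0, 1 :: 'a poly))"

definition unif where
  "unif = (if b \<noteq> 0 then x - c a else y)"

lemma ev_unif_pair: "ev unif_pair = unif"
  by (simp add: unif_pair_def unif_def ev_def hom_uminus)

lemma unif_pair_nonzero: "unif_pair \<noteq> 0"
  by (simp add: unif_pair_def prod_eq_iff)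

lemma unif_nonzero [simp]: "unif \<noteq> 0"
  using unif_pair_nonzero ev_unif_pair ev_eq_0_iff by metis

lemma pair_val_unif [simp]: "pair_val a b unif_pair = 0"
  by (simp add: unif_pair_def pair_val_def)

lemma val_mult: "pair_val a b (pair_mult F u v) = pair_val a b u * pair_val a b v"
  by (rule pair_val_mult[OF on_curve])

lemma val_nonzero: "pair_val a b u \<noteq> 0 \<Longrightarrow> ev u \<noteq> 0"
  by (auto simp: pair_val_def)

text \<open>An equation without denominators, with units given by pairs instead of bivariate
  polynomials; \<open>vanishing_order_iff\<close> links it to
  \<open>vanishing_order\<close>.\<close>

definition has_order :: "int \<Rightarrow> 'b \<Rightarrow> bool" where
  "has_order n \<phi> \<longleftrightarrow> (\<exists>G H. pair_val a b G \<noteq> 0 \<and> pair_val a b H \<noteq> 0 \<and> \<phi> * ev H = ev G * unif powi n)"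

definition order_ge :: "nat \<Rightarrow> 'b \<Rightarrow> bool" where
  "order_ge n \<phi> \<longleftrightarrow> (\<exists>G H. pair_val a b H \<noteq> 0 \<and> \<phi> * ev H = ev G * unif ^ n)"

lemma has_order_1 [simp]: "has_order 0 1"
  unfolding has_order_def by (rule exI[of _ "(1, 0)"], rule exI[of _ "(1, 0)"]) simp

lemma has_order_nonzero:
  assumes "has_order n \<phi>"
  shows "\<phi> \<noteq> 0"
proof
  assume "\<phi> = 0"
  with assms obtain G where "pair_val a b G \<noteq> 0" "ev G * unif powi n = 0"
    unfolding has_order_def by auto
  with val_nonzero[of G] show False by (simp add: power_int_eq_0_iff del: ev_eq_0_iff)
qed

lemma has_order_mult:
  assumes "has_order m \<phi>" "has_order n \<psi>"
  shows "has_order (m + n) (\<phi> * \<psi>)"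
proof -
  from assms obtain G H G' H' where
    *: "pair_val a b G \<noteq> 0" "pair_val a b H \<noteq> 0" "\<phi> * ev H = ev G * unif powi m"
      "pair_val a b G' \<noteq> 0" "pair_val a b H' \<noteq> 0" "\<psi> * ev H' = ev G' * unif powi n"
    unfolding has_order_def by blast
  have "\<phi> * \<psi> * ev (pair_mult F H H') = (\<phi> * ev H) * (\<psi> * ev H')"
    by (simp add: ev_mult)
  also have "\<dots> = ev (pair_mult F G G') * unif powi (m + n)"
    by (simp add: *(3,6) ev_mult power_int_add)
  finally show ?thesis
    using *(1,2,4,5) unfolding has_order_def
    by (intro exI[of _ "pair_mult F G G'"] exI[of _ "pair_mult F H H'"]) (simp add: val_mult)
qed

lemma has_order_inverse:
  assumes "has_order n \<phi>"
  shows "has_order (- n) (inverse \<phi>)"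
proof -
  from assms obtain G H where
    *: "pair_val a b G \<noteq> 0" "pair_val a b H \<noteq> 0" "\<phi> * ev H = ev G * unif powi n"
    unfolding has_order_def by blast
  have "inverse \<phi> * ev G = ev H * unif powi (- n)"
    using *(3) has_order_nonzero[OF assms] by (simp add: power_int_minus field_simps)
  with * show ?thesis unfolding has_order_def by blast
qed

lemma has_order_divide:
  assumes "has_order m \<phi>" "has_order n \<psi>"
  shows "has_order (m - n) (\<phi> / \<psi>)"
  using has_order_mult[OF assms(1) has_order_inverse[OF assms(2)]] by (simp add: divide_inverse)

lemma has_order_power:
  assumes "has_order m \<phi>"
  shows "has_order (int n * m) (\<phi> ^ n)"
proof (induction n)
  case (Suc n)
  from has_order_mult[OF assms Suc.IH] show ?case by (simp add: algebra_simps)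
qed simp

lemma has_order_powi:
  assumes "has_order m \<phi>"
  shows "has_order (n * m) (\<phi> powi n)"
proof (cases "n \<ge> 0")
  case True
  with has_order_power[OF assms, of "nat n"] show ?thesis by (simp add: power_int_def)
next
  case False
  with has_order_inverse[OF has_order_power[OF assms, of "nat (- n)"]] show ?thesis
    by (simp add: power_int_def power_inverse)
qed

lemma has_order_unif: "has_order 1 unif"
  unfolding has_order_def by (rule exI[of _ "(1, 0)"], rule exI[of _ "(1, 0)"]) simp

lemma has_order_unit: "pair_val a b u \<noteq> 0 \<Longrightarrow> has_order 0 (ev u)"
  unfolding has_order_def by (rule exI[of _ u], rule exI[of _ "(1, 0)"]) simp

lemma unif_power_ev: "\<exists>w. unif ^ k = ev w"
proof (induction k)
  case 0
  then show ?case by (intro exI[of _ "(1, 0)"]) simp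
next
  case (Suc k)
  then obtain w where "unif ^ k = ev w" ..
  then show ?case
    by (intro exI[of _ "pair_mult F unif_pair w"]) (simp add: ev_mult ev_unif_pair)
qed

text \<open>Cross-multiplying the two representations would otherwise equate a unit with a multiple
  of the uniformizer, which evaluation at the point refutes.\<close>

lemma has_order_ge_imp_le:
  assumes "has_order m \<phi>" "order_ge n \<phi>"
  shows "int n \<le> m"
proof (rule ccontr)
  assume less: "\<not> int n \<le> m"
  from assms obtain G H G' H' where
    *: "pair_val a b G \<noteq> 0" "pair_val a b H \<noteq> 0" "\<phi> * ev H = ev G * unif powi m"
      "pair_val a b H' \<noteq> 0" "\<phi> * ev H' = ev G' * unif ^ n"
    unfolding has_order_def order_ge_def by blast
  define k where "k = nat (int n - m - 1)"
  have n: "int n = m + 1 + int k" using less by (simp add: k_def)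
  have "(\<phi> * ev H) * ev H' = (\<phi> * ev H') * ev H" by (simp add: mult_ac)
  then have "ev G * ev H' * unif powi m = ev G' * ev H * unif powi (int n)"
    by (simp add: *(3,5) mult_ac)
  also have "unif powi (int n) = unif powi m * (unif * unif ^ k)"
    by (simp add: n power_int_add)
  finally have eq: "ev G * ev H' = ev (pair_mult F G' H) * unif ^ k * unif"
    by (simp add: ev_mult mult_ac)
  obtain w where w: "unif ^ k = ev w"
    using unif_power_ev by blast
  from eq have "ev (pair_mult F G H') = ev (pair_mult F (pair_mult F (pair_mult F G' H) w) unif_pair)"
    by (simp only: ev_mult w ev_unif_pair)
  then have "pair_mult F G H' = pair_mult F (pair_mult F (pair_mult F G' H) w) unif_pair"
    by (rule iffD1[OF ev_eq_iff])
  from arg_cong[OF this, of "pair_val a b"] have "pair_val a b G * pair_val a b H' = 0"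
    unfolding val_mult by simp
  with *(1,4) show False by simp
qed

lemma has_order_imp_ge:
  assumes "has_order m \<phi>" "int n \<le> m"
  shows "order_ge n \<phi>"
proof -
  from assms obtain G H where
    *: "pair_val a b G \<noteq> 0" "pair_val a b H \<noteq> 0" "\<phi> * ev H = ev G * unif powi m"
    unfolding has_order_def by blast
  define k where "k = nat (m - int n)"
  have m: "m = int k + int n" using assms by (simp add: k_def)
  obtain w where w: "unif ^ k = ev w"
    using unif_power_ev by blast
  have "\<phi> * ev H = ev (pair_mult F G w) * unif ^ n"
    unfolding *(3) m power_int_add[OF disjI1[OF unif_nonzero]] by (simp add: ev_mult w[symmetric])
  with *(2) show ?thesis unfolding order_ge_def by blast
qed

text \<open>\<open>order_ge\<close> only knows natural exponents, so \<phi> is first multiplied by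
  the power of the uniformizer that moves the order \<open>k\<close> to 0.\<close>

lemma has_order_le:
  assumes "has_order k \<phi>" "has_order l \<phi>"
  shows "k \<le> l"
proof -
  have k: "has_order (k + (- k)) (\<phi> * unif powi (- k))"
    using has_order_mult[OF assms(1) has_order_powi[OF has_order_unif, of "- k"]] by simp
  have l: "has_order (l + (- k)) (\<phi> * unif powi (- k))"
    using has_order_mult[OF assms(2) has_order_powi[OF has_order_unif, of "- k"]] by simp
  have "order_ge 0 (\<phi> * unif powi (- k))"
    by (rule has_order_imp_ge[OF k]) simp
  from has_order_ge_imp_le[OF l this] show ?thesis by simp
qed

lemma has_order_unique: "has_order m \<phi> \<Longrightarrow> has_order n \<phi> \<Longrightarrow> m = n"
  by (rule order_antisym) (rule has_order_le; assumption)+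

lemma ramified_factor:
  assumes "b = 0"
  obtains F1 where "F = [:-a, 1:] * F1" "poly F1 a \<noteq> 0"
proof -
  have "poly F a = 0" using on_curve assms by simp
  then obtain F1 where F1: "F = [:-a, 1:] * F1" by (metis dvd_def poly_eq_0_iff_dvd)
  have "poly (pderiv F) a = poly F1 a"
    unfolding F1 pderiv_mult by (simp add: pderiv_pCons)
  with smooth[OF assms] F1 that show thesis by metis
qed

text \<open>A point with \<open>b = 0\<close> is a ramification point of \<open>x\<close>: there
  \<open>y\<close> is the uniformizer, and \<open>F = (x - a) F1\<close> turns into
  \<open>x - a = y ^ 2 / F1\<close> with \<open>F1\<close> a unit.\<close>

lemma has_order_x_minus:
  "has_order (if b = 0 then 2 else 1) (x - c a)"
proof (cases "b = 0")
  case True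
  obtain F1 where F1: "F = [:-a, 1:] * F1" "poly F1 a \<noteq> 0" using ramified_factor[OF True] .
  have "(x - c a) * ev (F1, 0) = ev (1, 0) * unif powi 2"
    unfolding unif_def using arg_cong[OF F1(1), of ev_poly] True
    by (simp add: ev_def y_square' hom_uminus algebra_simps)
  with F1(2) True show ?thesis
    unfolding has_order_def by (intro exI[of _ "(1,0)"] exI[of _ "(F1,0)"]) (simp add: pair_val_def)
next
  case False
  then show ?thesis using has_order_unif by (simp add: unif_def)
qed

text \<open>Common factors \<open>x - a\<close> of \<open>p\<close> and \<open>q\<close> are divided
  off by induction on the degrees. If the value at the point vanishes but \<open>q(a)\<close> does
  not, then for \<open>b \<noteq> 0\<close> the conjugate \<open>p - q y\<close> is a unit, so the
  order is that of the norm \<open>p ^ 2 - q ^ 2 F\<close>; for \<open>b = 0\<close> the order is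
  exactly 1.\<close>

lemma has_order_exists_pair: "u \<noteq> 0 \<Longrightarrow> \<exists>n::nat. has_order (int n) (ev u)"
proof (induction "degree (fst u) + degree (snd u)" arbitrary: u rule: less_induct)
  case less
  obtain p q where u: "u = (p, q)" by fastforce
  consider (both) "poly p a = 0" "poly q a = 0" | (unit) "pair_val a b u \<noteq> 0"
    | (conj) "pair_val a b u = 0" "poly q a \<noteq> 0"
    by (cases "poly q a = 0") (auto simp: pair_val_def u)
  then show ?case
  proof cases
    case both
    then obtain s t where st: "p = [:-a, 1:] * s" "q = [:-a, 1:] * t"
      by (metis dvd_def poly_eq_0_iff_dvd)
    have "(s, t) \<noteq> 0" using less.prems st by (auto simp: u prod_eq_iff)
    have deg: "degree ([:-a, 1:] * r) = (if r = 0 then 0 else degree r + 1)" for r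
      by (simp add: degree_mult_eq del: mult_pCons_left)
    have "degree (fst (s, t)) + degree (snd (s, t)) < degree (fst u) + degree (snd u)"
      using \<open>(s, t) \<noteq> 0\<close> unfolding u st fst_conv snd_conv deg by (auto simp: prod_eq_iff)
    from less.hyps[OF this \<open>(s, t) \<noteq> 0\<close>] obtain n where n: "has_order (int n) (ev (s, t))" ..
    have "(x - c a) * ev (s, t) = ev u"
      by (simp add: ev_def u st algebra_simps hom_uminus)
    with has_order_mult[OF has_order_x_minus n]
    have "has_order ((if b = 0 then 2 else 1) + int n) (ev u)" by simp
    moreover have "(if b = 0 then 2 else 1) + int n = int ((if b = 0 then 2 else 1) + n)" by simp
    ultimately have "has_order (int ((if b = 0 then 2 else 1) + n)) (ev u)" by (simp only:)
    then show ?thesis ..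
  next
    case unit
    then show ?thesis using has_order_unit by (intro exI[of _ 0]) simp
  next
    case conj
    show ?thesis
    proof (cases "b = 0")
      case False
      define N where "N = p\<^sup>2 - q\<^sup>2 * F"
      have N: "ev u * ev (p, - q) = ev (N, 0)"
        unfolding ev_mult[symmetric] ev_eq_iff
        by (simp add: pair_mult_def u N_def power2_eq_square algebra_simps)
      have val: "pair_val a b (p, - q) \<noteq> 0"
      proof
        assume "pair_val a b (p, - q) = 0"
        then have "poly p a - b * poly q a = 0" "poly p a + b * poly q a = 0"
          using conj(1) by (simp_all add: u pair_val_def)
        moreover have "2 * (b * poly q a) = (poly p a + b * poly q a) - (poly p a - b * poly q a)"
          by simp
        ultimately have "2 * (b * poly q a) = 0" by (simp only: diff_0_right)
        with conj(2) False show False by simp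
      qed
      have "N \<noteq> 0"
      proof
        assume "N = 0"
        then have "ev (N, 0) = 0" by (simp add: zero_prod_def)
        with N have "ev u = 0 \<or> ev (p, -q) = 0" by (simp only: mult_eq_0_iff)
        with less.prems val_nonzero[OF val] ev_eq_0_iff[of u] show False by blast
      qed
      then obtain M where M: "N = [:-a, 1:] ^ order a N * M" "poly M a \<noteq> 0"
        using order_decomp[of N a] unfolding poly_eq_0_iff_dvd by blast
      have "ev (N, 0) = ev (M, 0) * unif powi (int (order a N))"
        unfolding ev_def fst_conv snd_conv by (subst M(1)) (simp add: unif_def False hom_uminus)
      with N val M(2) have "has_order (int (order a N)) (ev u)"
        unfolding has_order_def by (intro exI[of _ "(M,0)"] exI[of _ "(p,-q)"]) (simp add: pair_val_def)
      then show ?thesis ..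
    next
      case True
      obtain F1 where F1: "F = [:-a, 1:] * F1" "poly F1 a \<noteq> 0" using ramified_factor[OF True] .
      have "poly p a = 0" using conj True by (simp add: u pair_val_def)
      then obtain s where s: "p = [:-a, 1:] * s" by (metis dvd_def poly_eq_0_iff_dvd)
      have up: "unif_pair = (0, 1)" unfolding unif_pair_def using True by simp
      \<comment> \<open>As \<open>p F1 = s F = s y ^ 2\<close>, a factor \<open>y\<close> splits off
        and leaves \<open>q F1 + s y\<close>, a unit at the point.\<close>
      have "pair_mult F u (F1, 0) = pair_mult F (q * F1, s) unif_pair" unfolding up
        by (simp add: pair_mult_def u s F1 mult_ac del: mult_pCons_left mult_pCons_right)
      then have "ev u * ev (F1, 0) = ev (q * F1, s) * unif powi 1"
        using ev_mult[of u "(F1, 0)"] ev_mult[of "(q * F1, s)" unif_pair]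
        by (simp add: ev_unif_pair)
      moreover have "pair_val a b (q * F1, s) \<noteq> 0" "pair_val a b (F1, 0) \<noteq> 0"
        using conj F1 True by (simp_all add: pair_val_def)
      ultimately have "has_order (int 1) (ev u)"
        unfolding has_order_def of_nat_1 by blast
      then show ?thesis ..
    qed
  qed
qed

lemma order_ge_add:
  assumes "order_ge n \<phi>" "order_ge n \<psi>"
  shows "order_ge n (\<phi> + \<psi>)"
proof -
  from assms obtain G H G' H' where
    *: "pair_val a b H \<noteq> 0" "\<phi> * ev H = ev G * unif ^ n"
      "pair_val a b H' \<noteq> 0" "\<psi> * ev H' = ev G' * unif ^ n"
    unfolding order_ge_def by blast
  have "(\<phi> + \<psi>) * ev (pair_mult F H H') = (\<phi> * ev H) * ev H' + (\<psi> * ev H') * ev H"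
    by (simp add: ev_mult algebra_simps)
  also have "\<dots> = ev (pair_mult F G H' + pair_mult F G' H) * unif ^ n"
    by (simp add: *(2,4) ev_mult ev_add algebra_simps)
  finally show ?thesis
    using *(1,3) unfolding order_ge_def
    by (intro exI[of _ "pair_mult F G H' + pair_mult F G' H"] exI[of _ "pair_mult F H H'"])
       (simp add: val_mult)
qed

lemma order_ge_mult:
  assumes "order_ge m \<phi>" "order_ge n \<psi>"
  shows "order_ge (m + n) (\<phi> * \<psi>)"
proof -
  from assms obtain G H G' H' where
    *: "pair_val a b H \<noteq> 0" "\<phi> * ev H = ev G * unif ^ m"
      "pair_val a b H' \<noteq> 0" "\<psi> * ev H' = ev G' * unif ^ n"
    unfolding order_ge_def by blast
  have "\<phi> * \<psi> * ev (pair_mult F H H') = (\<phi> * ev H) * (\<psi> * ev H')"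
    by (simp add: ev_mult)
  also have "\<dots> = ev (pair_mult F G G') * unif ^ (m + n)"
    by (simp add: *(2,4) ev_mult power_add)
  finally show ?thesis
    using *(1,3) unfolding order_ge_def
    by (intro exI[of _ "pair_mult F G G'"] exI[of _ "pair_mult F H H'"]) (simp add: val_mult)
qed

lemma order_ge_0: "order_ge 0 (ev u)"
  unfolding order_ge_def by (rule exI[of _ u], rule exI[of _ "(1, 0)"]) simp

lemma order_ge_1:
  assumes "pair_val a b u = 0"
  shows "order_ge 1 (ev u)"
proof (cases "u = 0")
  case True
  then show ?thesis
    unfolding order_ge_def by (intro exI[of _ 0] exI[of _ "(1,0)"]) simp
next
  case False
  then obtain n where n: "has_order (int n) (ev u)" using has_order_exists_pair by blast
  have "n \<noteq> 0"
  proof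
    assume "n = 0"
    with n obtain G H where "pair_val a b G \<noteq> 0" "ev u * ev H = ev G"
      unfolding has_order_def by auto
    with assms show False by (metis ev_mult ev_eq_iff val_mult mult_zero_left)
  qed
  with has_order_imp_ge[OF n] show ?thesis by simp
qed

text \<open>The valuation filtration is that of the powers of the maximal ideal. Such powers refer
  only to the generators \<open>x - a\<close> and \<open>y - b\<close>, so orders can be transported
  by maps that act on coefficients without acting on the function field.\<close>

lemma order_ge_iff_ideal: "order_ge n (ev u) \<longleftrightarrow> u \<in> ideal_power F a b n"
proof
  show "u \<in> ideal_power F a b n \<Longrightarrow> order_ge n (ev u)"
  proof (induction n arbitrary: u)
    case (Suc n)
    from Suc.prems obtain s t where
      u: "u = pair_mult F ([:-a, 1:], 0) s + pair_mult F ([:-b:], 1) t"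
      and *: "s \<in> ideal_power F a b n" "t \<in> ideal_power F a b n"
      by auto
    have "order_ge 1 (ev ([:-a, 1:], 0))" "order_ge 1 (ev ([:-b:], 1))"
      by (rule order_ge_1, simp add: pair_val_def)+
    from order_ge_mult[OF this(1) Suc.IH[OF *(1)]] order_ge_mult[OF this(2) Suc.IH[OF *(2)]]
    show ?case unfolding u ev_add ev_mult by (intro order_ge_add) simp_all
  qed (simp add: order_ge_0)
next
  have pow: "\<exists>w. w \<in> ideal_power F a b n \<and> ev w = unif ^ n" for n
  proof (induction n)
    case (Suc n)
    then obtain w where w: "w \<in> ideal_power F a b n" "ev w = unif ^ n" by blast
    from ideal_power_Suc_mult[OF w(1) pair_val_unif] w(2) show ?case
      by (intro exI[of _ "pair_mult F unif_pair w"]) (simp add: ev_mult ev_unif_pair)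
  qed (rule exI[of _ "(1,0)"], simp)
  assume "order_ge n (ev u)"
  then obtain G H where H: "pair_val a b H \<noteq> 0" and eq: "ev u * ev H = ev G * unif ^ n"
    unfolding order_ge_def by blast
  from pow obtain w where w: "w \<in> ideal_power F a b n" "ev w = unif ^ n" by blast
  from eq have "ev (pair_mult F u H) = ev (pair_mult F G w)" by (simp only: ev_mult w(2))
  then have uH: "pair_mult F u H = pair_mult F G w" by simp
  obtain h' where h': "(1, 0) - pair_mult F H h' \<in> ideal_power F a b n"
    using ideal_power_inverse[OF on_curve H] by blast
  have "u = pair_mult F u ((1, 0) - pair_mult F H h') + pair_mult F h' (pair_mult F u H)"
    by (simp add: pair_mult_def prod_eq_iff algebra_simps)
  also have "\<dots> \<in> ideal_power F a b n"
    unfolding uH by (intro ideal_power_add ideal_power_mult h' w)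
  finally show "u \<in> ideal_power F a b n" .
qed

lemma has_order_ideal:
  assumes "has_order m (ev u)"
  shows "int n \<le> m \<longleftrightarrow> u \<in> ideal_power F a b n"
  using has_order_imp_ge[OF assms] has_order_ge_imp_le[OF assms] order_ge_iff_ideal by blast

end

section \<open>Orders of functions on the curve\<close>

lemma comm_ring_hom_func_const: "comm_ring_hom func_const"
  by unfold_locales
     (simp_all add: func_const_def one_pCons[symmetric]
       flip: to_ac_add to_ac_mult to_fract_add to_fract_mult)

lemma add_fractions:
  fixes r1 r2 s1 s2 y :: "'l::field"
  shows "r2 \<noteq> 0 \<Longrightarrow> s2 \<noteq> 0 \<Longrightarrow> r1 / r2 + s1 / s2 * y = (r1 * s2 + s1 * r2 * y) / (r2 * s2)"
  by (simp add: field_simps)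

lemma func_const_eq_0_iff [simp]: "func_const a = 0 \<longleftrightarrow> a = 0"
  by (simp add: func_const_def)

lemma poly_func_const: "poly (map_poly func_const p) coord_x = to_ac (to_fract p)"
proof (induction p)
  case (pCons a p)
  have "pCons a p = [:a:] + [:0, 1:] * p" by simp
  then have "to_ac (to_fract (pCons a p)) = func_const a + coord_x * to_ac (to_fract p)"
    unfolding func_const_def coord_x_def to_ac_add[symmetric] to_ac_mult[symmetric]
      to_fract_add[symmetric] to_fract_mult[symmetric] by (simp only:)
  with pCons show ?case by (simp add: map_poly_pCons)
qed simp

lemma coord_x_nonzero [simp]: "coord_x \<noteq> 0"
  by (simp add: coord_x_def)

text \<open>The polynomial \<open>x ^ N p(1 / x)\<close>. The exponent is a parameter rather than
  the degree, so that reversal is linear and commutes with coefficientwise maps.\<close>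

definition rev_poly :: "nat \<Rightarrow> 'k::comm_ring_1 poly \<Rightarrow> 'k poly" where
  "rev_poly N p = (\<Sum>i\<le>N. monom (coeff p (N - i)) i)"

lemma coeff_rev_poly: "coeff (rev_poly N p) i = (if i \<le> N then coeff p (N - i) else 0)"
  by (simp add: rev_poly_def coeff_sum coeff_monom)

lemma rev_poly_0 [simp]: "rev_poly N 0 = 0"
  by (simp add: rev_poly_def)

lemma rev_poly_rev_poly: "degree p \<le> N \<Longrightarrow> rev_poly N (rev_poly N p) = p"
  by (rule poly_eqI) (auto simp: coeff_rev_poly coeff_eq_0)

lemma degree_rev_poly: "degree (rev_poly N p) \<le> N"
  by (rule degree_le) (simp add: coeff_rev_poly)

lemma rev_poly_eq_0_iff: "degree p \<le> N \<Longrightarrow> rev_poly N p = 0 \<longleftrightarrow> p = 0"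
  by (metis rev_poly_rev_poly rev_poly_0)

lemma poly_eq_sum_le:
  fixes p :: "'a::comm_ring_1 poly"
  assumes "degree p \<le> N"
  shows "poly p x = (\<Sum>i\<le>N. coeff p i * x ^ i)"
  unfolding poly_altdef by (rule sum.mono_neutral_left) (use assms in \<open>auto simp: coeff_eq_0\<close>)

lemma poly_rev_poly:
  fixes c :: "'k::field \<Rightarrow> 'l::field"
  assumes "degree p \<le> N" "x \<noteq> 0" "c 0 = 0"
  shows "poly (map_poly c p) x = x ^ N * poly (map_poly c (rev_poly N p)) (1 / x)"
proof -
  have "poly (map_poly c p) x = (\<Sum>i\<le>N. c (coeff p i) * x ^ i)"
    using assms by (subst poly_eq_sum_le[of _ N]) (auto simp: coeff_map_poly intro: order_trans[OF degree_map_poly_le])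
  also have "\<dots> = (\<Sum>i\<le>N. c (coeff p (N - i)) * x ^ (N - i))"
    by (rule sum.reindex_bij_witness[of _ "\<lambda>i. N - i" "\<lambda>i. N - i"]) auto
  also have "\<dots> = (\<Sum>i\<le>N. x ^ N * (c (coeff (rev_poly N p) i) * (1 / x) ^ i))"
    using assms by (intro sum.cong) (auto simp: coeff_rev_poly power_diff power_one_over field_simps)
  also have "\<dots> = x ^ N * poly (map_poly c (rev_poly N p)) (1 / x)"
    unfolding sum_distrib_left[symmetric]
    using assms degree_rev_poly[of N p]
    by (subst poly_eq_sum_le[of _ N]) (auto simp: coeff_map_poly intro: order_trans[OF degree_map_poly_le])
  finally show ?thesis .
qed

lemma eval2_pCons:
  "\<phi> 0 = 0 \<Longrightarrow> eval2 \<phi> (pCons g G) p = poly (map_poly \<phi> g) (fst p) + snd p * eval2 \<phi> G p"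
  by (cases "g = 0 \<and> G = 0") (auto simp: eval2_def map_poly_pCons)

section \<open>The hyperelliptic curve, its two charts and the existence of orders\<close>

locale hyperelliptic =
  fixes d :: "'k::{alg_closed_field, field_char_0}" and f :: "'k poly"
  assumes d_nonzero: "d \<noteq> 0" and degree_f: "3 \<le> degree f"
    and simple_roots: "poly f a = 0 \<Longrightarrow> poly (pderiv f) a \<noteq> 0"
begin

definition F :: "'k poly" where "F = smult (inverse d) f"

definition F_inf :: "'k poly" where "F_inf = rev_poly (2 * half_degree f) F"

lemma degree_F: "degree F = degree f"
  using d_nonzero by (simp add: F_def)

lemma half_degree_bounds: "degree f \<le> 2 * half_degree f" "2 * half_degree f \<le> degree f + 1"
  by (simp_all add: half_degree_def)

lemma coord_y_square: "(coord_y d f)\<^sup>2 = to_ac (to_fract F)"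
proof -
  obtain z :: "'k func" where "z ^ 2 = to_ac (to_fract f) / func_const d"
    using nth_root_exists[of 2] by auto
  then have "func_const d * z\<^sup>2 = to_ac (to_fract f)" using d_nonzero by simp
  then have *: "func_const d * (coord_y d f)\<^sup>2 = to_ac (to_fract f)"
    unfolding coord_y_def by (rule someI)
  have "f = [:d:] * F" using d_nonzero by (simp add: F_def)
  then have "to_ac (to_fract f) = func_const d * to_ac (to_fract F)"
    unfolding func_const_def to_ac_mult[symmetric] to_fract_mult[symmetric] by (simp only:)
  with * d_nonzero show ?thesis by simp
qed

text \<open>At a simple root of \<open>F\<close> the order of \<open>p ^ 2\<close> is even and that
  of \<open>F q ^ 2\<close> is odd. This makes 1 and \<open>y\<close> independent over the
  polynomials in \<open>x\<close>.\<close>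

lemma F_not_square:
  assumes "p\<^sup>2 = F * q\<^sup>2"
  shows "q = 0"
proof (rule ccontr)
  assume "q \<noteq> 0"
  have "F \<noteq> 0" using degree_F degree_f by auto
  obtain a where a: "poly F a = 0"
    using alg_closed_imp_poly_has_root[of F] degree_F degree_f by auto
  then obtain F1 where F1: "F = [:-a, 1:] * F1" by (metis dvd_def poly_eq_0_iff_dvd)
  have "poly (pderiv F) a = poly F1 a"
    unfolding F1 pderiv_mult by (simp add: pderiv_pCons)
  moreover have "poly (pderiv F) a \<noteq> 0"
    using simple_roots[of a] a d_nonzero by (simp add: F_def pderiv_smult)
  ultimately have "order a F1 = 0" by (intro order_0I) simp
  moreover have "order a F = order a [:-a, 1:] + order a F1"
    using \<open>F \<noteq> 0\<close> unfolding F1 by (rule order_mult)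
  ultimately have ordF: "order a F = 1" by (simp add: order_linear)
  have "F * q\<^sup>2 \<noteq> 0" "q\<^sup>2 \<noteq> 0" using \<open>F \<noteq> 0\<close> \<open>q \<noteq> 0\<close> by auto
  with assms have "p * p \<noteq> 0" by (simp add: power2_eq_square)
  have "order a (p * p) = order a (F * q\<^sup>2)" using assms by (simp add: power2_eq_square)
  also have "\<dots> = order a F + order a (q * q)"
    using order_mult[OF \<open>F * q\<^sup>2 \<noteq> 0\<close>, of a] by (simp add: power2_eq_square)
  finally have "order a p + order a p = 1 + (order a q + order a q)"
    using order_mult[OF \<open>p * p \<noteq> 0\<close>, of a] order_mult[of q q a] \<open>q \<noteq> 0\<close> ordF by simp
  then show False by presburger
qed

lemma independent_aff:
  assumes "to_ac (to_fract p) + to_ac (to_fract q) * coord_y d f = 0"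
  shows "p = 0 \<and> q = 0"
proof -
  have "to_ac (to_fract p) = - (to_ac (to_fract q) * coord_y d f)"
    using assms by (simp add: eq_neg_iff_add_eq_0)
  then have "(to_ac (to_fract p))\<^sup>2 = (to_ac (to_fract q))\<^sup>2 * (coord_y d f)\<^sup>2"
    by (simp add: power_mult_distrib)
  then have "to_ac (to_fract (p * p)) = to_ac (to_fract (F * (q * q)))"
    unfolding coord_y_square by (simp add: power2_eq_square mult_ac)
  then have "p\<^sup>2 = F * q\<^sup>2" by (simp only: to_ac_eq_iff to_fract_eq_iff power2_eq_square)
  then have "q = 0" by (rule F_not_square)
  with assms show ?thesis by simp
qed

sublocale aff: quadratic_chart func_const coord_x "coord_y d f" F
proof -
  interpret comm_ring_hom "func_const :: 'k \<Rightarrow> _" by (rule comm_ring_hom_func_const)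
  show "quadratic_chart func_const coord_x (coord_y d f) F"
    by unfold_locales (use independent_aff coord_y_square in \<open>simp_all add: poly_func_const\<close>)
qed

lemma aff_ev_poly: "aff.ev_poly p = to_ac (to_fract p)"
  by (simp add: aff.ev_poly_def poly_func_const)

lemma aff_ev: "aff.ev (p, q) = to_ac (to_fract p) + to_ac (to_fract q) * coord_y d f"
  by (simp add: aff.ev_def aff_ev_poly)

lemma inf_ev_raw:
  assumes "degree p \<le> N" "degree q + half_degree f \<le> N"
  shows "aff.ev (p, q) = coord_x ^ N * (poly (map_poly func_const (rev_poly N p)) (1 / coord_x)
     + poly (map_poly func_const (rev_poly (N - half_degree f) q)) (1 / coord_x)
       * (coord_y d f / coord_x ^ half_degree f))"
proof -
  have "aff.ev_poly p = coord_x ^ N * poly (map_poly func_const (rev_poly N p)) (1 / coord_x)"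
    unfolding aff.ev_poly_def by (rule poly_rev_poly) (use assms in simp_all)
  moreover have "aff.ev_poly q = coord_x ^ (N - half_degree f)
      * poly (map_poly func_const (rev_poly (N - half_degree f) q)) (1 / coord_x)"
    unfolding aff.ev_poly_def by (rule poly_rev_poly) (use assms in simp_all)
  moreover have "coord_x ^ N = (coord_x :: 'k func) ^ (N - half_degree f) * coord_x ^ half_degree f"
    using assms by (simp flip: power_add)
  ultimately show ?thesis by (simp add: aff.ev_def algebra_simps)
qed

sublocale inf: quadratic_chart func_const "1 / coord_x" "coord_y d f / coord_x ^ half_degree f" F_inf
proof -
  interpret comm_ring_hom "func_const :: 'k \<Rightarrow> _" by (rule comm_ring_hom_func_const)
  show "quadratic_chart func_const (1 / coord_x) (coord_y d f / coord_x ^ half_degree f) F_inf"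
  proof unfold_locales
    have "poly (map_poly func_const F) coord_x
        = coord_x ^ (2 * half_degree f) * poly (map_poly func_const F_inf) (1 / coord_x)"
      unfolding F_inf_def
      by (rule poly_rev_poly) (use half_degree_bounds degree_F in simp_all)
    moreover have "(coord_y d f)\<^sup>2 = poly (map_poly func_const F) coord_x"
      by (rule aff.y_square)
    ultimately show "(coord_y d f / coord_x ^ half_degree f)\<^sup>2 = poly (map_poly func_const F_inf) (1 / coord_x)"
      by (simp add: power_divide power_mult[symmetric] mult.commute)
  next
    fix p q :: "'k poly"
    assume 0: "poly (map_poly func_const p) (1 / coord_x)
      + poly (map_poly func_const q) (1 / coord_x) * (coord_y d f / coord_x ^ half_degree f) = 0"
    define n where "n = degree p + degree q"
    \<comment> \<open>Reversal clears the powers of \<open>1 / x\<close>; \<open>q\<close> needs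
      \<open>half_degree f\<close> fewer of them, because \<open>coord_y\<close> already comes
      divided by that power of \<open>x\<close>.\<close>
    define p' q' where "p' = rev_poly (n + half_degree f) p" and "q' = rev_poly n q"
    have deg: "degree p' \<le> n + half_degree f" "degree q' + half_degree f \<le> n + half_degree f"
      by (simp_all add: p'_def q'_def degree_rev_poly)
    have "rev_poly (n + half_degree f) p' = p" "rev_poly (n + half_degree f - half_degree f) q' = q"
      by (simp_all add: p'_def q'_def rev_poly_rev_poly n_def)
    with inf_ev_raw[OF deg] 0 have "aff.ev (p', q') = 0" by simp
    then have "p' = 0" "q' = 0" by (simp_all only: aff.ev_eq_0_iff prod_eq_iff fst_zero snd_zero fst_conv snd_conv)
    then show "p = 0 \<and> q = 0"
      by (simp add: p'_def q'_def rev_poly_eq_0_iff n_def)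
  qed
qed

lemma inf_ev:
  assumes "degree p \<le> N" "degree q + half_degree f \<le> N"
  shows "aff.ev (p, q) = coord_x ^ N * inf.ev (rev_poly N p, rev_poly (N - half_degree f) q)"
  using inf_ev_raw[OF assms] by (simp add: inf.ev_def inf.ev_poly_def)

definition chart_poly :: "'k curve_point \<Rightarrow> 'k poly" where
  "chart_poly P = (case P of Affine _ _ \<Rightarrow> F | Infinite _ \<Rightarrow> F_inf)"

lemma affine_in_curve: "Affine a b \<in> curve_points d f \<longleftrightarrow> b\<^sup>2 = poly F a"
  using d_nonzero by (auto simp: curve_points_def F_def field_simps)

lemma infinite_in_curve: "Infinite w \<in> curve_points d f \<longleftrightarrow> w\<^sup>2 = coeff F (2 * half_degree f)"
  using d_nonzero by (auto simp: curve_points_def F_def field_simps)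

lemma quadratic_chart_chart:
  "quadratic_chart func_const (fst (chart_functions d f P)) (snd (chart_functions d f P)) (chart_poly P)"
  by (cases P) (simp_all add: chart_poly_def aff.quadratic_chart_axioms inf.quadratic_chart_axioms)

lemma smooth_point_affine:
  assumes "Affine a b \<in> curve_points d f"
  shows "smooth_point func_const coord_x (coord_y d f) F a b"
proof unfold_locales
  show b2: "b\<^sup>2 = poly F a" using assms by (simp add: affine_in_curve)
  show "poly (pderiv F) a \<noteq> 0" if "b = 0"
    using b2 that d_nonzero simple_roots[of a] by (auto simp: F_def pderiv_smult)
qed

lemma poly_F_inf_0: "poly F_inf 0 = coeff F (2 * half_degree f)"
  by (simp add: poly_0_coeff_0 F_inf_def coeff_rev_poly)

lemma smooth_point_infinite:
  assumes "Infinite w \<in> curve_points d f"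
  shows "smooth_point func_const (1 / coord_x) (coord_y d f / coord_x ^ half_degree f) F_inf 0 w"
proof unfold_locales
  show w2: "w\<^sup>2 = poly F_inf 0" using assms by (simp add: infinite_in_curve poly_F_inf_0)
  show "poly (pderiv F_inf) 0 \<noteq> 0" if "w = 0"
  proof -
    have "coeff F (2 * half_degree f) = 0" using w2 that by (simp add: poly_F_inf_0)
    then have "degree F \<noteq> 2 * half_degree f" using degree_F degree_f
      by (metis leading_coeff_0_iff degree_0 not_numeral_le_zero)
    then have "degree F = 2 * half_degree f - 1" using half_degree_bounds degree_F by linarith
    moreover have "F \<noteq> 0" using degree_F degree_f by auto
    ultimately have "coeff F (2 * half_degree f - 1) \<noteq> 0" by (metis leading_coeff_0_iff)
    moreover have "coeff F_inf 1 = coeff F (2 * half_degree f - 1)"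
      using half_degree_bounds degree_f by (simp add: F_inf_def coeff_rev_poly)
    ultimately show ?thesis by (simp add: poly_0_coeff_0 coeff_pderiv)
  qed
qed

lemma smooth_point_chart:
  "P \<in> curve_points d f \<Longrightarrow>
    smooth_point func_const (fst (chart_functions d f P)) (snd (chart_functions d f P))
      (chart_poly P) (fst (chart_values P)) (snd (chart_values P))"
  by (cases P) (simp_all add: chart_poly_def smooth_point_affine smooth_point_infinite)

definition has_ord :: "'k curve_point \<Rightarrow> int \<Rightarrow> 'k func \<Rightarrow> bool" where
  "has_ord P = smooth_point.has_order func_const (fst (chart_functions d f P))
     (snd (chart_functions d f P)) (fst (chart_values P)) (snd (chart_values P))"

definition chart_ev :: "'k curve_point \<Rightarrow> 'k poly \<times> 'k poly \<Rightarrow> 'k func" where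
  "chart_ev P = quadratic_chart.ev func_const (fst (chart_functions d f P)) (snd (chart_functions d f P))"

definition chart_val :: "'k curve_point \<Rightarrow> 'k poly \<times> 'k poly \<Rightarrow> 'k" where
  "chart_val P = pair_val (fst (chart_values P)) (snd (chart_values P))"

text \<open>Local units are quotients of arbitrary bivariate polynomials. Horner's scheme and
  \<open>y ^ 2 = F\<close> reduce these to pairs, and since the point lies on the curve the same
  reduction is valid for the values.\<close>

lemma eval2_reduce:
  assumes P: "P \<in> curve_points d f"
  shows "\<exists>u. eval2 func_const G (chart_functions d f P) = chart_ev P u \<and>
    eval2 id G (chart_values P) = chart_val P u"
proof -
  interpret smooth_point func_const "fst (chart_functions d f P)" "snd (chart_functions d f P)"
      "chart_poly P" "fst (chart_values P)" "snd (chart_values P)"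
    by (rule smooth_point_chart[OF P])
  show ?thesis
  proof (induction G)
    case 0
    then show ?case
      by (intro exI[of _ 0]) (simp add: eval2_def chart_ev_def chart_val_def pair_val_def)
  next
    case (pCons g G)
    then obtain u where u: "eval2 func_const G (chart_functions d f P) = chart_ev P u"
      "eval2 id G (chart_values P) = chart_val P u" by blast
    define v where "v = (g, 0) + pair_mult (chart_poly P) (0, 1) u"
    have "eval2 func_const (pCons g G) (chart_functions d f P) = chart_ev P v"
      using u(1) by (simp add: eval2_pCons v_def chart_ev_def ev_add ev_mult ev_def[of "(g, 0)"]
          ev_def[of "(0, 1)"] ev_poly_def del: split_paired_Ex)
    moreover have "eval2 id (pCons g G) (chart_values P) = chart_val P v"
      using u(2) by (simp add: eval2_pCons v_def chart_val_def pair_val_add val_mult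
          pair_val_def[of _ _ "(g, 0)"] pair_val_def[of _ _ "(0, 1)"])
    ultimately show ?case by blast
  qed
qed

lemma eval2_linear:
  "eval2 func_const [:p, q:] (chart_functions d f P) = chart_ev P (p, q)"
  "eval2 id [:p, q:] (chart_values P) = chart_val P (p, q)"
proof -
  interpret quadratic_chart func_const "fst (chart_functions d f P)" "snd (chart_functions d f P)"
      "chart_poly P"
    by (rule quadratic_chart_chart)
  show "eval2 func_const [:p, q:] (chart_functions d f P) = chart_ev P (p, q)"
    by (simp add: eval2_pCons eval2_def[of _ 0] chart_ev_def ev_def ev_poly_def mult.commute)
  show "eval2 id [:p, q:] (chart_values P) = chart_val P (p, q)"
    by (simp add: eval2_pCons eval2_def[of _ 0] chart_val_def pair_val_def)
qed

lemma local_unit_iff: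
  assumes P: "P \<in> curve_points d f"
  shows "local_unit d f P u \<longleftrightarrow>
    (\<exists>G H. chart_val P G \<noteq> 0 \<and> chart_val P H \<noteq> 0 \<and> u = chart_ev P G / chart_ev P H)"
proof
  assume "local_unit d f P u"
  then show "\<exists>G H. chart_val P G \<noteq> 0 \<and> chart_val P H \<noteq> 0 \<and> u = chart_ev P G / chart_ev P H"
    unfolding local_unit_def using eval2_reduce[OF P] by metis
next
  assume "\<exists>G H. chart_val P G \<noteq> 0 \<and> chart_val P H \<noteq> 0 \<and> u = chart_ev P G / chart_ev P H"
  then obtain p q p' q' where
    "chart_val P (p, q) \<noteq> 0" "chart_val P (p', q') \<noteq> 0" "u = chart_ev P (p, q) / chart_ev P (p', q')"
    by auto
  then show "local_unit d f P u"
    unfolding local_unit_def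
    by (intro exI[of _ "[:p, q:]"] exI[of _ "[:p', q':]"]) (simp only: eval2_linear simp_thms)
qed

text \<open>Together with \<open>has_ord_unique\<close> this makes the definite description in
  \<open>vanishing_order\<close> proper as soon as some order exists.\<close>

lemma vanishing_order_iff:
  assumes P: "P \<in> curve_points d f"
  shows "(\<exists>u. local_unit d f P u \<and> \<phi> = u * uniformizer d f P powi n) \<longleftrightarrow> has_ord P n \<phi>"
proof -
  interpret smooth_point func_const "fst (chart_functions d f P)" "snd (chart_functions d f P)"
      "chart_poly P" "fst (chart_values P)" "snd (chart_values P)"
    by (rule smooth_point_chart[OF P])
  have unif: "uniformizer d f P = unif"
    by (simp add: uniformizer_def unif_def)
  have eq: "\<phi> = chart_ev P G / chart_ev P H * unif powi n \<longleftrightarrow> \<phi> * ev H = ev G * unif powi n"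
    if "chart_val P H \<noteq> 0" for G H
  proof -
    have "ev H \<noteq> 0" using val_nonzero[of H] that by (simp only: chart_val_def simp_thms)
    then show ?thesis unfolding chart_ev_def times_divide_eq_left by (rule nonzero_eq_divide_eq)
  qed
  show ?thesis
    unfolding local_unit_iff[OF P] unif has_ord_def has_order_def chart_val_def[symmetric]
    using eq by blast
qed

lemma has_ord_unique:
  "P \<in> curve_points d f \<Longrightarrow> has_ord P m \<phi> \<Longrightarrow> has_ord P n \<phi> \<Longrightarrow> m = n"
  unfolding has_ord_def using smooth_point.has_order_unique[OF smooth_point_chart] by blast

lemma vanishing_order_eqI:
  assumes "P \<in> curve_points d f" "has_ord P n \<phi>"
  shows "vanishing_order d f P \<phi> = n"
  unfolding vanishing_order_def vanishing_order_iff[OF assms(1)]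
  using assms has_ord_unique by blast

lemma has_ord_mult:
  "P \<in> curve_points d f \<Longrightarrow> has_ord P m \<phi> \<Longrightarrow> has_ord P n \<psi> \<Longrightarrow> has_ord P (m + n) (\<phi> * \<psi>)"
  unfolding has_ord_def by (rule smooth_point.has_order_mult[OF smooth_point_chart])

lemma has_ord_divide:
  "P \<in> curve_points d f \<Longrightarrow> has_ord P m \<phi> \<Longrightarrow> has_ord P n \<psi> \<Longrightarrow> has_ord P (m - n) (\<phi> / \<psi>)"
  unfolding has_ord_def by (rule smooth_point.has_order_divide[OF smooth_point_chart])

lemma has_ord_power:
  "P \<in> curve_points d f \<Longrightarrow> has_ord P m \<phi> \<Longrightarrow> has_ord P (int n * m) (\<phi> ^ n)"
  unfolding has_ord_def by (rule smooth_point.has_order_power[OF smooth_point_chart])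

lemma has_ord_1: "P \<in> curve_points d f \<Longrightarrow> has_ord P 0 1"
  unfolding has_ord_def by (rule smooth_point.has_order_1[OF smooth_point_chart])

lemma has_ord_nonzero: "P \<in> curve_points d f \<Longrightarrow> has_ord P m \<phi> \<Longrightarrow> \<phi> \<noteq> 0"
  unfolding has_ord_def by (rule smooth_point.has_order_nonzero[OF smooth_point_chart])

lemma has_ord_exists_chart:
  "P \<in> curve_points d f \<Longrightarrow> u \<noteq> 0 \<Longrightarrow> \<exists>n::nat. has_ord P (int n) (chart_ev P u)"
  unfolding has_ord_def chart_ev_def by (rule smooth_point.has_order_exists_pair[OF smooth_point_chart])

lemma has_ord_chart_unit:
  "P \<in> curve_points d f \<Longrightarrow> chart_val P u \<noteq> 0 \<Longrightarrow> has_ord P 0 (chart_ev P u)"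
  unfolding has_ord_def chart_ev_def chart_val_def
  by (rule smooth_point.has_order_unit[OF smooth_point_chart])

lemma has_ord_x_minus:
  assumes "Affine a b \<in> curve_points d f"
  shows "has_ord (Affine a b) (if b = 0 then 2 else 1) (coord_x - func_const a)"
  using smooth_point.has_order_x_minus[OF smooth_point_affine[OF assms]] by (simp add: has_ord_def)

lemma has_ord_coord_x:
  assumes "Infinite w \<in> curve_points d f"
  shows "has_ord (Infinite w) (if w = 0 then -2 else -1) coord_x"
proof -
  have "has_ord (Infinite w) (if w = 0 then 2 else 1) (1 / coord_x)"
    using smooth_point.has_order_x_minus[OF smooth_point_infinite[OF assms]] by (simp add: has_ord_def)
  from has_ord_divide[OF assms has_ord_1[OF assms] this] show ?thesis
    by (simp split: if_splits)
qed

lemma chart_ev_affine: "chart_ev (Affine a b) = aff.ev"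
  by (simp add: chart_ev_def)

lemma chart_ev_infinite: "chart_ev (Infinite w) = inf.ev"
  by (simp add: chart_ev_def)

lemma has_ord_exists_ev:
  assumes P: "P \<in> curve_points d f" and u: "u \<noteq> 0"
  shows "\<exists>n. has_ord P n (aff.ev u)"
proof (cases P)
  case (Affine a b)
  then show ?thesis using has_ord_exists_chart[OF P u] by (auto simp: chart_ev_affine)
next
  case (Infinite w)
  obtain p q where pq: "u = (p, q)" by fastforce
  define N where "N = degree p + degree q + half_degree f"
  define v where "v = (rev_poly N p, rev_poly (N - half_degree f) q)"
  have ev: "aff.ev u = coord_x ^ N * inf.ev v"
    unfolding pq v_def by (rule inf_ev) (simp_all add: N_def)
  have "v \<noteq> 0" using u ev by auto
  then obtain n where "has_ord P (int n) (inf.ev v)"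
    using has_ord_exists_chart[OF P, of v] unfolding Infinite chart_ev_infinite by blast
  moreover have "\<exists>m. has_ord P m (coord_x ^ N)"
    using has_ord_power[OF P, of _ coord_x] has_ord_coord_x P Infinite by blast
  ultimately show ?thesis unfolding ev using has_ord_mult[OF P] by blast
qed

lemma function_field_repr:
  assumes "\<phi> \<in> function_field d f"
  obtains u w where "w \<noteq> 0" "\<phi> = aff.ev u / aff.ev (w, 0)"
proof -
  from assms obtain r s where \<phi>: "\<phi> = to_ac r + to_ac s * coord_y d f"
    by (auto simp: function_field_def)
  obtain r1 r2 where r: "r2 \<noteq> 0" "r = to_fract r1 / to_fract r2"
    by (cases r) (auto simp: Fract_conv_to_fract)
  obtain s1 s2 where s: "s2 \<noteq> 0" "s = to_fract s1 / to_fract s2"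
    by (cases s) (auto simp: Fract_conv_to_fract)
  have "\<phi> = aff.ev (r1 * s2, s1 * r2) / aff.ev (r2 * s2, 0)"
    unfolding \<phi> r(2) s(2) aff_ev to_ac_divide to_fract_mult to_ac_mult
    using add_fractions[of "to_ac (to_fract r2)" "to_ac (to_fract s2)"] r(1) s(1)
    by (simp only: to_ac_eq_0_iff to_fract_eq_0_iff to_fract_0 to_ac_0 mult_zero_left add_0_right not_False_eq_True)
  moreover have "r2 * s2 \<noteq> 0" using r(1) s(1) by simp
  ultimately show thesis by (rule that[rotated])
qed

lemma ev_in_function_field: "aff.ev u / aff.ev (w, 0) \<in> function_field d f"
proof -
  obtain p q where u: "u = (p, q)" by fastforce
  have "aff.ev u / aff.ev (w, 0) = to_ac (to_fract p / to_fract w) + to_ac (to_fract q / to_fract w) * coord_y d f"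
    by (simp add: u aff_ev add_divide_distrib)
  then show ?thesis unfolding function_field_def by blast
qed

lemma has_ord_exists:
  assumes P: "P \<in> curve_points d f" and \<phi>: "\<phi> \<in> function_field d f" "\<phi> \<noteq> 0"
  shows "has_ord P (vanishing_order d f P \<phi>) \<phi>"
proof -
  obtain u w where uw: "w \<noteq> 0" "\<phi> = aff.ev u / aff.ev (w, 0)"
    using function_field_repr[OF \<phi>(1)] .
  have "u \<noteq> 0" using uw \<phi>(2) by auto
  moreover have "(w, 0) \<noteq> 0" using uw(1) by (simp add: prod_eq_iff)
  ultimately obtain m n where "has_ord P m (aff.ev u)" "has_ord P n (aff.ev (w, 0))"
    using has_ord_exists_ev[OF P] by metis
  then have "has_ord P (m - n) \<phi>" unfolding uw(2) by (rule has_ord_divide[OF P])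
  then show ?thesis using vanishing_order_eqI[OF P] by simp
qed

end

section \<open>Automorphisms and the involution acting on orders; principal divisors have degree
  zero\<close>

lemma sum_order_eq_degree:
  fixes g :: "'k::alg_closed_field poly"
  assumes "finite A"
  shows "g \<noteq> 0 \<Longrightarrow> {a. poly g a = 0} \<subseteq> A \<Longrightarrow> (\<Sum>a\<in>A. order a g) = degree g"
proof (induction "degree g" arbitrary: g)
  case 0
  then obtain e where "g = [:e:]" by (metis degree_eq_zeroE)
  with 0 have "order a g = 0" for a by (intro order_0I) auto
  with 0 show ?case by simp
next
  case (Suc n)
  then obtain r where r: "poly g r = 0" using alg_closed_imp_poly_has_root[of g] by auto
  then obtain g1 where g1: "g = [:-r, 1:] * g1" by (metis dvd_def poly_eq_0_iff_dvd)
  have "g1 \<noteq> 0" using Suc.prems g1 by auto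
  have deg: "degree g = Suc (degree g1)"
    unfolding g1 using \<open>g1 \<noteq> 0\<close> by (subst degree_mult_eq) auto
  have IH: "(\<Sum>a\<in>A. order a g1) = degree g1"
    using Suc.hyps(1)[of g1] Suc.hyps(2) deg Suc.prems(2) \<open>g1 \<noteq> 0\<close> unfolding g1 by auto
  have "r \<in> A" using r Suc.prems by auto
  have "order a g = (if a = r then 1 else 0) + order a g1" for a
  proof -
    have "order a g = order a [:-r, 1:] + order a g1"
      using Suc.prems(1) unfolding g1 by (rule order_mult)
    then show ?thesis by (simp add: order_linear')
  qed
  then have "(\<Sum>a\<in>A. order a g) = (\<Sum>a\<in>A. if a = r then 1 else 0) + (\<Sum>a\<in>A. order a g1)"
    by (simp add: sum.distrib)
  also have "(\<Sum>a\<in>A. if a = r then 1 else 0) = (1::nat)"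
    using assms \<open>r \<in> A\<close> by simp
  finally show ?case using IH deg by simp
qed

text \<open>
  The scalar \<open>s\<close> satisfies \<open>s\<^sup>2 = 1\<close> below: field automorphisms are the case \<open>s = 1\<close>, the hyperelliptic involution
  is \<open>\<sigma> = id\<close>, \<open>s = -1\<close>.
\<close>

definition twist_pair :: "('k::comm_ring_1 \<Rightarrow> 'k) \<Rightarrow> 'k \<Rightarrow> 'k poly \<times> 'k poly \<Rightarrow> 'k poly \<times> 'k poly" where
  "twist_pair \<sigma> s u = (map_poly \<sigma> (fst u), smult s (map_poly \<sigma> (snd u)))"

definition twist_point :: "('k::comm_ring_1 \<Rightarrow> 'k) \<Rightarrow> 'k \<Rightarrow> 'k curve_point \<Rightarrow> 'k curve_point" where
  "twist_point \<sigma> s P = (case P of Affine a b \<Rightarrow> Affine (\<sigma> a) (s * \<sigma> b) | Infinite w \<Rightarrow> Infinite (s * \<sigma> w))"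

lemma twist_point_1: "twist_point \<sigma> 1 = map_curve_point \<sigma>"
  by (rule ext) (simp add: twist_point_def split: curve_point.split)

lemma map_poly_smult_hom:
  assumes "comm_ring_hom \<sigma>"
  shows "map_poly \<sigma> (smult s p) = smult (\<sigma> s) (map_poly \<sigma> p)"
proof -
  interpret comm_ring_hom \<sigma> by fact
  show ?thesis by (rule poly_eqI) (simp add: coeff_map_poly hom_mult)
qed

lemma ideal_power_twist:
  assumes "comm_ring_hom \<sigma>" "s * s = 1"
  shows "u \<in> ideal_power F a b n \<Longrightarrow> twist_pair \<sigma> s u \<in> ideal_power (map_poly \<sigma> F) (\<sigma> a) (s * \<sigma> b) n"
proof (induction n arbitrary: u)
  case (Suc n)
  interpret \<sigma>: comm_ring_hom \<sigma> by fact
  interpret map_poly_comm_ring_hom \<sigma> ..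
  from Suc.prems obtain v w where uvw: "u = pair_mult F ([:-a, 1:], 0) v + pair_mult F ([:-b:], 1) w"
    and *: "v \<in> ideal_power F a b n" "w \<in> ideal_power F a b n" by (rule ideal_power_SucE)
  have ss: "smult s (smult s p) = p" for p using assms(2) by (simp add: smult_smult)
  \<comment> \<open>The generator \<open>y - b\<close> is sent to \<open>s y - \<sigma> b\<close>,
    which is \<open>s (y - s \<sigma> b)\<close> by \<open>s * s = 1\<close>; the factor
    \<open>s\<close> goes into the cofactor.\<close>
  have eq: "twist_pair \<sigma> s u = pair_mult (map_poly \<sigma> F) ([:- \<sigma> a, 1:], 0) (twist_pair \<sigma> s v)
      + pair_mult (map_poly \<sigma> F) ([:- (s * \<sigma> b):], 1) (pair_mult (map_poly \<sigma> F) ([:s:], 0) (twist_pair \<sigma> s w))"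
    using assms(2)
    by (simp add: uvw twist_pair_def pair_mult_def prod_eq_iff hom_distribs \<sigma>.hom_uminus map_poly_smult_hom[OF assms(1)]
        smult_add_right smult_diff_right ss algebra_simps)
       (simp add: mult.assoc[symmetric] assms(2))
  show ?case unfolding eq
    by (intro ideal_power_SucI ideal_power_mult Suc.IH *)
qed simp

lemma rev_poly_map_poly:
  "\<sigma> 0 = 0 \<Longrightarrow> rev_poly N (map_poly \<sigma> p) = map_poly \<sigma> (rev_poly N p)"
  by (rule poly_eqI) (simp add: coeff_rev_poly coeff_map_poly)

lemma rev_poly_smult: "rev_poly N (smult s p) = smult s (rev_poly N p)"
  by (rule poly_eqI) (simp add: coeff_rev_poly)

context hyperelliptic
begin

lemma has_ord_ideal:
  assumes "P \<in> curve_points d f" "has_ord P m (chart_ev P u)"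
  shows "int n \<le> m \<longleftrightarrow> u \<in> ideal_power (chart_poly P) (fst (chart_values P)) (snd (chart_values P)) n"
  using smooth_point.has_order_ideal[OF smooth_point_chart[OF assms(1)]] assms(2)
  by (simp add: has_ord_def chart_ev_def)

lemma chart_ev_eq_0_iff: "chart_ev P u = 0 \<longleftrightarrow> u = 0"
  unfolding chart_ev_def by (rule quadratic_chart.ev_eq_0_iff[OF quadratic_chart_chart])

lemma map_poly_F_inf:
  assumes "\<sigma> 0 = 0" "map_poly \<sigma> F = F"
  shows "map_poly \<sigma> F_inf = F_inf"
  unfolding F_inf_def using rev_poly_map_poly[where \<sigma> = \<sigma> and p = F] assms by metis

lemma map_poly_chart_poly:
  assumes "\<sigma> 0 = 0" "map_poly \<sigma> F = F"
  shows "map_poly \<sigma> (chart_poly P) = chart_poly P"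
  using assms map_poly_F_inf[OF assms] by (simp add: chart_poly_def split: curve_point.split)

lemma chart_poly_twist_point: "chart_poly (twist_point \<sigma> s P) = chart_poly P"
  by (simp add: chart_poly_def twist_point_def split: curve_point.split)

lemma chart_values_twist_point:
  "\<sigma> 0 = 0 \<Longrightarrow> chart_values (twist_point \<sigma> s P)
     = (\<sigma> (fst (chart_values P)), s * \<sigma> (snd (chart_values P)))"
  by (cases P) (simp_all add: twist_point_def)

lemma twist_point_in_curve:
  assumes "comm_ring_hom \<sigma>" "map_poly \<sigma> F = F" "s * s = 1" "P \<in> curve_points d f"
  shows "twist_point \<sigma> s P \<in> curve_points d f"
proof -
  interpret comm_ring_hom \<sigma> by fact
  have sq: "(s * \<sigma> b)\<^sup>2 = \<sigma> (b\<^sup>2)" for b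
    using assms(3) by (simp add: power_mult_distrib hom_power power2_eq_square hom_mult)
  show ?thesis
  proof (cases P)
    case (Affine a b)
    then have "b\<^sup>2 = poly F a" using assms(4) by (simp add: affine_in_curve)
    then have "(s * \<sigma> b)\<^sup>2 = poly (map_poly \<sigma> F) (\<sigma> a)" by (simp only: sq poly_map_poly)
    then show ?thesis by (simp add: Affine twist_point_def affine_in_curve assms(2))
  next
    case (Infinite w)
    then have "w\<^sup>2 = coeff F (2 * half_degree f)" using assms(4) by (simp add: infinite_in_curve)
    then have "(s * \<sigma> w)\<^sup>2 = coeff (map_poly \<sigma> F) (2 * half_degree f)"
      by (simp only: sq coeff_map_poly hom_zero)
    then show ?thesis by (simp add: Infinite twist_point_def infinite_in_curve assms(2))
  qed
qed

lemma has_ord_twist_le: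
  assumes \<sigma>: "comm_ring_hom \<sigma>" "map_poly \<sigma> F = F" "s * s = 1" and P: "P \<in> curve_points d f"
    and m: "has_ord P (int m) (chart_ev P u)"
    and m': "has_ord (twist_point \<sigma> s P) (int m') (chart_ev (twist_point \<sigma> s P) (twist_pair \<sigma> s u))"
  shows "m \<le> m'"
proof -
  interpret comm_ring_hom \<sigma> by fact
  have "u \<in> ideal_power (chart_poly P) (fst (chart_values P)) (snd (chart_values P)) m"
    using has_ord_ideal[OF P m, of m] by simp
  from ideal_power_twist[OF \<sigma>(1,3) this] have "int m \<le> int m'"
    unfolding has_ord_ideal[OF twist_point_in_curve[OF \<sigma> P] m']
    by (simp add: chart_poly_twist_point chart_values_twist_point map_poly_chart_poly[OF hom_zero \<sigma>(2)])
  then show ?thesis by simp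
qed

text \<open>Ideal powers only show that orders do not drop; applying this to \<sigma> and to its
  inverse \<tau> yields equality.\<close>

lemma has_ord_twist_chart:
  assumes \<sigma>: "comm_ring_hom \<sigma>" "map_poly \<sigma> F = F" "s * s = 1" and P: "P \<in> curve_points d f"
    and \<tau>: "comm_ring_hom \<tau>" "\<And>x. \<tau> (\<sigma> x) = x" "\<tau> s = s"
    and m: "has_ord P (int m) (chart_ev P u)"
  shows "has_ord (twist_point \<sigma> s P) (int m) (chart_ev (twist_point \<sigma> s P) (twist_pair \<sigma> s u))"
proof -
  interpret \<sigma>: comm_ring_hom \<sigma> by fact
  interpret \<tau>: comm_ring_hom \<tau> by fact
  interpret \<tau>p: map_poly_comm_ring_hom \<tau> ..
  have P': "twist_point \<sigma> s P \<in> curve_points d f" by (rule twist_point_in_curve[OF \<sigma> P])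
  have mm: "map_poly \<tau> (map_poly \<sigma> p) = p" for p
    by (rule poly_eqI) (simp add: coeff_map_poly \<tau>)
  have ss: "smult s (smult s p) = p" for p using \<sigma>(3) by (simp add: smult_smult)
  have inv: "twist_pair \<tau> s (twist_pair \<sigma> s u) = u"
    using \<tau>(3) by (simp add: twist_pair_def mm map_poly_smult_hom[OF \<tau>(1)] \<sigma>(3) prod_eq_iff)
  have invP: "twist_point \<tau> s (twist_point \<sigma> s P) = P"
    using \<sigma>(3) \<tau>(2,3)
    by (cases P) (simp_all add: twist_point_def \<tau>.hom_mult mult.assoc[symmetric])
  have "u \<noteq> 0" using has_ord_nonzero[OF P m] chart_ev_eq_0_iff by blast
  then have "twist_pair \<sigma> s u \<noteq> 0" using inv by (metis \<tau>p.hom_zero twist_pair_def fst_zero snd_zero smult_0_right zero_prod_def)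
  then obtain m' where
    m': "has_ord (twist_point \<sigma> s P) (int m') (chart_ev (twist_point \<sigma> s P) (twist_pair \<sigma> s u))"
    using has_ord_exists_chart[OF P'] by blast
  have "map_poly \<tau> F = F" using mm[of F] \<sigma>(2) by simp
  from has_ord_twist_le[OF \<tau>(1) this \<sigma>(3) P' m'] m have "m' \<le> m"
    unfolding inv invP by blast
  moreover have "m \<le> m'" by (rule has_ord_twist_le[OF \<sigma> P m m'])
  ultimately show ?thesis using m' by simp
qed

lemma has_ord_twist:
  assumes \<sigma>: "comm_ring_hom \<sigma>" "map_poly \<sigma> F = F" "s * s = 1" and P: "P \<in> curve_points d f"
    and \<tau>: "comm_ring_hom \<tau>" "\<And>x. \<tau> (\<sigma> x) = x" "\<tau> s = s"
    and m: "has_ord P m (aff.ev u)"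
  shows "has_ord (twist_point \<sigma> s P) m (aff.ev (twist_pair \<sigma> s u))"
proof (cases P)
  case (Affine a b)
  have "u \<noteq> 0" using has_ord_nonzero[OF P m] by auto
  then obtain k where k: "has_ord P (int k) (chart_ev P u)" using has_ord_exists_chart[OF P] by blast
  then have "m = int k" using m has_ord_unique[OF P] by (simp add: Affine chart_ev_affine)
  with has_ord_twist_chart[OF \<sigma> P \<tau> k] show ?thesis
    by (simp add: Affine twist_point_def chart_ev_affine)
next
  case (Infinite w)
  interpret \<sigma>: comm_ring_hom \<sigma> by fact
  interpret \<tau>: comm_ring_hom \<tau> by fact
  have P': "Infinite (s * \<sigma> w) \<in> curve_points d f"
    using twist_point_in_curve[OF \<sigma> P] by (simp add: Infinite twist_point_def)
  obtain p q where pq: "u = (p, q)" by fastforce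
  define N where "N = degree p + degree q + half_degree f"
  define v where "v = (rev_poly N p, rev_poly (N - half_degree f) q)"
  have ev: "aff.ev u = coord_x ^ N * inf.ev v"
    unfolding pq v_def by (rule inf_ev) (simp_all add: N_def)
  have ev': "aff.ev (twist_pair \<sigma> s u) = coord_x ^ N * inf.ev (twist_pair \<sigma> s v)"
  proof -
    have deg: "degree (map_poly \<sigma> p) \<le> N" "degree (smult s (map_poly \<sigma> q)) + half_degree f \<le> N"
      using degree_map_poly_le[of \<sigma> p] degree_map_poly_le[of \<sigma> q]
        degree_smult_le[of s "map_poly \<sigma> q"] by (simp_all add: N_def)
    show ?thesis
      using inf_ev[OF deg]
      by (simp add: pq v_def twist_pair_def rev_poly_smult rev_poly_map_poly)
  qed
  have "v \<noteq> 0" using has_ord_nonzero[OF P m] ev by auto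
  then obtain k where k: "has_ord P (int k) (chart_ev P v)" using has_ord_exists_chart[OF P] by blast
  \<comment> \<open>Ramification at infinity is preserved, so the factor \<open>coord_x ^ N\<close>
    has the same order at both points.\<close>
  have w0: "w = 0 \<longleftrightarrow> s * \<sigma> w = 0"
    using \<sigma>(3) \<tau>(2)[of w] by auto
  have x: "has_ord P (if w = 0 then -2 else -1) coord_x"
    using has_ord_coord_x P by (simp add: Infinite)
  have x': "has_ord (twist_point \<sigma> s P) (if w = 0 then -2 else -1) coord_x"
    using has_ord_coord_x[OF P'] w0 by (simp add: Infinite twist_point_def)
  have "has_ord P (int N * (if w = 0 then -2 else -1) + int k) (aff.ev u)"
    using has_ord_mult[OF P has_ord_power[OF P x] k] by (simp add: ev Infinite chart_ev_infinite)
  then have m_eq: "m = int N * (if w = 0 then -2 else -1) + int k"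
    using m has_ord_unique[OF P] by blast
  have Pt: "twist_point \<sigma> s P \<in> curve_points d f" by (rule twist_point_in_curve[OF \<sigma> P])
  have "has_ord (twist_point \<sigma> s P) (int k) (inf.ev (twist_pair \<sigma> s v))"
    using has_ord_twist_chart[OF \<sigma> P \<tau> k] by (simp add: Infinite twist_point_def chart_ev_infinite)
  from has_ord_mult[OF Pt has_ord_power[OF Pt x'] this] show ?thesis
    unfolding ev' m_eq .
qed

lemma has_ord_conj:
  assumes "P \<in> curve_points d f" "has_ord P m (aff.ev (p, q))"
  shows "has_ord (twist_point id (- 1) P) m (aff.ev (p, - q))"
proof -
  have id: "comm_ring_hom (id :: 'k \<Rightarrow> 'k)" by unfold_locales simp_all
  have "map_poly id r = r" for r :: "'k poly" by (rule poly_eqI) (simp add: coeff_map_poly)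
  with has_ord_twist[OF id _ _ assms(1) id, of "-1" m "(p, q)"] assms(2) show ?thesis
    by (simp add: twist_pair_def)
qed

lemma has_ord_poly_affine:
  assumes P: "Affine a b \<in> curve_points d f" and g: "g \<noteq> 0"
  shows "has_ord (Affine a b) (int (order a g) * (if b = 0 then 2 else 1)) (aff.ev (g, 0))"
proof -
  obtain g1 where g1: "g = [:-a, 1:] ^ order a g * g1" "poly g1 a \<noteq> 0"
    using order_decomp[OF g, of a] unfolding poly_eq_0_iff_dvd by blast
  have "aff.ev (g, 0) = (coord_x - func_const a) ^ order a g * aff.ev (g1, 0)"
    unfolding aff.ev_def fst_conv snd_conv by (subst g1(1)) (simp add: aff.hom_uminus)
  moreover have "has_ord (Affine a b) 0 (aff.ev (g1, 0))"
    using has_ord_chart_unit[OF P, of "(g1, 0)"] g1(2)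
    by (simp add: chart_ev_affine chart_val_def pair_val_def)
  ultimately show ?thesis
    using has_ord_mult[OF P has_ord_power[OF P has_ord_x_minus[OF P]], of 0 _ "order a g"] by simp
qed

lemma has_ord_poly_infinite:
  assumes P: "Infinite w \<in> curve_points d f" and g: "g \<noteq> 0"
  shows "has_ord (Infinite w) (int (degree g) * (if w = 0 then -2 else -1)) (aff.ev (g, 0))"
proof -
  define N where "N = degree g"
  have g_eq: "aff.ev (g, 0) = coord_x ^ N * inf.ev (rev_poly N g, 0)"
    unfolding aff.ev_def inf.ev_def aff.ev_poly_def inf.ev_poly_def fst_conv snd_conv
    by (simp add: poly_rev_poly[of g N coord_x func_const] N_def)
  have "has_ord (Infinite w) 0 (inf.ev (rev_poly N g, 0))"
    using has_ord_chart_unit[OF P, of "(rev_poly N g, 0)"] g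
    by (simp add: chart_ev_infinite chart_val_def pair_val_def poly_0_coeff_0 coeff_rev_poly N_def)
  from has_ord_mult[OF P has_ord_power[OF P has_ord_coord_x[OF P], of N] this] show ?thesis
    by (simp add: g_eq N_def)
qed

lemma square_roots: "\<exists>b0. {b. b\<^sup>2 = (e::'k)} = {b0, - b0}"
proof -
  obtain b0 where "b0 ^ 2 = e" using nth_root_exists[of 2] by auto
  then show ?thesis by (intro exI[of _ b0]) (auto simp: power2_eq_iff)
qed

text \<open>Every fibre of \<open>x\<close> has two points, a ramification point being counted
  twice.\<close>

lemma sum_square_roots: "(\<Sum>b\<in>{b. b\<^sup>2 = (e::'k)}. if b = 0 then 2 else 1) = (2::int)"
proof -
  obtain b0 where b0: "{b. b\<^sup>2 = e} = {b0, - b0}" using square_roots by blast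
  have "b0 \<noteq> - b0" if "b0 \<noteq> 0"
    using that by (metis add_eq_0_iff2 mult_2 mult_eq_0_iff zero_neq_numeral)
  then show ?thesis unfolding b0 by (cases "b0 = 0") auto
qed

lemma finite_square_roots: "finite {b. b\<^sup>2 = (e::'k)}"
  using square_roots[of e] by auto

text \<open>A finite part of the curve that is closed under the involution. Once \<open>A\<close>
  contains the roots of the norm of \<open>u\<close>, every point where \<open>u\<close> has
  non-zero order belongs to it.\<close>

definition points_over :: "'k set \<Rightarrow> 'k curve_point set" where
  "points_over A = (\<Union>a\<in>A. Affine a ` {b. b\<^sup>2 = poly F a}) \<union>
     Infinite ` {w. w\<^sup>2 = coeff F (2 * half_degree f)}"

lemma finite_points_over: "finite A \<Longrightarrow> finite (points_over A)"
  unfolding points_over_def using finite_square_roots by auto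

lemma points_over_subset: "points_over A \<subseteq> curve_points d f"
  by (auto simp: points_over_def affine_in_curve infinite_in_curve)

lemma affine_in_points_over: "Affine a b \<in> points_over A \<longleftrightarrow> a \<in> A \<and> b\<^sup>2 = poly F a"
  by (auto simp: points_over_def)

lemma infinite_in_points_over: "Infinite w \<in> points_over A \<longleftrightarrow> w\<^sup>2 = coeff F (2 * half_degree f)"
  by (auto simp: points_over_def)

lemma sum_points_over:
  assumes "finite A"
  shows "sum \<omega> (points_over A) = (\<Sum>a\<in>A. \<Sum>b\<in>{b. b\<^sup>2 = poly F a}. \<omega> (Affine a b))
     + (\<Sum>w\<in>{w. w\<^sup>2 = coeff F (2 * half_degree f)}. \<omega> (Infinite w))"
proof -
  have "sum \<omega> (points_over A) = sum \<omega> (\<Union>a\<in>A. Affine a ` {b. b\<^sup>2 = poly F a})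
      + sum \<omega> (Infinite ` {w. w\<^sup>2 = coeff F (2 * half_degree f)})"
    unfolding points_over_def
    by (rule sum.union_disjoint) (use assms finite_square_roots in auto)
  also have "sum \<omega> (\<Union>a\<in>A. Affine a ` {b. b\<^sup>2 = poly F a})
      = (\<Sum>a\<in>A. sum \<omega> (Affine a ` {b. b\<^sup>2 = poly F a}))"
    by (rule sum.UNION_disjoint) (use assms finite_square_roots in auto)
  also have "\<dots> = (\<Sum>a\<in>A. \<Sum>b\<in>{b. b\<^sup>2 = poly F a}. \<omega> (Affine a b))"
    by (intro sum.cong refl, subst sum.reindex) (auto simp: inj_on_def)
  also have "sum \<omega> (Infinite ` {w. w\<^sup>2 = coeff F (2 * half_degree f)})
      = (\<Sum>w\<in>{w. w\<^sup>2 = coeff F (2 * half_degree f)}. \<omega> (Infinite w))"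
    by (subst sum.reindex) (auto simp: inj_on_def)
  finally show ?thesis .
qed

lemma ev_in_ff: "aff.ev u \<in> function_field d f"
  using ev_in_function_field[of u 1] by simp

abbreviation order_at :: "'k curve_point \<Rightarrow> 'k func \<Rightarrow> int" where
  "order_at \<equiv> vanishing_order d f"

lemma has_ord_ord: "P \<in> curve_points d f \<Longrightarrow> u \<noteq> 0 \<Longrightarrow> has_ord P (order_at P (aff.ev u)) (aff.ev u)"
  by (rule has_ord_exists[OF _ ev_in_ff]) simp_all

lemma sum_ord_poly:
  assumes "finite A" "g \<noteq> 0" "{a. poly g a = 0} \<subseteq> A"
  shows "(\<Sum>P\<in>points_over A. order_at P (aff.ev (g, 0))) = 0"
proof -
  have "order_at (Affine a b) (aff.ev (g, 0)) = int (order a g) * (if b = 0 then 2 else 1)"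
    if "b\<^sup>2 = poly F a" for a b
    using that has_ord_poly_affine[OF _ assms(2)] by (intro vanishing_order_eqI) (simp_all add: affine_in_curve)
  then have "(\<Sum>b\<in>{b. b\<^sup>2 = poly F a}. order_at (Affine a b) (aff.ev (g, 0)))
      = int (order a g) * (\<Sum>b\<in>{b. b\<^sup>2 = poly F a}. if b = 0 then 2 else 1)" for a
    unfolding sum_distrib_left by (intro sum.cong) auto
  then have aff: "(\<Sum>b\<in>{b. b\<^sup>2 = poly F a}. order_at (Affine a b) (aff.ev (g, 0))) = int (order a g) * 2" for a
    by (simp only: sum_square_roots)
  have "order_at (Infinite w) (aff.ev (g, 0)) = - int (degree g) * (if w = 0 then 2 else 1)"
    if "w\<^sup>2 = coeff F (2 * half_degree f)" for w
    using that has_ord_poly_infinite[OF _ assms(2), of w]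
    by (intro vanishing_order_eqI) (simp_all add: infinite_in_curve split: if_splits)
  then have inf: "(\<Sum>w\<in>{w. w\<^sup>2 = coeff F (2 * half_degree f)}. order_at (Infinite w) (aff.ev (g, 0)))
      = - int (degree g) * (\<Sum>w\<in>{w. w\<^sup>2 = coeff F (2 * half_degree f)}. if w = 0 then 2 else 1)"
    unfolding sum_distrib_left by (intro sum.cong) auto
  have "(\<Sum>a\<in>A. int (order a g) * 2) = 2 * int (\<Sum>a\<in>A. order a g)"
    by (simp add: sum_distrib_left mult.commute)
  also have "\<dots> = 2 * int (degree g)" using sum_order_eq_degree[OF assms] by simp
  finally show ?thesis
    unfolding sum_points_over[OF assms(1)] aff inf sum_square_roots by simp
qed

definition norm_poly :: "'k poly \<times> 'k poly \<Rightarrow> 'k poly" where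
  "norm_poly u = (fst u)\<^sup>2 - (snd u)\<^sup>2 * F"

lemma ev_norm: "aff.ev (p, q) * aff.ev (p, - q) = aff.ev (norm_poly (p, q), 0)"
  unfolding aff.ev_mult[symmetric]
  by (simp add: pair_mult_def norm_poly_def power2_eq_square algebra_simps)

lemma norm_poly_nonzero:
  assumes "(p, q) \<noteq> 0"
  shows "norm_poly (p, q) \<noteq> 0"
proof
  assume "norm_poly (p, q) = 0"
  then have "aff.ev (norm_poly (p, q), 0) = 0" by (simp add: zero_prod_def)
  with ev_norm[of p q] have "aff.ev (p, q) = 0 \<or> aff.ev (p, - q) = 0" by simp
  then have "(p, q) = 0 \<or> (p, - q) = 0" by (simp only: aff.ev_eq_0_iff)
  with assms show False by (auto simp: zero_prod_def)
qed

text \<open>The involution permutes \<open>points_over A\<close> and exchanges \<open>u\<close> with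
  its conjugate, so both have the same sum of orders. The two sums add up to that of the norm, a
  polynomial in \<open>x\<close>, for which zeros and poles balance.\<close>

lemma sum_ord_pair:
  assumes "finite A" "u \<noteq> 0" "{a. poly (norm_poly u) a = 0} \<subseteq> A"
  shows "(\<Sum>P\<in>points_over A. order_at P (aff.ev u)) = 0"
proof -
  obtain p q where u: "u = (p, q)" by fastforce
  have u': "(p, - q) \<noteq> 0" using assms(2) by (auto simp: u zero_prod_def)
  let ?T = "twist_point id (- 1 :: 'k)"
  have TT: "?T (?T P) = P" for P by (cases P) (simp_all add: twist_point_def)
  have Tin: "?T P \<in> points_over A" if "P \<in> points_over A" for P
    using that by (cases P)
      (simp_all add: twist_point_def affine_in_points_over infinite_in_points_over)
  have eq: "order_at (?T P) (aff.ev (p, - q)) = order_at P (aff.ev u)" if "P \<in> points_over A" for P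
  proof (rule vanishing_order_eqI)
    show "?T P \<in> curve_points d f" using Tin[OF that] points_over_subset by blast
    have "P \<in> curve_points d f" using that points_over_subset by blast
    from has_ord_conj[OF this] has_ord_ord[OF this assms(2)]
    show "has_ord (?T P) (order_at P (aff.ev u)) (aff.ev (p, - q))" by (simp add: u)
  qed
  have "(\<Sum>P\<in>points_over A. order_at P (aff.ev u)) = (\<Sum>P\<in>points_over A. order_at P (aff.ev (p, - q)))"
    by (rule sum.reindex_bij_witness[of _ ?T ?T]) (use TT Tin eq in auto)
  moreover have "order_at P (aff.ev u) + order_at P (aff.ev (p, - q)) = order_at P (aff.ev (norm_poly u, 0))"
    if "P \<in> points_over A" for P
  proof -
    have P: "P \<in> curve_points d f" using that points_over_subset by blast
    from has_ord_mult[OF P has_ord_ord[OF P assms(2)] has_ord_ord[OF P u']]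
    have "has_ord P (order_at P (aff.ev u) + order_at P (aff.ev (p, - q))) (aff.ev (norm_poly u, 0))"
      by (simp add: u ev_norm)
    then show ?thesis using vanishing_order_eqI[OF P] by simp
  qed
  then have "(\<Sum>P\<in>points_over A. order_at P (aff.ev u)) + (\<Sum>P\<in>points_over A. order_at P (aff.ev (p, - q)))
      = (\<Sum>P\<in>points_over A. order_at P (aff.ev (norm_poly u, 0)))"
    unfolding sum.distrib[symmetric] by (intro sum.cong) auto
  moreover have "\<dots> = 0"
    using sum_ord_poly[OF assms(1) _ assms(3)] norm_poly_nonzero assms(2) u by blast
  ultimately show ?thesis by simp
qed

lemma ord_outside:
  assumes "P \<in> curve_points d f" "P \<notin> points_over A" "{a. poly (norm_poly u) a = 0} \<subseteq> A"
  shows "order_at P (aff.ev u) = 0"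
proof -
  obtain p q where u: "u = (p, q)" by fastforce
  obtain a b where P: "P = Affine a b"
    using assms(1,2) by (cases P) (auto simp: infinite_in_points_over infinite_in_curve)
  then have b: "b\<^sup>2 = poly F a" using assms(1) affine_in_curve by simp
  then have "poly (norm_poly u) a \<noteq> 0" using assms(2,3) P by (auto simp: affine_in_points_over)
  moreover have "poly (norm_poly u) a = (poly p a + b * poly q a) * (poly p a - b * poly q a)"
    using b by (simp add: u norm_poly_def algebra_simps power2_eq_square)
  ultimately have "chart_val P u \<noteq> 0" by (auto simp: chart_val_def pair_val_def P u)
  from has_ord_chart_unit[OF assms(1) this] show ?thesis
    using vanishing_order_eqI[OF assms(1)] by (simp add: P chart_ev_affine)
qed

lemma ord_divide:
  assumes "P \<in> curve_points d f" "u \<noteq> 0" "w \<noteq> 0"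
  shows "order_at P (aff.ev u / aff.ev (w, 0)) = order_at P (aff.ev u) - order_at P (aff.ev (w, 0))"
  using assms by (intro vanishing_order_eqI has_ord_divide has_ord_ord) (auto simp: zero_prod_def)

lemma divisor_exists:
  assumes "\<phi> \<in> function_field d f" "\<phi> \<noteq> 0"
  shows "\<exists>S. finite S \<and> S \<subseteq> curve_points d f \<and> (\<forall>P\<in>curve_points d f - S. order_at P \<phi> = 0)
    \<and> (\<Sum>P\<in>S. order_at P \<phi>) = 0"
proof -
  obtain u w where uw: "w \<noteq> 0" "\<phi> = aff.ev u / aff.ev (w, 0)"
    using function_field_repr[OF assms(1)] .
  have u: "u \<noteq> 0" using uw assms(2) by auto
  have w: "(w, 0) \<noteq> 0" using uw(1) by (simp add: zero_prod_def)
  define A where "A = {a. poly (norm_poly u * norm_poly (w, 0)) a = 0}"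
  have "norm_poly u \<noteq> 0" "norm_poly (w, 0) \<noteq> 0"
    using norm_poly_nonzero u w by (metis surj_pair)+
  then have fin: "finite A" unfolding A_def by (intro poly_roots_finite) simp
  have sub: "{a. poly (norm_poly u) a = 0} \<subseteq> A" "{a. poly (norm_poly (w, 0)) a = 0} \<subseteq> A"
    by (auto simp: A_def)
  have order_at: "order_at P \<phi> = order_at P (aff.ev u) - order_at P (aff.ev (w, 0))" if "P \<in> curve_points d f" for P
    unfolding uw(2) by (rule ord_divide[OF that u uw(1)])
  have "(\<Sum>P\<in>points_over A. order_at P \<phi>)
      = (\<Sum>P\<in>points_over A. order_at P (aff.ev u)) - (\<Sum>P\<in>points_over A. order_at P (aff.ev (w, 0)))"
    unfolding sum_subtractf[symmetric] using order_at points_over_subset by (intro sum.cong) auto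
  also have "\<dots> = 0"
    using sum_ord_pair[OF fin u sub(1)] sum_ord_pair[OF fin w sub(2)] by simp
  finally have "(\<Sum>P\<in>points_over A. order_at P \<phi>) = 0" .
  moreover have "\<forall>P\<in>curve_points d f - points_over A. order_at P \<phi> = 0"
    using order_at ord_outside[OF _ _ sub(1)] ord_outside[OF _ _ sub(2)] by auto
  ultimately show ?thesis
    using finite_points_over[OF fin] points_over_subset by blast
qed

lemma function_field_mult:
  assumes "\<phi> \<in> function_field d f" "\<psi> \<in> function_field d f"
  shows "\<phi> * \<psi> \<in> function_field d f"
proof -
  obtain u w v z where "\<phi> = aff.ev u / aff.ev (w, 0)" "\<psi> = aff.ev v / aff.ev (z, 0)"
    using function_field_repr assms by metis
  then have "\<phi> * \<psi> = aff.ev (pair_mult F u v) / aff.ev (pair_mult F (w, 0) (z, 0))"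
    by (simp only: aff.ev_mult times_divide_times_eq)
  also have "pair_mult F (w, 0) (z, 0) = (w * z, 0)" by (simp add: pair_mult_def)
  finally have "\<phi> * \<psi> = aff.ev (pair_mult F u v) / aff.ev (w * z, 0)" .
  then show ?thesis by (simp add: ev_in_function_field)
qed

lemma function_field_inverse:
  assumes "\<phi> \<in> function_field d f"
  shows "inverse \<phi> \<in> function_field d f"
proof (cases "\<phi> = 0")
  case False
  obtain u w where uw: "w \<noteq> 0" "\<phi> = aff.ev u / aff.ev (w, 0)"
    using function_field_repr[OF assms] .
  obtain p q where u: "u = (p, q)" by fastforce
  have "(p, q) \<noteq> 0" using False uw u by auto
  then have nz: "aff.ev (p, - q) \<noteq> 0" by (auto simp: zero_prod_def)
  have "inverse \<phi> = aff.ev (w, 0) / aff.ev u" using uw(2) by simp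
  also have "\<dots> = (aff.ev (w, 0) * aff.ev (p, - q)) / (aff.ev u * aff.ev (p, - q))"
    using nz by simp
  also have "\<dots> = aff.ev (pair_mult F (w, 0) (p, - q)) / aff.ev (norm_poly (p, q), 0)"
    by (simp only: aff.ev_mult u ev_norm)
  finally show ?thesis by (simp add: ev_in_function_field)
qed (use assms in simp)

lemma ord_mult:
  assumes "P \<in> curve_points d f" "\<phi> \<in> function_field d f - {0}" "\<psi> \<in> function_field d f - {0}"
  shows "order_at P (\<phi> * \<psi>) = order_at P \<phi> + order_at P \<psi>"
  using assms by (intro vanishing_order_eqI has_ord_mult has_ord_exists) auto

lemma ord_inverse:
  assumes "P \<in> curve_points d f" "\<phi> \<in> function_field d f - {0}"
  shows "order_at P (inverse \<phi>) = - order_at P \<phi>"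
  using has_ord_divide[OF assms(1) has_ord_1[OF assms(1)] has_ord_exists[OF assms(1), of \<phi>]] assms
  by (intro vanishing_order_eqI) (auto simp: inverse_eq_divide)

end

section \<open>Divisor classes and rank\<close>

lemma divisor_degree_eq:
  assumes "finite S" "Poly_Mapping.keys \<Delta> \<subseteq> S"
  shows "divisor_degree \<Delta> = (\<Sum>P\<in>S. Poly_Mapping.lookup \<Delta> P)"
  unfolding divisor_degree_def
  by (rule sum.mono_neutral_left) (use assms in \<open>auto simp: in_keys_iff\<close>)

lemma divisor_degree_0 [simp]: "divisor_degree 0 = 0"
  by (simp add: divisor_degree_def)

lemma divisor_degree_add: "divisor_degree (\<Delta> + \<Delta>') = divisor_degree \<Delta> + divisor_degree \<Delta>'"
proof -
  let ?S = "Poly_Mapping.keys \<Delta> \<union> Poly_Mapping.keys \<Delta>'"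
  have "divisor_degree (\<Delta> + \<Delta>') = (\<Sum>P\<in>?S. Poly_Mapping.lookup (\<Delta> + \<Delta>') P)"
    by (rule divisor_degree_eq) (use keys_add[of \<Delta> \<Delta>'] in auto)
  also have "\<dots> = (\<Sum>P\<in>?S. Poly_Mapping.lookup \<Delta> P) + (\<Sum>P\<in>?S. Poly_Mapping.lookup \<Delta>' P)"
    by (simp add: lookup_add sum.distrib)
  also have "\<dots> = divisor_degree \<Delta> + divisor_degree \<Delta>'"
    using divisor_degree_eq[of ?S \<Delta>] divisor_degree_eq[of ?S \<Delta>'] by simp
  finally show ?thesis .
qed

lemma divisor_degree_uminus: "divisor_degree (- \<Delta>) = - divisor_degree \<Delta>"
  using divisor_degree_add[of \<Delta> "- \<Delta>"] by simp

lemma divisor_degree_frag_of: "divisor_degree (frag_of P) = 1"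
  by (simp add: divisor_degree_def)

lemma divisor_degree_difference: "divisor_degree (frag_of P - frag_of Q) = 0"
  using divisor_degree_add[of "frag_of P" "- frag_of Q"]
  by (simp add: divisor_degree_uminus divisor_degree_frag_of)

lemma Div0_simps [simp]:
  "\<Delta> \<otimes>\<^bsub>Div0 d f\<^esub> \<Delta>' = \<Delta> + \<Delta>'" "\<one>\<^bsub>Div0 d f\<^esub> = 0"
  "\<Delta> \<in> carrier (Div0 d f) \<longleftrightarrow> Poly_Mapping.keys \<Delta> \<subseteq> curve_points d f \<and> divisor_degree \<Delta> = 0"
  by (simp_all add: Div0_def free_Abelian_group_def)

lemma subgroup_degree_0:
  "subgroup {\<Delta> \<in> carrier (free_Abelian_group S). divisor_degree \<Delta> = 0} (free_Abelian_group S)"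
proof (rule group.subgroupI[OF group_free_Abelian_group])
  show "{\<Delta> \<in> carrier (free_Abelian_group S). divisor_degree \<Delta> = 0} \<noteq> {}"
    using divisor_degree_0 by force
qed (auto simp: divisor_degree_add divisor_degree_uminus dest!: subsetD[OF keys_add])

lemma comm_group_Div0: "comm_group (Div0 d f)"
proof (rule group.group_comm_groupI)
  show "group (Div0 d f)"
    unfolding Div0_def by (rule subgroup.subgroup_is_group[OF subgroup_degree_0 group_free_Abelian_group])
qed (simp add: add.commute)

lemma int_pow_Div0:
  assumes "\<Delta> \<in> carrier (Div0 d f)"
  shows "\<Delta> [^]\<^bsub>Div0 d f\<^esub> (n::int) = frag_cmul n \<Delta>"
proof -
  have "\<Delta> [^]\<^bsub>Div0 d f\<^esub> n = \<Delta> [^]\<^bsub>free_Abelian_group (curve_points d f)\<^esub> n"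
    unfolding Div0_def using assms
    by (intro group.int_pow_consistent[OF group_free_Abelian_group subgroup_degree_0, symmetric]) simp
  then show ?thesis using assms by simp
qed

lemma int_independent_singleton:
  assumes "comm_group G" "C \<in> carrier G" "\<And>n::int. C [^]\<^bsub>G\<^esub> n = \<one>\<^bsub>G\<^esub> \<Longrightarrow> n = 0"
  shows "int_independent G {C}"
proof -
  interpret comm_group G by fact
  have "(\<Otimes>\<^bsub>G\<^esub>s\<in>{C}. s [^]\<^bsub>G\<^esub> (c s :: int)) = C [^]\<^bsub>G\<^esub> c C" for c
    using assms(2) by (subst finprod_insert) auto
  then show ?thesis using assms(2,3) by (simp add: int_independent_def)
qed

lemma subgroup_rank_pos:
  assumes "C \<in> H" "int_independent G {C}"
  shows "subgroup_rank G H > 0"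
proof -
  have "enat (card {C}) \<le> subgroup_rank G H"
    unfolding subgroup_rank_def by (rule SUP_upper) (use assms in auto)
  moreover have "(0::enat) < enat (card {C})" by (simp add: zero_enat_def)
  ultimately show ?thesis by (rule less_le_trans[rotated])
qed

lemma subgroup_rank_posE:
  assumes "comm_group G" "subgroup_rank G H > 0"
  obtains C where "C \<in> H" "C \<in> carrier G" "\<And>n::int. C [^]\<^bsub>G\<^esub> n = \<one>\<^bsub>G\<^esub> \<Longrightarrow> n = 0"
proof -
  interpret comm_group G by fact
  obtain S where S: "S \<subseteq> H" "int_independent G S" "0 < enat (card S)"
    using assms(2) unfolding subgroup_rank_def less_SUP_iff by auto
  then have fin: "finite S" and car: "S \<subseteq> carrier G" by (auto simp: int_independent_def)
  from S(3) obtain C where C: "C \<in> S" by (metis card.empty ex_in_conv enat_0 less_irrefl)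
  have "n = 0" if "C [^]\<^bsub>G\<^esub> n = \<one>\<^bsub>G\<^esub>" for n :: int
  proof -
    define c where "c = (\<lambda>s. if s = C then n else 0)"
    have "(\<Otimes>\<^bsub>G\<^esub>s\<in>S. s [^]\<^bsub>G\<^esub> c s) = \<one>\<^bsub>G\<^esub>"
    proof (rule finprod_one_eqI)
      fix s assume "s \<in> S"
      then show "s [^]\<^bsub>G\<^esub> c s = \<one>\<^bsub>G\<^esub>" using that car by (auto simp: c_def)
    qed
    then have "c C = 0" using S(2) C unfolding int_independent_def by blast
    then show ?thesis by (simp add: c_def)
  qed
  with C S(1) car show thesis by (intro that[of C]) auto
qed

lemma map_divisor_add: "map_divisor \<sigma> (\<Delta> + \<Delta>') = map_divisor \<sigma> \<Delta> + map_divisor \<sigma> \<Delta>'"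
  by (simp add: map_divisor_def frag_extend_add)

lemma map_divisor_diff: "map_divisor \<sigma> (\<Delta> - \<Delta>') = map_divisor \<sigma> \<Delta> - map_divisor \<sigma> \<Delta>'"
  by (simp add: map_divisor_def frag_extend_diff)

lemma map_divisor_frag_of: "map_divisor \<sigma> (frag_of P) = frag_of (map_curve_point \<sigma> P)"
  by (simp add: map_divisor_def)

lemma lookup_map_divisor:
  "Poly_Mapping.lookup (map_divisor \<sigma> \<Delta>) Q =
    (\<Sum>P\<in>Poly_Mapping.keys \<Delta>. if map_curve_point \<sigma> P = Q then Poly_Mapping.lookup \<Delta> P else 0)"
  unfolding map_divisor_def frag_extend_def lookup_sum
  by (rule sum.cong) (auto simp: lookup_single when_def)

lemma lookup_map_divisor_inj:
  assumes "inj \<sigma>"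
  shows "Poly_Mapping.lookup (map_divisor \<sigma> \<Delta>) (map_curve_point \<sigma> P) = Poly_Mapping.lookup \<Delta> P"
proof -
  have "inj (map_curve_point \<sigma>)" using assms by (rule curve_point.inj_map)
  then have "map_curve_point \<sigma> P' = map_curve_point \<sigma> P \<longleftrightarrow> P' = P" for P' by (simp add: inj_eq)
  then show ?thesis unfolding lookup_map_divisor by (simp add: in_keys_iff)
qed

text \<open>Here \<open>y\<close> is a uniformizer, \<open>p\<close> has an even order and
  \<open>q y\<close> an odd one, so they cannot cancel. Order at least \<open>n\<close> therefore
  forces \<open>x - a\<close> to divide \<open>p\<close> at least \<open>n / 2\<close> times and
  \<open>q\<close> at least \<open>(n - 1) / 2\<close> times, rounded up.\<close>

lemma ideal_power_ramified:
  fixes F :: "'k::comm_ring_1 poly"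
  assumes "poly F a = 0"
  shows "u \<in> ideal_power F a 0 n \<Longrightarrow>
    [:-a, 1:] ^ ((n + 1) div 2) dvd fst u \<and> [:-a, 1:] ^ (n div 2) dvd snd u"
proof (induction n arbitrary: u)
  case (Suc n)
  from Suc.prems obtain v w where u: "u = pair_mult F ([:-a, 1:], 0) v + pair_mult F ([:-0:], 1) w"
    and *: "v \<in> ideal_power F a 0 n" "w \<in> ideal_power F a 0 n" by (rule ideal_power_SucE)
  obtain F1 where F1: "F = [:-a, 1:] * F1" using assms by (metis dvd_def poly_eq_0_iff_dvd)
  have fst_u: "fst u = [:-a, 1:] * fst v + [:-a, 1:] * snd w * F1"
    unfolding u F1 by (simp add: pair_mult_def algebra_simps del: mult_pCons_left mult_pCons_right)
  have snd_u: "snd u = [:-a, 1:] * snd v + fst w"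
    unfolding u by (simp add: pair_mult_def)
  note v = Suc.IH[OF *(1)] and w = Suc.IH[OF *(2)]
  have e: "(Suc n + 1) div 2 = Suc (n div 2)" "Suc n div 2 = (n + 1) div 2" by simp_all
  have "[:-a, 1:] ^ (n div 2) dvd fst v"
    using v le_imp_power_dvd[of "n div 2" "(n + 1) div 2" "[:-a, 1:]"] dvd_trans by fastforce
  moreover have "[:-a, 1:] ^ ((n + 1) div 2) dvd [:-a, 1:] * snd v"
  proof -
    have "[:-a, 1:] ^ ((n + 1) div 2) dvd [:-a, 1:] ^ Suc (n div 2)"
      by (rule le_imp_power_dvd) simp
    also have "\<dots> dvd [:-a, 1:] * snd v" using v by (simp add: mult_dvd_mono del: mult_pCons_left)
    finally show ?thesis .
  qed
  ultimately show ?case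
    unfolding e fst_u snd_u power_Suc mult.assoc using v w
    by (intro conjI dvd_add[OF mult_dvd_mono[OF dvd_refl] mult_dvd_mono[OF dvd_refl dvd_mult2]] dvd_add) simp_all
qed simp

text \<open>\<open>Y\<close> is a branch of \<open>y\<close> to precision \<open>N\<close> in
  \<open>x - a\<close>. Substituting it turns both generators of the ideal into multiples of
  \<open>x - a\<close>, so that the order of vanishing becomes divisibility of polynomials in
  \<open>x\<close>.\<close>

lemma ideal_power_eval:
  fixes F :: "'k::comm_ring_1 poly"
  assumes "[:-a, 1:] ^ N dvd Y\<^sup>2 - F" "poly Y a = b"
  shows "n \<le> N \<Longrightarrow> u \<in> ideal_power F a b n \<Longrightarrow> [:-a, 1:] ^ n dvd fst u + snd u * Y"
proof (induction n arbitrary: u)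
  case (Suc n)
  from Suc.prems(2) obtain v w where u: "u = pair_mult F ([:-a, 1:], 0) v + pair_mult F ([:-b:], 1) w"
    and *: "v \<in> ideal_power F a b n" "w \<in> ideal_power F a b n" by (rule ideal_power_SucE)
  have "poly (Y - [:b:]) a = 0" using assms(2) by simp
  then obtain Y1 where "Y - [:b:] = [:-a, 1:] * Y1" by (metis dvd_def poly_eq_0_iff_dvd)
  then have Y1: "Y = [:b:] + [:-a, 1:] * Y1" by (simp add: algebra_simps)
  \<comment> \<open>\<open>pair_mult\<close> replaces \<open>y ^ 2\<close> by \<open>F\<close>,
    whereas substitution produces \<open>Y ^ 2\<close>; the last term is this discrepancy, which is
    small because \<open>n\<close> stays within the precision \<open>N\<close>.\<close>
  have "fst u + snd u * Y = [:-a, 1:] * (fst v + snd v * Y) + (Y - [:b:]) * (fst w + snd w * Y)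
      - snd w * (Y\<^sup>2 - F)"
    unfolding u by (simp add: pair_mult_def algebra_simps power2_eq_square)
  also have "Y - [:b:] = [:-a, 1:] * Y1" by fact
  finally have eq: "fst u + snd u * Y = [:-a, 1:] * (fst v + snd v * Y)
      + [:-a, 1:] * Y1 * (fst w + snd w * Y) - snd w * (Y\<^sup>2 - F)" .
  have "[:-a, 1:] ^ Suc n dvd Y\<^sup>2 - F"
    using assms(1) le_imp_power_dvd[OF Suc.prems(1)] by (rule dvd_trans[rotated])
  moreover have "[:-a, 1:] ^ n dvd fst v + snd v * Y" "[:-a, 1:] ^ n dvd fst w + snd w * Y"
    using Suc.IH * Suc.prems(1) by auto
  ultimately show ?case
    unfolding eq power_Suc mult.assoc
    by (intro dvd_diff[OF dvd_add[OF mult_dvd_mono[OF dvd_refl] mult_dvd_mono[OF dvd_refl dvd_mult]] dvd_mult])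
qed simp

section \<open>The group of divisor classes, and functions regular on the affine chart\<close>

context hyperelliptic
begin

lemma principal_degree:
  assumes "\<Delta> \<in> principal_divisors d f"
  shows "divisor_degree \<Delta> = 0"
proof -
  from assms obtain \<phi> where \<phi>: "\<phi> \<in> function_field d f" "\<phi> \<noteq> 0"
    and \<Delta>: "Poly_Mapping.keys \<Delta> \<subseteq> curve_points d f"
      "\<forall>P\<in>curve_points d f. Poly_Mapping.lookup \<Delta> P = order_at P \<phi>"
    by (auto simp: principal_divisors_def)
  obtain S where S: "finite S" "S \<subseteq> curve_points d f" "\<forall>P\<in>curve_points d f - S. order_at P \<phi> = 0"
    "(\<Sum>P\<in>S. order_at P \<phi>) = 0"
    using divisor_exists[OF \<phi>] by blast
  have "Poly_Mapping.keys \<Delta> \<subseteq> S" using \<Delta> S(3) by (metis DiffI in_keys_iff subsetD subsetI)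
  with S(1) have "divisor_degree \<Delta> = (\<Sum>P\<in>S. Poly_Mapping.lookup \<Delta> P)" by (rule divisor_degree_eq)
  also have "\<dots> = (\<Sum>P\<in>S. order_at P \<phi>)" using \<Delta>(2) S(2) by (intro sum.cong) auto
  finally show ?thesis using S(4) by simp
qed

lemma has_ord_constant: "P \<in> curve_points d f \<Longrightarrow> order_at P 1 = 0"
  by (rule vanishing_order_eqI[OF _ has_ord_1])

lemma one_in_function_field: "1 \<in> function_field d f"
  using ev_in_ff[of "(1, 0)"] by simp

lemma subgroup_principal: "subgroup (principal_divisors d f) (Div0 d f)"
proof -
  interpret comm_group "Div0 d f" by (rule comm_group_Div0)
  show ?thesis
  proof (rule subgroupI)
    show "principal_divisors d f \<subseteq> carrier (Div0 d f)"
    proof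
      fix \<Delta> assume D: "\<Delta> \<in> principal_divisors d f"
      then have "Poly_Mapping.keys \<Delta> \<subseteq> curve_points d f" by (simp add: principal_divisors_def)
      with principal_degree[OF D] show "\<Delta> \<in> carrier (Div0 d f)" by simp
    qed
    have "0 \<in> principal_divisors d f"
      using one_in_function_field has_ord_constant by (auto simp: principal_divisors_def intro!: bexI[of _ 1])
    then show "principal_divisors d f \<noteq> {}" by blast
  next
    fix \<Delta> assume D: "\<Delta> \<in> principal_divisors d f"
    then obtain \<phi> where \<phi>: "\<phi> \<in> function_field d f - {0}"
      "\<forall>P\<in>curve_points d f. Poly_Mapping.lookup \<Delta> P = order_at P \<phi>"
      and keys: "Poly_Mapping.keys \<Delta> \<subseteq> curve_points d f"
      by (auto simp: principal_divisors_def)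
    have "inv\<^bsub>Div0 d f\<^esub> \<Delta> = - \<Delta>"
      by (rule inv_equality) (use keys principal_degree[OF D] in \<open>auto simp: divisor_degree_uminus\<close>)
    moreover have "- \<Delta> \<in> principal_divisors d f"
      unfolding principal_divisors_def using \<phi> keys function_field_inverse[of \<phi>] ord_inverse
      by (auto intro!: bexI[of _ "inverse \<phi>"])
    ultimately show "inv\<^bsub>Div0 d f\<^esub> \<Delta> \<in> principal_divisors d f" by simp
  next
    fix \<Delta> \<Delta>' assume "\<Delta> \<in> principal_divisors d f" "\<Delta>' \<in> principal_divisors d f"
    then obtain \<phi> \<psi> where \<phi>: "\<phi> \<in> function_field d f - {0}" "\<psi> \<in> function_field d f - {0}"
      "\<forall>P\<in>curve_points d f. Poly_Mapping.lookup \<Delta> P = order_at P \<phi>"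
      "\<forall>P\<in>curve_points d f. Poly_Mapping.lookup \<Delta>' P = order_at P \<psi>"
      and keys: "Poly_Mapping.keys \<Delta> \<subseteq> curve_points d f" "Poly_Mapping.keys \<Delta>' \<subseteq> curve_points d f"
      by (auto simp: principal_divisors_def)
    have "Poly_Mapping.keys (\<Delta> + \<Delta>') \<subseteq> curve_points d f" using keys keys_add[of \<Delta> \<Delta>'] by blast
    moreover have "\<phi> * \<psi> \<in> function_field d f - {0}" using \<phi>(1,2) function_field_mult by auto
    moreover have "\<forall>P\<in>curve_points d f. Poly_Mapping.lookup (\<Delta> + \<Delta>') P = order_at P (\<phi> * \<psi>)"
      using \<phi> ord_mult by (auto simp: lookup_add)
    ultimately show "\<Delta> \<otimes>\<^bsub>Div0 d f\<^esub> \<Delta>' \<in> principal_divisors d f"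
      unfolding principal_divisors_def by auto
  qed
qed

lemma normal_principal: "normal (principal_divisors d f) (Div0 d f)"
  using comm_group.normal_iff_subgroup[OF comm_group_Div0] subgroup_principal by blast

lemma comm_group_Pic0: "comm_group (Pic0 d f)"
  unfolding Pic0_def by (rule comm_group.abelian_FactGroup[OF comm_group_Div0 subgroup_principal])

lemma divisor_class_in_Pic0: "\<Delta> \<in> carrier (Div0 d f) \<Longrightarrow> divisor_class d f \<Delta> \<in> carrier (Pic0 d f)"
  unfolding Pic0_def carrier_FactGroup divisor_class_def by blast

lemma divisor_class_pow_eq_one_iff:
  assumes D: "\<Delta> \<in> carrier (Div0 d f)"
  shows "divisor_class d f \<Delta> [^]\<^bsub>Pic0 d f\<^esub> (n::int) = \<one>\<^bsub>Pic0 d f\<^esub> \<longleftrightarrow>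
    frag_cmul n \<Delta> \<in> principal_divisors d f"
proof -
  interpret G: comm_group "Div0 d f" by (rule comm_group_Div0)
  interpret N: normal "principal_divisors d f" "Div0 d f" by (rule normal_principal)
  interpret h: group_hom "Div0 d f" "Pic0 d f" "\<lambda>a. principal_divisors d f #>\<^bsub>Div0 d f\<^esub> a"
    unfolding Pic0_def
    by (intro group_hom.intro group_hom_axioms.intro N.factorgroup_is_group N.r_coset_hom_Mod G.is_group)
  have "divisor_class d f \<Delta> [^]\<^bsub>Pic0 d f\<^esub> n = principal_divisors d f #>\<^bsub>Div0 d f\<^esub> frag_cmul n \<Delta>"
    unfolding divisor_class_def h.hom_int_pow[OF D, symmetric] int_pow_Div0[OF D] ..
  moreover have "frag_cmul n \<Delta> \<in> carrier (Div0 d f)"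
    using G.int_pow_closed[OF D, of n] unfolding int_pow_Div0[OF D] .
  moreover have "\<one>\<^bsub>Pic0 d f\<^esub> = principal_divisors d f" by (simp add: Pic0_def)
  ultimately show ?thesis
    using G.coset_join1 G.coset_join2 subgroup_principal by metis
qed

lemma principal_uminus: "\<Delta> \<in> principal_divisors d f \<Longrightarrow> - \<Delta> \<in> principal_divisors d f"
proof -
  assume D: "\<Delta> \<in> principal_divisors d f"
  interpret G: comm_group "Div0 d f" by (rule comm_group_Div0)
  have "\<Delta> \<in> carrier (Div0 d f)" using D subgroup.subset[OF subgroup_principal] by blast
  then have "inv\<^bsub>Div0 d f\<^esub> \<Delta> = - \<Delta>"
    by (intro G.inv_equality) (auto simp: divisor_degree_uminus)
  with subgroup.m_inv_closed[OF subgroup_principal D] show ?thesis by simp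
qed

lemma independent_class:
  assumes D: "\<Delta> \<in> carrier (Div0 d f)"
    and inf: "\<And>n. n \<ge> 1 \<Longrightarrow> frag_cmul (int n) \<Delta> \<notin> principal_divisors d f"
  shows "int_independent (Pic0 d f) {divisor_class d f \<Delta>}"
proof (rule int_independent_singleton[OF comm_group_Pic0 divisor_class_in_Pic0[OF D]])
  fix n :: int
  assume "divisor_class d f \<Delta> [^]\<^bsub>Pic0 d f\<^esub> n = \<one>\<^bsub>Pic0 d f\<^esub>"
  then have n: "frag_cmul n \<Delta> \<in> principal_divisors d f" using divisor_class_pow_eq_one_iff[OF D] by blast
  show "n = 0"
  proof (rule ccontr)
    assume "n \<noteq> 0"
    then consider "n = int (nat n)" "nat n \<ge> 1" | "- n = int (nat (- n))" "nat (- n) \<ge> 1" by linarith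
    then show False
    proof cases
      case 1
      with n inf[of "nat n"] show False by simp
    next
      case 2
      from principal_uminus[OF n] have "frag_cmul (- n) \<Delta> \<in> principal_divisors d f" by simp
      with 2 inf[of "nat (- n)"] show False by simp
    qed
  qed
qed

text \<open>The affine coordinate ring is integrally closed. At a root \<open>a\<close> of the
  denominator, regularity at \<open>(a, b)\<close> and \<open>(a, - b)\<close> forces
  \<open>p(a) = q(a) = 0\<close>; if \<open>b = 0\<close>, the numerator has order at least 2, with
  the same effect. The factor \<open>x - a\<close> then cancels.\<close>

lemma regular_imp_polynomial_aux:
  assumes "\<And>a b. Affine a b \<in> curve_points d f \<Longrightarrow> order_at (Affine a b) \<phi> \<ge> 0" "\<phi> \<noteq> 0"
  shows "w \<noteq> 0 \<Longrightarrow> \<phi> = aff.ev u / aff.ev (w, 0) \<Longrightarrow> \<exists>v. \<phi> = aff.ev v"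
proof (induction "degree w" arbitrary: u w)
  case 0
  then obtain e where e: "w = [:e:]" "e \<noteq> 0" by (metis degree_eq_zeroE pCons_0_0)
  have "aff.ev (w, 0) * aff.ev ([:1/e:], 0) = aff.ev (1, 0)"
    unfolding aff.ev_mult[symmetric] using e by (simp add: pair_mult_def one_pCons)
  then have "aff.ev u / aff.ev (w, 0) = aff.ev u * aff.ev ([:1/e:], 0)"
    by (metis aff.ev_1 divide_inverse inverse_unique)
  with 0 show ?case by (metis aff.ev_mult)
next
  case (Suc n)
  obtain p q where u: "u = (p, q)" by fastforce
  have u0: "u \<noteq> 0" using assms(2) Suc.prems by auto
  obtain a where a: "poly w a = 0" using alg_closed_imp_poly_has_root[of w] Suc.hyps(2) by auto
  then obtain w1 where w1: "w = [:-a, 1:] * w1" by (metis dvd_def poly_eq_0_iff_dvd)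
  have "order a w \<ge> 1" using a Suc.prems(1) order_root by (metis One_nat_def Suc_leI neq0_conv)
  have ge: "(if b = 0 then 2 else 1) \<le> order_at (Affine a b) (aff.ev u)" if "b\<^sup>2 = poly F a" for b
  proof -
    have P: "Affine a b \<in> curve_points d f" using that by (simp add: affine_in_curve)
    have "order_at (Affine a b) \<phi> = order_at (Affine a b) (aff.ev u) - order_at (Affine a b) (aff.ev (w, 0))"
      unfolding Suc.prems(2) by (rule ord_divide[OF P u0 Suc.prems(1)])
    moreover have "order_at (Affine a b) (aff.ev (w, 0)) = int (order a w) * (if b = 0 then 2 else 1)"
      by (rule vanishing_order_eqI[OF P has_ord_poly_affine[OF P Suc.prems(1)]])
    ultimately show ?thesis using assms(1)[OF P] \<open>order a w \<ge> 1\<close> by (simp split: if_splits)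
  qed
  have val0: "poly p a + b * poly q a = 0" if "b\<^sup>2 = poly F a" for b
  proof (rule ccontr)
    assume "poly p a + b * poly q a \<noteq> 0"
    then have "chart_val (Affine a b) u \<noteq> 0" by (simp add: chart_val_def pair_val_def u)
    moreover have P: "Affine a b \<in> curve_points d f" using that by (simp add: affine_in_curve)
    ultimately have "order_at (Affine a b) (aff.ev u) = 0"
      using vanishing_order_eqI[OF P has_ord_chart_unit[OF P]] by (simp add: chart_ev_affine)
    with ge[OF that] show False by (simp split: if_splits)
  qed
  obtain b where b: "b\<^sup>2 = poly F a" using nth_root_exists[of 2 "poly F a"] by auto
  have "poly p a = 0 \<and> poly q a = 0"
  proof (cases "b = 0")
    case False
    have 1: "poly p a + b * poly q a = 0" by (rule val0[OF b])
    have 2: "poly p a - b * poly q a = 0" using val0[of "- b"] b by simp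
    have "2 * (b * poly q a) = (poly p a + b * poly q a) - (poly p a - b * poly q a)" by simp
    then have "2 * (b * poly q a) = 0" by (simp only: 1 2 diff_0_right)
    with False 1 show ?thesis by simp
  next
    case True
    then have P: "Affine a 0 \<in> curve_points d f" and Fa: "poly F a = 0" using b by (simp_all add: affine_in_curve)
    have h: "has_ord (Affine a 0) (order_at (Affine a 0) (aff.ev u)) (chart_ev (Affine a 0) u)"
      using has_ord_ord[OF P u0] by (simp add: chart_ev_affine)
    have "int 2 \<le> order_at (Affine a 0) (aff.ev u)" using ge[of 0] Fa by simp
    then have "u \<in> ideal_power F a 0 2"
      using has_ord_ideal[OF P h, of 2] by (simp add: chart_poly_def)
    from ideal_power_ramified[OF Fa this] have "[:-a, 1:] dvd p" "[:-a, 1:] dvd q" by (simp_all add: u)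
    then show ?thesis by (simp add: poly_eq_0_iff_dvd)
  qed
  then obtain p1 q1 where pq: "p = [:-a, 1:] * p1" "q = [:-a, 1:] * q1"
    by (metis dvd_def poly_eq_0_iff_dvd)
  have "w1 \<noteq> 0" using Suc.prems(1) w1 by auto
  have "degree w = Suc (degree w1)" unfolding w1 using \<open>w1 \<noteq> 0\<close> by (subst degree_mult_eq) auto
  then have n: "n = degree w1" using Suc.hyps(2) by simp
  have "aff.ev u = aff.ev ([:-a, 1:], 0) * aff.ev (p1, q1)"
    "aff.ev (w, 0) = aff.ev ([:-a, 1:], 0) * aff.ev (w1, 0)"
    unfolding aff.ev_mult[symmetric] u pq w1
    by (simp_all add: pair_mult_def del: mult_pCons_left)
  moreover have "aff.ev ([:-a, 1:], 0) \<noteq> 0" by (simp add: zero_prod_def)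
  ultimately have "\<phi> = aff.ev (p1, q1) / aff.ev (w1, 0)" using Suc.prems(2) by simp
  from Suc.hyps(1)[OF n \<open>w1 \<noteq> 0\<close> this] show ?case .
qed

lemma regular_imp_polynomial:
  assumes "\<phi> \<in> function_field d f" "\<phi> \<noteq> 0"
    and "\<And>a b. Affine a b \<in> curve_points d f \<Longrightarrow> order_at (Affine a b) \<phi> \<ge> 0"
  obtains u where "\<phi> = aff.ev u"
  using function_field_repr[OF assms(1)] regular_imp_polynomial_aux[OF assms(3,2)] by metis

end

section \<open>Truncated square roots\<close>

text \<open>
  The square root of \<open>1 + \<theta> ((1 + z)\<^sup>m - 1)\<close>, correct modulo \<open>z\<^sup>n\<close>. For \<open>\<theta> = x\<^sub>0\<^sup>m / y\<^sub>0\<^sup>2\<close> it is the expansion of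
  \<open>y / y\<^sub>0\<close> on \<open>y\<^sup>2 = x\<^sup>m + \<delta>\<close> at \<open>(x\<^sub>0, y\<^sub>0)\<close> in the coordinate \<open>x = x\<^sub>0 (1 + z)\<close>.
\<close>

definition sqrt_series :: "'a::field_char_0 \<Rightarrow> nat \<Rightarrow> nat \<Rightarrow> 'a poly" where
  "sqrt_series \<theta> m n = (\<Sum>k<n. smult (((1/2) gchoose k) * \<theta> ^ k) (([:1, 1:] ^ m - 1) ^ k))"

text \<open>By Vandermonde's convolution the coefficients of the square are those of
  \<open>(1 + z) ^ (1/2 + 1/2)\<close>.\<close>

lemma sqrt_coeffs_square:
  "monom 1 n dvd (\<Sum>k<n. monom ((1/2) gchoose k) k)\<^sup>2 - [:1, 1 :: 'a::field_char_0:]"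
proof -
  let ?T = "\<Sum>k<n. monom ((1/2) gchoose k) k :: 'a poly"
  have T: "coeff ?T i = (1/2) gchoose i" if "i < n" for i
    using that by (simp add: coeff_sum coeff_monom)
  have "coeff (?T\<^sup>2) i = coeff [:1, 1:] i" if "i < n" for i
  proof -
    have "coeff (?T\<^sup>2) i = (\<Sum>j=0..i. ((1/2) gchoose j) * ((1/2) gchoose (i - j)))"
      unfolding power2_eq_square coeff_mult atMost_atLeast0
      using that by (intro sum.cong) (auto simp: T)
    also have "\<dots> = (1/2 + 1/2) gchoose i" by (rule gbinomial_Vandermonde)
    also have "\<dots> = of_nat (1 choose i)" by (simp add: binomial_gbinomial)
    also have "\<dots> = coeff [:1, 1:] i"
      by (cases i) (auto simp: coeff_pCons split: nat.splits)
    finally show ?thesis .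
  qed
  then show ?thesis by (simp add: monom_1_dvd_iff' del: coeff_pCons)
qed

lemma pcompose_monom: "pcompose (monom c k) q = smult c (q ^ k)"
proof (induction k)
  case 0
  then show ?case by (simp add: monom_0)
next
  case (Suc k)
  then show ?case by (simp add: monom_Suc pcompose_pCons)
qed

lemma sqrt_series_pcompose:
  "sqrt_series \<theta> m n = pcompose (\<Sum>k<n. monom ((1/2) gchoose k) k) (smult \<theta> ([:1, 1:] ^ m - 1))"
  by (simp add: sqrt_series_def pcompose_sum pcompose_monom smult_power)

lemma X_power_dvd_cancel:
  fixes a b :: "'a::field poly"
  assumes "[:-e, 1:] ^ n dvd a * b" "poly b e \<noteq> 0"
  shows "[:-e, 1:] ^ n dvd a"
proof (cases "a = 0")
  case False
  have "b \<noteq> 0" using assms(2) by auto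
  with False have "order e (a * b) = order e a + order e b" by (intro order_mult) simp
  also have "order e b = 0" using assms(2) by (rule order_0I)
  finally show ?thesis using assms(1) False \<open>b \<noteq> 0\<close> by (simp add: order_divides)
qed simp

lemma monom_eq_X_power: "monom (1::'a::field) n = [:-0, 1:] ^ n"
  by (simp add: monom_altdef)

text \<open>The argument \<open>\<theta> ((1 + z) ^ m - 1)\<close> has no constant term, so
  substituting it into the truncated binomial series keeps the precision
  \<open>z ^ n\<close>.\<close>

lemma sqrt_series_square:
  fixes \<theta> :: "'a::field_char_0"
  shows "[:-0, 1:] ^ n dvd (sqrt_series \<theta> m n)\<^sup>2 - (1 + smult \<theta> ([:1, 1:] ^ m - 1))"
proof -
  let ?T = "\<Sum>k<n. monom ((1/2) gchoose k) k :: 'a poly"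
  let ?B = "smult \<theta> ([:1, 1:] ^ m - 1)"
  obtain R where R: "?T\<^sup>2 - [:1, 1:] = monom 1 n * R" using sqrt_coeffs_square by blast
  have "(sqrt_series \<theta> m n)\<^sup>2 - (1 + ?B) = pcompose (?T\<^sup>2 - [:1, 1:]) ?B"
    by (simp add: sqrt_series_pcompose pcompose_diff pcompose_mult power2_eq_square pcompose_pCons
        one_pCons)
  also have "\<dots> = ?B ^ n * pcompose R ?B"
    unfolding R by (simp add: pcompose_mult pcompose_monom)
  finally have eq: "(sqrt_series \<theta> m n)\<^sup>2 - (1 + ?B) = ?B ^ n * pcompose R ?B" .
  have "poly ?B 0 = 0" by simp
  then have "[:-0, 1:] dvd ?B" unfolding poly_eq_0_iff_dvd .
  then have "[:-0, 1:] ^ n dvd ?B ^ n" by (rule dvd_power_same)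
  then show ?thesis unfolding eq by (rule dvd_mult2)
qed

lemma poly_sqrt_series_0: "n \<ge> 1 \<Longrightarrow> poly (sqrt_series \<theta> m n) 0 = 1"
proof -
  assume "n \<ge> 1"
  have "poly (sqrt_series \<theta> m n) 0 = (\<Sum>k<n. (((1/2) gchoose k) * \<theta> ^ k) * 0 ^ k)"
    by (simp add: sqrt_series_def poly_sum)
  also have "\<dots> = (\<Sum>k\<in>{0}. (((1/2) gchoose k) * \<theta> ^ k) * 0 ^ k)"
    by (rule sum.mono_neutral_right) (use \<open>n \<ge> 1\<close> in auto)
  finally show ?thesis by simp
qed

text \<open>Comparing the values at \<open>t\<close> and \<open>- t\<close> separates the even part
  from the odd one.\<close>

lemma even_odd_zero:
  fixes p q :: "'a::field_char_0 poly"
  assumes "pcompose p [:0, 0, 1:] + [:0, 1:] ^ 3 * pcompose q [:0, 0, 1:] = 0"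
  shows "p = 0 \<and> q = 0"
proof -
  have ev: "poly p (t ^ 2) + t ^ 3 * poly q (t ^ 2) = 0" for t
    using arg_cong[OF assms, of "\<lambda>r. poly r t"] by (simp add: poly_pcompose power2_eq_square)
  have "poly p (t ^ 2) = 0 \<and> t ^ 3 * poly q (t ^ 2) = 0" for t
  proof -
    have 1: "poly p (t ^ 2) + t ^ 3 * poly q (t ^ 2) = 0" by (rule ev)
    have 2: "poly p (t ^ 2) - t ^ 3 * poly q (t ^ 2) = 0" using ev[of "- t"] by simp
    have "2 * poly p (t ^ 2) = (poly p (t ^ 2) + t ^ 3 * poly q (t ^ 2))
        + (poly p (t ^ 2) - t ^ 3 * poly q (t ^ 2))" by simp
    then have "2 * poly p (t ^ 2) = 0" by (simp only: 1 2 add_0_right)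
    with 1 show ?thesis by simp
  qed
  then have "poly (pcompose p [:0, 0, 1:]) t = 0" "poly ([:0, 1:] ^ 3 * pcompose q [:0, 0, 1:]) t = 0" for t
    by (simp_all add: poly_pcompose power2_eq_square[symmetric])
  then have "pcompose p [:0, 0, 1:] = 0" "[:0, 1:] ^ 3 * pcompose q [:0, 0, 1:] = 0"
    using poly_all_0_iff_0 by blast+
  then show ?thesis by (auto simp: pcompose_eq_0)
qed

text \<open>
  Substituting \<open>1 + z = T\<^sup>2\<close> turns the combination into \<open>P + T\<^sup>3 Q\<close> up to a power of \<open>T\<close>, with \<open>P\<close> and \<open>Q\<close> evaluated at \<open>T\<^sup>2\<close>.
  It has degree at most \<open>n\<close> and is divisible by \<open>(T - 1)\<^sup>n\<close>, but has no \<open>T\<close>-coefficient, so it vanishes.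
\<close>

lemma sqrt_series_kernel:
  fixes P Q :: "'a::field_char_0 poly"
  assumes m: "odd m" "m \<ge> 3" and n: "n \<ge> 1" and P: "2 * degree P \<le> n"
    and Q: "Q = 0 \<or> 2 * degree Q + 3 \<le> n"
    and dvd: "[:-0, 1:] ^ n dvd [:1, 1:] ^ ((m - 3) div 2) * P + Q * sqrt_series 1 m n"
  shows "P = 0 \<and> Q = 0"
proof -
  \<comment> \<open>\<open>L\<close> is the variable \<open>T\<close> centred at 1, and
    \<open>z = L ^ 2 - 1\<close>; thus expansions at the point remain expansions at 0.\<close>
  define L z :: "'a poly" where "L = [:1, 1:]" and "z = [:0, 2, 1:]"
  define S where "S = pcompose (sqrt_series 1 m n) z"
  have Lz: "pcompose L z = L ^ 2" by (simp add: L_def z_def pcompose_pCons power2_eq_square)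
  have comp_dvd: "[:-0, 1:] ^ n dvd pcompose r z" if "[:-0, 1:] ^ n dvd r" for r
  proof -
    from that obtain r' where r': "r = monom 1 n * r'" unfolding monom_eq_X_power by blast
    have "pcompose r z = z ^ n * pcompose r' z"
      unfolding r' by (simp add: pcompose_mult pcompose_monom)
    moreover have "[:-0, 1:] dvd z" unfolding poly_eq_0_iff_dvd[symmetric] by (simp add: z_def)
    ultimately show ?thesis by (simp add: dvd_power_same dvd_mult2)
  qed
  have pc_pow: "pcompose (r ^ k) z = (pcompose r z) ^ k" for r k
    by (induction k) (simp_all add: pcompose_mult pcompose_1)
  have m2: "2 * ((m - 3) div 2) + 3 = m" using m by (auto elim!: oddE)
  have "[:-0, 1:] ^ n dvd (sqrt_series 1 m n)\<^sup>2 - L ^ m"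
    using sqrt_series_square[where \<theta> = "1::'a" and n = n and m = m] by (simp add: L_def)
  from comp_dvd[OF this] have "[:-0, 1:] ^ n dvd S\<^sup>2 - (L ^ m)\<^sup>2"
    by (simp add: pcompose_diff pc_pow S_def Lz power_mult[symmetric] mult.commute)
  then have "[:-0, 1:] ^ n dvd (S - L ^ m) * (S + L ^ m)"
    by (simp add: power2_eq_square algebra_simps)
  moreover have "poly (S + L ^ m) 0 \<noteq> 0"
    using poly_sqrt_series_0[OF n, of "1::'a" m] by (simp add: S_def poly_pcompose z_def L_def)
  \<comment> \<open>For \<theta> = 1 the square root is the polynomial \<open>L ^ m\<close> itself:
    both \<open>S\<close> and \<open>L ^ m\<close> have value 1 at 0, so the factor
    \<open>S + L ^ m\<close> can be cancelled and the sign is settled.\<close>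
  ultimately have S: "[:-0, 1:] ^ n dvd S - L ^ m" by (rule X_power_dvd_cancel)
  define P' Q' where "P' = pcompose P z" and "Q' = pcompose Q z"
  define g where "g = (m - 3) div 2"
  from comp_dvd[OF dvd] have "[:-0, 1:] ^ n dvd (L ^ 2) ^ g * P' + Q' * S"
    unfolding L_def[symmetric] g_def[symmetric]
    by (simp add: pcompose_add pcompose_mult pc_pow Lz P'_def Q'_def S_def)
  from dvd_diff[OF this dvd_mult[OF S, of Q']]
  have "[:-0, 1:] ^ n dvd (L ^ 2) ^ g * P' + Q' * L ^ m" by (simp add: algebra_simps)
  also have "(L ^ 2) ^ g * P' + Q' * L ^ m = (P' + L ^ 3 * Q') * L ^ (2 * g)"
  proof -
    have "L ^ m = L ^ (2 * g) * L ^ 3"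
      using m2 unfolding g_def by (metis power_add)
    moreover have "(L ^ 2) ^ g = L ^ (2 * g)" by (simp only: power_mult)
    ultimately show ?thesis by (simp only:) (simp add: algebra_simps)
  qed
  finally have "[:-0, 1:] ^ n dvd (P' + L ^ 3 * Q') * L ^ (2 * g)" .
  then have "[:-0, 1:] ^ n dvd P' + L ^ 3 * Q'"
    by (rule X_power_dvd_cancel) (simp add: L_def)
  then obtain c where c: "P' + L ^ 3 * Q' = [:-0, 1:] ^ n * c" by blast
  have degz: "degree z = 2" by (simp add: z_def)
  have "degree (P' + L ^ 3 * Q') \<le> n"
  proof (rule degree_add_le)
    show "degree P' \<le> n" using P by (simp add: P'_def degree_pcompose degz)
    show "degree (L ^ 3 * Q') \<le> n"
    proof (cases "Q = 0")
      case False
      have "degree (L ^ 3 * Q') \<le> degree (L ^ 3) + degree Q'" by (rule degree_mult_le)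
      also have "degree (L ^ 3) = 3" unfolding L_def by (subst degree_power_eq) simp_all
      also have "degree Q' = degree Q * 2" by (simp add: Q'_def degree_pcompose degz)
      finally show ?thesis using Q False by simp
    qed (simp add: Q'_def)
  qed
  then have degc: "degree c = 0"
  proof (cases "c = 0")
    case False
    have "degree ([:-0, 1:] ^ n * c) = n + degree c"
      using False by (subst degree_mult_eq) (auto simp: degree_power_eq)
    then show ?thesis using \<open>degree (P' + L ^ 3 * Q') \<le> n\<close> c by simp
  qed simp
  then obtain e where e: "c = [:e:]" by (metis degree_eq_zeroE)
  \<comment> \<open>Translation by 1 returns from the centred variable to \<open>T\<close>, where
    \<open>z\<close> is \<open>T ^ 2 - 1\<close> and parity in \<open>T\<close> becomes
    visible.\<close>
  define P2 Q2 where "P2 = pcompose P [:-1, 1:]" and "Q2 = pcompose Q [:-1, 1:]"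
  have zz: "pcompose z [:-1, 1:] = pcompose [:-1, 1:] [:0, 0, 1:]"
    by (simp add: z_def pcompose_pCons)
  have pc_pow': "pcompose (r ^ k) s = (pcompose r s) ^ k" for r s :: "'a poly" and k
    by (induction k) (simp_all add: pcompose_mult pcompose_1)
  have "pcompose (P' + L ^ 3 * Q') [:-1, 1:]
      = pcompose P2 [:0, 0, 1:] + [:0, 1:] ^ 3 * pcompose Q2 [:0, 0, 1:]"
    by (simp add: pcompose_add pcompose_mult pc_pow' P'_def Q'_def P2_def Q2_def L_def
        pcompose_assoc[symmetric] zz pcompose_pCons[of 1])
  moreover have "pcompose ([:-0, 1:] ^ n * c) [:-1, 1:] = smult e ([:-1, 1:] ^ n)"
    by (simp add: pcompose_smult pc_pow' e pcompose_pCons)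
  ultimately have main: "pcompose P2 [:0, 0, 1:] + [:0, 1:] ^ 3 * pcompose Q2 [:0, 0, 1:]
      = smult e ([:-1, 1:] ^ n)" using c by metis
  \<comment> \<open>The derivative at 0 is the \<open>T\<close>-coefficient: it is 0 on the left and
    \<open>e n (-1) ^ (n - 1)\<close> on the right.\<close>
  have "poly (pderiv (pcompose P2 [:0, 0, 1:] + [:0, 1:] ^ 3 * pcompose Q2 [:0, 0, 1:])) 0 = 0"
    by (simp add: pderiv_add pderiv_mult pderiv_pcompose pderiv_power pderiv_pCons)
  then have "poly (pderiv (smult e ([:-1, 1:] ^ n))) 0 = 0" unfolding main .
  moreover have "poly (pderiv (smult e ([:-1, 1:] ^ n))) 0 = e * (of_nat n * (- 1) ^ (n - 1))"
    by (simp add: pderiv_smult pderiv_power pderiv_pCons)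
  ultimately have "e = 0" using n by simp
  with main have "P2 = 0 \<and> Q2 = 0" by (intro even_odd_zero) simp
  then show ?thesis
    using pcompose_eq_0[of P "[:-1, 1:]"] pcompose_eq_0[of Q "[:-1, 1:]"]
    by (simp add: P2_def Q2_def)
qed

lemma of_rat_gbinomial: "of_rat (a gchoose k) = (of_rat a :: 'a::field_char_0) gchoose k"
proof -
  have "of_rat (fact k) = (fact k :: 'a)" by (metis of_nat_fact of_rat_of_nat_eq)
  moreover have "of_rat (\<Prod>i=0..<j. a - of_nat i) = (\<Prod>i=0..<j. of_rat a - of_nat i :: 'a)" for j
    by (induction j) (simp_all add: of_rat_mult of_rat_diff)
  ultimately show ?thesis by (simp add: gbinomial_prod_rev of_rat_divide)
qed

interpretation of_rat_poly_hom: map_poly_comm_ring_hom of_rat ..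

lemma map_poly_of_rat_L: "map_poly of_rat ([:1, 1:] ^ m - 1) = [:1, 1 :: 'a::field_char_0:] ^ m - 1"
  by (simp add: hom_distribs)

text \<open>The coefficient of \<open>z ^ i\<close> in \<open>sqrt_series\<close> with \<theta> an
  indeterminate; through it the determinant of the linear system becomes a rational polynomial in
  \<theta>.\<close>

definition sqrt_entry :: "nat \<Rightarrow> nat \<Rightarrow> nat \<Rightarrow> rat poly" where
  "sqrt_entry m n i = (\<Sum>k<n. monom (((1/2) gchoose k) * coeff (([:1, 1:] ^ m - 1) ^ k) i) k)"

lemma poly_sqrt_entry:
  "poly (map_poly of_rat (sqrt_entry m n i)) \<theta> = coeff (sqrt_series \<theta> m n) i"
proof -
  have c: "of_rat (coeff (([:1, 1:] ^ m - 1) ^ k) i) = coeff (([:1, 1 :: 'a:] ^ m - 1) ^ k) i" for k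
  proof -
    have "map_poly of_rat (([:1, 1:] ^ m - 1) ^ k) = (map_poly of_rat ([:1, 1:] ^ m - 1) :: 'a poly) ^ k"
      by (simp only: hom_distribs)
    then have "map_poly of_rat (([:1, 1:] ^ m - 1) ^ k) = ([:1, 1 :: 'a:] ^ m - 1) ^ k"
      by (simp only: map_poly_of_rat_L)
    from arg_cong[OF this, of "\<lambda>p. coeff p i"] show ?thesis by (simp only: coeff_map_poly of_rat_0)
  qed
  have half: "of_rat ((1/2) gchoose k) = (1/2 :: 'a) gchoose k" for k
    by (simp add: of_rat_gbinomial of_rat_divide)
  have "map_poly of_rat (sqrt_entry m n i)
      = (\<Sum>k<n. monom (of_rat (((1/2) gchoose k) * coeff (([:1, 1:] ^ m - 1) ^ k) i) :: 'a) k)"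
    by (rule poly_eqI) (simp add: sqrt_entry_def coeff_map_poly coeff_sum of_rat_hom.hom_sum coeff_monom if_distrib cong: if_cong)
  then show ?thesis
    by (simp add: sqrt_series_def poly_sum poly_monom coeff_sum of_rat_mult c half mult_ac)
qed

text \<open>The power of \<open>1 + z\<close> is inserted to make the linear system square.\<close>

definition sqrt_matrix :: "'a::field_char_0 \<Rightarrow> nat \<Rightarrow> nat \<Rightarrow> 'a mat" where
  "sqrt_matrix \<theta> m n = mat n n (\<lambda>(i, j). if j < Suc (n div 2)
     then coeff ([:1, 1:] ^ ((m - 3) div 2) * monom 1 j) i
     else coeff (monom 1 (j - Suc (n div 2)) * sqrt_series \<theta> m n) i)"

definition sqrt_matrix_poly :: "nat \<Rightarrow> nat \<Rightarrow> rat poly mat" where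
  "sqrt_matrix_poly m n = mat n n (\<lambda>(i, j). if j < Suc (n div 2)
     then [:coeff ([:1, 1:] ^ ((m - 3) div 2) * monom 1 j) i:]
     else if j - Suc (n div 2) \<le> i then sqrt_entry m n (i - (j - Suc (n div 2))) else 0)"

lemma map_sqrt_matrix_poly:
  "map_mat (\<lambda>g. poly (map_poly of_rat g) \<theta>) (sqrt_matrix_poly m n) = sqrt_matrix \<theta> m n"
proof -
  have "of_rat (coeff ([:1, 1:] ^ g * monom 1 j) i) = coeff ([:1, 1 :: 'a:] ^ g * monom 1 j) i" for g i j
  proof -
    have "map_poly of_rat ([:1, 1:] ^ g * monom 1 j) = [:1, 1 :: 'a:] ^ g * monom 1 j"
      by (simp add: hom_distribs map_poly_monom)
    from arg_cong[OF this, of "\<lambda>p. coeff p i"] show ?thesis by (simp only: coeff_map_poly of_rat_0)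
  qed
  note * = this
  have const: "poly (map_poly of_rat [:r:]) \<theta> = of_rat r" for r
    by (cases "r = 0") (simp_all add: map_poly_pCons)
  show ?thesis
  proof (rule eq_matI)
    fix i j
    assume "i < dim_row (sqrt_matrix \<theta> m n)" "j < dim_col (sqrt_matrix \<theta> m n)"
    then have ij: "i < n" "j < n" by (simp_all add: sqrt_matrix_def)
    show "map_mat (\<lambda>g. poly (map_poly of_rat g) \<theta>) (sqrt_matrix_poly m n) $$ (i, j)
        = sqrt_matrix \<theta> m n $$ (i, j)"
    proof (cases "j < Suc (n div 2)")
      case True
      then show ?thesis using ij by (simp only: sqrt_matrix_poly_def sqrt_matrix_def index_map_mat
          index_mat dim_row_mat dim_col_mat split_conv if_True const *)
    next
      case False
      then show ?thesis using ij by (auto simp: sqrt_matrix_poly_def sqrt_matrix_def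
          poly_sqrt_entry coeff_monom_mult)
    qed
  qed (simp_all add: sqrt_matrix_poly_def sqrt_matrix_def)
qed

lemma sum_lessThan_add: "(\<Sum>j<k + l. f j) = (\<Sum>j<k. f j) + (\<Sum>j<l. f (j + k))"
  for f :: "nat \<Rightarrow> 'a::comm_monoid_add"
  by (induction l) (simp_all add: add_ac)

lemma sqrt_matrix_mult:
  fixes v :: "'a::field_char_0 vec"
  assumes v: "v \<in> carrier_vec n" and n: "n \<ge> 1" and i: "i < n"
  defines "P \<equiv> (\<Sum>j<Suc (n div 2). monom (v $ j) j)"
    and "Q \<equiv> (\<Sum>j<n - Suc (n div 2). monom (v $ (j + Suc (n div 2))) j)"
  shows "(sqrt_matrix \<theta> m n *\<^sub>v v) $ i
    = coeff ([:1, 1:] ^ ((m - 3) div 2) * P + Q * sqrt_series \<theta> m n) i"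
proof -
  define k where "k = Suc (n div 2)"
  define a where "a = (\<lambda>j. if j < k then coeff ([:1, 1:] ^ ((m - 3) div 2) * monom 1 j) i
     else coeff (monom 1 (j - k) * sqrt_series \<theta> m n) i)"
  have k: "k \<le> n" using n by (auto simp: k_def)
  have "(sqrt_matrix \<theta> m n *\<^sub>v v) $ i = (\<Sum>j<n. a j * v $ j)"
    unfolding a_def k_def using v i by (simp add: sqrt_matrix_def scalar_prod_def atLeast0LessThan)
  also have "\<dots> = (\<Sum>j<k. a j * v $ j) + (\<Sum>j<n - k. a (j + k) * v $ (j + k))"
    using sum_lessThan_add[of "\<lambda>j. a j * v $ j" k "n - k"] k by simp
  also have "(\<Sum>j<k. a j * v $ j) = coeff ([:1, 1:] ^ ((m - 3) div 2) * P) i"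
  proof -
    have "[:1, 1:] ^ ((m - 3) div 2) * P = (\<Sum>j<k. smult (v $ j) ([:1, 1:] ^ ((m - 3) div 2) * monom 1 j))"
      unfolding P_def k_def[symmetric] sum_distrib_left
      by (intro sum.cong refl) (simp flip: mult_smult_right add: smult_monom)
    then show ?thesis by (simp add: coeff_sum a_def mult.commute)
  qed
  also have "(\<Sum>j<n - k. a (j + k) * v $ (j + k)) = coeff (Q * sqrt_series \<theta> m n) i"
  proof -
    have "Q * sqrt_series \<theta> m n = (\<Sum>j<n - k. smult (v $ (j + k)) (monom 1 j * sqrt_series \<theta> m n))"
      unfolding Q_def k_def[symmetric] sum_distrib_right
      by (intro sum.cong refl) (simp flip: mult_smult_left add: smult_monom)
    then show ?thesis by (simp add: coeff_sum a_def mult.commute)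
  qed
  finally show ?thesis by simp
qed

lemma X_power_dvd_iff: "[:-0, 1:] ^ n dvd p \<longleftrightarrow> (\<forall>i<n. coeff p i = 0)"
  for p :: "'a::field poly"
  unfolding monom_eq_X_power[symmetric] by (rule monom_1_dvd_iff')

lemma coeff_sum_monom: "coeff (\<Sum>j<k. monom (g j) j) i = (if i < k then g i else 0)"
  by (simp add: coeff_sum coeff_monom)

text \<open>A kernel vector holds the coefficients of some \<open>P\<close> of degree at most
  \<open>n / 2\<close> and some \<open>Q\<close> of degree at most \<open>(n - 3) / 2\<close>: just
  the pairs that \<open>sqrt_series_kernel\<close> excludes.\<close>

lemma det_sqrt_matrix_1:
  assumes "odd m" "m \<ge> 3" "n \<ge> 1"
  shows "det (sqrt_matrix (1::'a::field_char_0) m n) \<noteq> 0"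
proof
  assume "det (sqrt_matrix (1::'a) m n) = 0"
  moreover have "sqrt_matrix (1::'a) m n \<in> carrier_mat n n" by (simp add: sqrt_matrix_def)
  ultimately obtain v :: "'a vec" where v: "v \<in> carrier_vec n" "v \<noteq> 0\<^sub>v n"
    "sqrt_matrix 1 m n *\<^sub>v v = 0\<^sub>v n"
    using det_0_iff_vec_prod_zero by blast
  define k where "k = Suc (n div 2)"
  define P where "P = (\<Sum>j<k. monom (v $ j) j)"
  define Q where "Q = (\<Sum>j<n - k. monom (v $ (j + k)) j)"
  have "P = 0 \<and> Q = 0"
  proof (rule sqrt_series_kernel[OF assms])
    have "degree P \<le> n div 2"
      by (rule degree_le) (simp add: P_def coeff_sum_monom k_def)
    then show "2 * degree P \<le> n" by linarith
    show "Q = 0 \<or> 2 * degree Q + 3 \<le> n"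
    proof (cases "n - k = 0")
      case True
      then show ?thesis by (simp add: Q_def)
    next
      case False
      have "degree Q \<le> n - k - 1"
        by (rule degree_le) (use False in \<open>auto simp: Q_def coeff_sum_monom\<close>)
      then show ?thesis using False unfolding k_def by linarith
    qed
    show "[:-0, 1:] ^ n dvd [:1, 1:] ^ ((m - 3) div 2) * P + Q * sqrt_series 1 m n"
      unfolding X_power_dvd_iff P_def Q_def k_def
      using sqrt_matrix_mult[OF v(1) assms(3), of _ 1 m, symmetric] v(3) by simp
  qed
  then have "v $ j = 0" if "j < n" for j
  proof (cases "j < k")
    case True
    then have "coeff P j = v $ j" by (simp add: P_def coeff_sum_monom)
    with \<open>P = 0 \<and> Q = 0\<close> show ?thesis by simp
  next
    case False
    then have "coeff Q (j - k) = v $ j" using that by (simp add: Q_def coeff_sum_monom)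
    with \<open>P = 0 \<and> Q = 0\<close> show ?thesis by simp
  qed
  then have "v = 0\<^sub>v n" using v(1) by (intro eq_vecI) auto
  with v(2) show False by simp
qed

lemma comm_ring_hom_eval_rat: "comm_ring_hom (\<lambda>g. poly (map_poly of_rat g) (\<theta> :: 'a::field_char_0))"
  by unfold_locales (simp_all add: hom_distribs)

text \<open>The hypothesis on \<theta> says that \<theta> specializes to 1, and the determinant is a
  rational polynomial in \<theta> with non-zero value at 1.\<close>

lemma det_sqrt_matrix:
  fixes \<theta> :: "'a::field_char_0"
  assumes "odd m" "m \<ge> 3" "n \<ge> 1"
    and \<theta>: "\<And>g :: rat poly. poly g 1 \<noteq> 0 \<Longrightarrow> poly (map_poly of_rat g) \<theta> \<noteq> 0"
  shows "det (sqrt_matrix \<theta> m n) \<noteq> 0"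
proof -
  have det: "det (sqrt_matrix t m n) = poly (map_poly of_rat (det (sqrt_matrix_poly m n))) t"
    for t :: "'b::field_char_0"
    unfolding map_sqrt_matrix_poly[symmetric]
    by (rule comm_ring_hom.hom_det[OF comm_ring_hom_eval_rat])
  have "of_rat (poly (det (sqrt_matrix_poly m n)) 1) \<noteq> (0 :: rat)"
    using det_sqrt_matrix_1[OF assms(1-3), where 'a = rat] unfolding det
    by (metis of_rat_hom.poly_map_poly_1)
  then show ?thesis unfolding det by (intro \<theta>) simp
qed

text \<open>Multiplying by \<open>(1 + z) ^ ((m - 3) div 2)\<close> raises the degree bound for
  \<open>Q\<close> from \<open>(n - m) / 2\<close> to \<open>(n - 3) / 2\<close>. With the
  \<open>n div 2 + 1\<close> coefficients of \<open>P\<close> this gives \<open>n\<close> unknowns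
  for \<open>n\<close> conditions.\<close>

lemma sqrt_series_independent:
  fixes P Q :: "'a::field_char_0 poly"
  assumes m: "odd m" "m \<ge> 3" and n: "n \<ge> 1"
    and \<theta>: "\<And>g :: rat poly. poly g 1 \<noteq> 0 \<Longrightarrow> poly (map_poly of_rat g) \<theta> \<noteq> 0"
    and P: "2 * degree P \<le> n" and Q: "Q = 0 \<or> 2 * degree Q + m \<le> n"
    and dvd: "[:-0, 1:] ^ n dvd P + Q * sqrt_series \<theta> m n"
  shows "P = 0 \<and> Q = 0"
proof -
  define k where "k = Suc (n div 2)"
  define g where "g = (m - 3) div 2"
  define R where "R = [:1, 1:] ^ g * Q"
  define v where "v = vec n (\<lambda>j. if j < k then coeff P j else coeff R (j - k))"
  have v: "v \<in> carrier_vec n" by (simp add: v_def)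
  have k: "k \<le> n" using n by (auto simp: k_def)
  have "(\<Sum>j<k. monom (v $ j) j) = (\<Sum>j<k. monom (coeff P j) j)"
    using k by (intro sum.cong) (auto simp: v_def)
  also have "\<dots> = P"
  proof (rule poly_eqI)
    fix i
    have "coeff P i = 0" if "\<not> i < k"
      by (rule coeff_eq_0) (use P that in \<open>unfold k_def, linarith\<close>)
    then show "coeff (\<Sum>j<k. monom (coeff P j) j) i = coeff P i"
      unfolding coeff_sum_monom by simp
  qed
  finally have P_eq: "(\<Sum>j<k. monom (v $ j) j) = P" .
  have "(\<Sum>j<n - k. monom (v $ (j + k)) j) = (\<Sum>j<n - k. monom (coeff R j) j)"
    by (intro sum.cong) (auto simp: v_def)
  also have "\<dots> = R"
  proof (cases "Q = 0")
    case False
    have "degree R \<le> g + degree Q"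
      unfolding R_def by (rule order_trans[OF degree_mult_le]) (simp add: degree_power_eq)
    moreover have "2 * g + 3 = m" using m by (auto simp: g_def elim!: oddE)
    ultimately have "degree R < n - k" using Q False unfolding k_def by linarith
    then have "coeff R i = 0" if "\<not> i < n - k" for i
      using that by (intro coeff_eq_0) linarith
    then show ?thesis by (intro poly_eqI) (auto simp: coeff_sum_monom)
  qed (simp add: R_def)
  finally have R_eq: "(\<Sum>j<n - k. monom (v $ (j + k)) j) = R" .
  have "[:-0, 1:] ^ n dvd [:1, 1:] ^ g * (P + Q * sqrt_series \<theta> m n)"
    using dvd by (rule dvd_mult)
  also have "[:1, 1:] ^ g * (P + Q * sqrt_series \<theta> m n) = [:1, 1:] ^ g * P + R * sqrt_series \<theta> m n"
    by (simp only: R_def distrib_left mult.assoc)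
  finally have "\<forall>i<n. coeff ([:1, 1:] ^ g * P + R * sqrt_series \<theta> m n) i = 0"
    unfolding X_power_dvd_iff .
  then have "(sqrt_matrix \<theta> m n *\<^sub>v v) $ i = 0" if "i < n" for i
    using sqrt_matrix_mult[OF v n that, of \<theta> m] that
    unfolding k_def[symmetric] g_def[symmetric] P_eq R_eq by simp
  then have "sqrt_matrix \<theta> m n *\<^sub>v v = 0\<^sub>v n"
    by (intro eq_vecI) (simp_all add: sqrt_matrix_def)
  moreover have "sqrt_matrix \<theta> m n \<in> carrier_mat n n" by (simp add: sqrt_matrix_def)
  ultimately have "v = 0\<^sub>v n"
    using det_sqrt_matrix[OF m n \<theta>] v det_0_iff_vec_prod_zero by blast
  then have "v $ j = 0" if "j < n" for j using that by simp
  then have "P = 0" "R = 0"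
    using k unfolding P_eq[symmetric] R_eq[symmetric] by (simp_all add: sum.neutral)
  then show ?thesis by (simp add: R_def)
qed

section \<open>Points of infinite order on \<open>y\<^sup>2 = x\<^sup>m + \<delta>\<close>\<close>

lemma galois_group_fixes: "\<sigma> \<in> galois_group \<Longrightarrow> \<sigma> (to_ac c) = to_ac c"
  by (simp add: galois_group_def)

lemma galois_group_hom:
  assumes "\<sigma> \<in> galois_group"
  shows "comm_ring_hom \<sigma>"
proof -
  have "\<sigma> 0 = 0" "\<sigma> 1 = 1"
    using galois_group_fixes[OF assms, of 0] galois_group_fixes[OF assms, of 1] by simp_all
  with assms show ?thesis by unfold_locales (auto simp: galois_group_def)
qed

lemma galois_group_inv:
  assumes "\<sigma> \<in> galois_group"
  shows "inv_into UNIV \<sigma> \<in> galois_group" "\<And>x. inv_into UNIV \<sigma> (\<sigma> x) = x" "\<And>x. \<sigma> (inv_into UNIV \<sigma> x) = x"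
proof -
  have bij: "bij \<sigma>" and add: "\<And>x y. \<sigma> (x + y) = \<sigma> x + \<sigma> y" and mult: "\<And>x y. \<sigma> (x * y) = \<sigma> x * \<sigma> y"
    and fixed: "\<And>c. \<sigma> (to_ac c) = to_ac c"
    using assms by (auto simp: galois_group_def)
  show 1: "\<And>x. inv_into UNIV \<sigma> (\<sigma> x) = x" using bij by (simp add: bij_is_inj)
  show 2: "\<And>x. \<sigma> (inv_into UNIV \<sigma> x) = x" using bij by (simp add: bij_is_surj surj_f_inv_f)
  have "inv_into UNIV \<sigma> (x + y) = inv_into UNIV \<sigma> x + inv_into UNIV \<sigma> y" for x y
    using 1[of "inv_into UNIV \<sigma> x + inv_into UNIV \<sigma> y"] by (simp only: add 2)
  moreover have "inv_into UNIV \<sigma> (x * y) = inv_into UNIV \<sigma> x * inv_into UNIV \<sigma> y" for x y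
    using 1[of "inv_into UNIV \<sigma> x * inv_into UNIV \<sigma> y"] by (simp only: mult 2)
  moreover have "inv_into UNIV \<sigma> (to_ac c) = to_ac c" for c
    using 1[of "to_ac c"] by (simp only: fixed)
  ultimately show "inv_into UNIV \<sigma> \<in> galois_group"
    using bij_imp_bij_inv[OF bij] by (simp add: galois_group_def)
qed

text \<open>\<sigma> is applied to the coefficients of numerator and denominator. It fixes
  \<open>F\<close>, whose coefficients come from the base field, so by \<open>has_ord_twist\<close>
  with \<open>s = 1\<close> the orders move along with the points.\<close>

lemma galois_principal:
  fixes d :: "'a::field_char_0"
  assumes hyp: "hyperelliptic (to_ac d) (map_poly to_ac f)" and \<sigma>: "\<sigma> \<in> galois_group"
    and D: "\<Delta> \<in> principal_divisors (to_ac d) (map_poly to_ac f)"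
  shows "map_divisor \<sigma> \<Delta> \<in> principal_divisors (to_ac d) (map_poly to_ac f)"
proof -
  interpret hyperelliptic "to_ac d" "map_poly to_ac f" by fact
  let ?C = "curve_points (to_ac d) (map_poly to_ac f)"
  note hom = galois_group_hom[OF \<sigma>] and hom' = galois_group_hom[OF galois_group_inv(1)[OF \<sigma>]]
  interpret \<sigma>: comm_ring_hom \<sigma> by (rule hom)
  interpret \<tau>: comm_ring_hom "inv_into UNIV \<sigma>" by (rule hom')
  have "\<sigma> (coeff F i) = coeff F i" for i
  proof -
    have "coeff F i = to_ac (inverse d * coeff f i)" by (simp add: F_def coeff_map_poly)
    then show ?thesis by (simp only: galois_group_fixes[OF \<sigma>])
  qed
  then have F\<sigma>: "map_poly \<sigma> F = F" by (intro poly_eqI) (simp add: coeff_map_poly)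
  have F\<tau>: "map_poly (inv_into UNIV \<sigma>) F = F"
  proof (rule poly_eqI)
    fix i
    have "coeff (map_poly (inv_into UNIV \<sigma>) F) i = inv_into UNIV \<sigma> (\<sigma> (coeff F i))"
      using \<open>\<And>i. \<sigma> (coeff F i) = coeff F i\<close> by (simp add: coeff_map_poly)
    then show "coeff (map_poly (inv_into UNIV \<sigma>) F) i = coeff F i" by (simp add: galois_group_inv(2)[OF \<sigma>])
  qed
  have tw: "P \<in> ?C \<Longrightarrow> has_ord P n (aff.ev u) \<Longrightarrow>
      has_ord (map_curve_point \<sigma> P) n (aff.ev (twist_pair \<sigma> 1 u))" for P n u
    unfolding twist_point_1[symmetric]
    by (rule has_ord_twist[OF hom F\<sigma> _ _ hom']) (simp_all add: galois_group_inv(2)[OF \<sigma>] \<tau>.hom_one)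
  have inv_in: "map_curve_point (inv_into UNIV \<sigma>) Q \<in> ?C" if "Q \<in> ?C" for Q
    using twist_point_in_curve[OF hom' F\<tau> _ that, of 1] by (simp add: twist_point_1)
  have inv_pt: "map_curve_point \<sigma> (map_curve_point (inv_into UNIV \<sigma>) Q) = Q" for Q
    by (cases Q) (simp_all add: galois_group_inv(3)[OF \<sigma>])
  from D obtain \<phi> where \<phi>: "\<phi> \<in> function_field (to_ac d) (map_poly to_ac f)" "\<phi> \<noteq> 0"
    "\<forall>P\<in>?C. Poly_Mapping.lookup \<Delta> P = order_at P \<phi>" and keys: "Poly_Mapping.keys \<Delta> \<subseteq> ?C"
    by (auto simp: principal_divisors_def)
  obtain u w where uw: "w \<noteq> 0" "\<phi> = aff.ev u / aff.ev (w, 0)" using function_field_repr[OF \<phi>(1)] .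
  have u: "u \<noteq> 0" and w: "(w, 0) \<noteq> 0" using uw \<phi>(2) by (auto simp: zero_prod_def)
  have tww: "twist_pair \<sigma> 1 (w, 0) = (map_poly \<sigma> w, 0)" by (simp add: twist_pair_def)
  define \<psi> where "\<psi> = aff.ev (twist_pair \<sigma> 1 u) / aff.ev (map_poly \<sigma> w, 0)"
  have ord: "has_ord (map_curve_point \<sigma> P) (order_at P \<phi>) \<psi>" if P: "P \<in> ?C" for P
  proof -
    have P': "map_curve_point \<sigma> P \<in> ?C"
      using twist_point_in_curve[OF hom F\<sigma> _ P, of 1] by (simp add: twist_point_1)
    have "order_at P \<phi> = order_at P (aff.ev u) - order_at P (aff.ev (w, 0))"
      unfolding uw(2) by (rule ord_divide[OF P u uw(1)])
    with has_ord_divide[OF P' tw[OF P has_ord_ord[OF P u]] tw[OF P has_ord_ord[OF P w]]]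
    show ?thesis by (simp add: \<psi>_def tww)
  qed
  have "\<psi> \<in> function_field (to_ac d) (map_poly to_ac f)"
    unfolding \<psi>_def by (rule ev_in_function_field)
  moreover have lookup: "Poly_Mapping.lookup (map_divisor \<sigma> \<Delta>) Q = order_at Q \<psi>" if Q: "Q \<in> ?C" for Q
  proof -
    let ?P = "map_curve_point (inv_into UNIV \<sigma>) Q"
    have "inj \<sigma>" using \<sigma> by (simp add: galois_group_def bij_is_inj)
    then have "Poly_Mapping.lookup (map_divisor \<sigma> \<Delta>) Q = Poly_Mapping.lookup \<Delta> ?P"
      using lookup_map_divisor_inj[of \<sigma> \<Delta> ?P] by (simp add: inv_pt)
    also have "\<dots> = order_at ?P \<phi>" using \<phi>(3) inv_in[OF Q] by blast
    also have "\<dots> = order_at Q \<psi>"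
      using vanishing_order_eqI[OF Q] ord[OF inv_in[OF Q]] by (simp add: inv_pt)
    finally show ?thesis .
  qed
  moreover have "\<psi> \<noteq> 0"
  proof -
    \<comment> \<open>A function that has an order at some point is non-zero, and the curve has a
      point over \<open>x = 0\<close>.\<close>
    obtain b where "b\<^sup>2 = poly F 0" using nth_root_exists[of 2 "poly F 0"] by auto
    then have P: "Affine 0 b \<in> ?C" by (simp add: affine_in_curve)
    have "map_curve_point \<sigma> (Affine 0 b) \<in> ?C"
      using twist_point_in_curve[OF hom F\<sigma> _ P, of 1] by (simp add: twist_point_1)
    from has_ord_nonzero[OF this ord[OF P]] show ?thesis .
  qed
  moreover have "Poly_Mapping.keys (map_divisor \<sigma> \<Delta>) \<subseteq> ?C"
  proof
    fix Q assume "Q \<in> Poly_Mapping.keys (map_divisor \<sigma> \<Delta>)"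
    then have "(\<Sum>P\<in>Poly_Mapping.keys \<Delta>. if map_curve_point \<sigma> P = Q then Poly_Mapping.lookup \<Delta> P else 0) \<noteq> 0"
      by (simp add: in_keys_iff lookup_map_divisor)
    then obtain P where P: "P \<in> Poly_Mapping.keys \<Delta>"
      "(if map_curve_point \<sigma> P = Q then Poly_Mapping.lookup \<Delta> P else 0) \<noteq> 0"
      by (rule sum.not_neutral_contains_not_neutral)
    then have "map_curve_point \<sigma> P = Q" by (simp split: if_splits)
    moreover have "P \<in> ?C" using P(1) keys by blast
    ultimately show "Q \<in> ?C"
      using twist_point_in_curve[OF hom F\<sigma>, of 1 P] by (simp add: twist_point_1)
  qed
  ultimately show ?thesis
    unfolding principal_divisors_def carrier_free_Abelian_group_iff by blast
qed

lemma map_divisor_inverse: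
  assumes "\<And>x. \<sigma> (\<tau> x) = x"
  shows "map_divisor \<sigma> (map_divisor \<tau> \<Delta>) = \<Delta>"
proof -
  have "map_curve_point \<sigma> (map_curve_point \<tau> P) = P" for P
    by (cases P) (simp_all add: assms)
  then have "(\<lambda>P. frag_of (map_curve_point \<sigma> P)) \<circ> map_curve_point \<tau> = frag_of" by auto
  then show ?thesis
    using frag_extend_compose[of "\<lambda>P. frag_of (map_curve_point \<sigma> P)" "map_curve_point \<tau>" \<Delta>]
      frag_expansion[of \<Delta>]
    by (simp add: map_divisor_def comp_def)
qed

lemma galois_invariant_class:
  fixes d :: "'a::field_char_0"
  assumes hyp: "hyperelliptic (to_ac d) (map_poly to_ac f)" and \<sigma>: "\<sigma> \<in> galois_group"
    and D: "\<And>\<sigma>. \<sigma> \<in> galois_group \<Longrightarrow> map_divisor \<sigma> \<Delta> = \<Delta>"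
  shows "map_divisor \<sigma> ` divisor_class (to_ac d) (map_poly to_ac f) \<Delta>
    = divisor_class (to_ac d) (map_poly to_ac f) \<Delta>"
proof -
  let ?H = "principal_divisors (to_ac d) (map_poly to_ac f)"
  have cl: "divisor_class (to_ac d) (map_poly to_ac f) \<Delta> = (\<lambda>h. h + \<Delta>) ` ?H"
    by (auto simp: divisor_class_def r_coset_def)
  have "map_divisor \<sigma> ` ?H = ?H"
  proof
    show "map_divisor \<sigma> ` ?H \<subseteq> ?H" using galois_principal[OF hyp \<sigma>] by blast
    show "?H \<subseteq> map_divisor \<sigma> ` ?H"
    proof
      fix h assume "h \<in> ?H"
      then have "map_divisor (inv_into UNIV \<sigma>) h \<in> ?H" by (rule galois_principal[OF hyp galois_group_inv(1)[OF \<sigma>]])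
      moreover have "h = map_divisor \<sigma> (map_divisor (inv_into UNIV \<sigma>) h)"
        by (rule map_divisor_inverse[symmetric]) (rule galois_group_inv(3)[OF \<sigma>])
      ultimately show "h \<in> map_divisor \<sigma> ` ?H" by blast
    qed
  qed
  moreover have "map_divisor \<sigma> ` (\<lambda>h. h + \<Delta>) ` ?H = (\<lambda>h. h + \<Delta>) ` map_divisor \<sigma> ` ?H"
    unfolding image_image by (simp add: map_divisor_add D[OF \<sigma>])
  ultimately show ?thesis unfolding cl by simp
qed

section \<open>Infinite order of the difference between an affine point and infinity\<close>

lemma degree_power_plus_constant: "m \<ge> 1 \<Longrightarrow> degree (monom 1 m + [:\<delta>:]) = m" for \<delta> :: "'k::field"
  by (subst degree_add_eq_left) (simp_all add: degree_monom_eq)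

lemma hyperelliptic_power_plus_constant:
  fixes \<delta> :: "'k::{alg_closed_field, field_char_0}"
  assumes "m \<ge> 3" "\<delta> \<noteq> 0"
  shows "hyperelliptic 1 (monom 1 m + [:\<delta>:])"
proof
  show "3 \<le> degree (monom 1 m + [:\<delta>:])" using assms by (simp add: degree_power_plus_constant)
  fix a
  assume a: "poly (monom 1 m + [:\<delta>:]) a = 0"
  then have "a \<noteq> 0" using assms by (auto simp: poly_monom power_0_left)
  then show "poly (pderiv (monom 1 m + [:\<delta>:])) a \<noteq> 0"
    using assms by (simp add: pderiv_add pderiv_monom poly_monom pderiv_pCons)
qed simp

lemma pcompose_power: "pcompose (r ^ k) s = (pcompose r s) ^ k" for r s :: "'a::comm_ring_1 poly"
  by (induction k) (simp_all add: pcompose_mult pcompose_1)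

lemma point_infinite_order:
  fixes x0 y0 \<delta> :: "'k::{alg_closed_field, field_char_0}"
  assumes m: "odd m" "m \<ge> 3" and \<delta>: "\<delta> \<noteq> 0" and y0: "y0\<^sup>2 = x0 ^ m + \<delta>" "x0 \<noteq> 0" "y0 \<noteq> 0"
    and \<theta>: "\<And>g :: rat poly. poly g 1 \<noteq> 0 \<Longrightarrow> poly (map_poly of_rat g) (x0 ^ m / y0\<^sup>2) \<noteq> 0"
    and n: "n \<ge> 1"
  shows "frag_cmul (int n) (frag_of (Affine x0 y0) - frag_of (Infinite 0))
    \<notin> principal_divisors 1 (monom 1 m + [:\<delta>:])"
proof
  define f where "f = monom 1 m + [:\<delta>:]"
  let ?\<Delta> = "frag_cmul (int n) (frag_of (Affine x0 y0) - frag_of (Infinite 0))"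
  assume "?\<Delta> \<in> principal_divisors 1 (monom 1 m + [:\<delta>:])"
  then have D: "?\<Delta> \<in> principal_divisors 1 f" by (simp add: f_def)
  interpret hyperelliptic 1 f unfolding f_def by (rule hyperelliptic_power_plus_constant[OF m(2) \<delta>])
  define h where "h = half_degree f"
  have F: "F = f" by (simp add: F_def)
  have deg_f: "degree f = m" using m by (simp add: f_def degree_power_plus_constant)
  have h: "2 * h = m + 1" using m by (auto simp: h_def half_degree_def deg_f elim!: oddE)
  have P: "Affine x0 y0 \<in> curve_points 1 f" unfolding affine_in_curve F using y0 by (simp add: f_def poly_monom)
  have "coeff F (2 * half_degree f) = 0" unfolding F h_def[symmetric] using h by (intro coeff_eq_0) (simp add: deg_f)
  then have I: "Infinite 0 \<in> curve_points 1 f" by (simp add: infinite_in_curve)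
  from D obtain \<phi> where \<phi>: "\<phi> \<in> function_field 1 f" "\<phi> \<noteq> 0"
    and lookup: "\<And>P. P \<in> curve_points 1 f \<Longrightarrow> Poly_Mapping.lookup ?\<Delta> P = order_at P \<phi>"
    by (auto simp: principal_divisors_def)
  \<comment> \<open>The only pole is at infinity, so \<phi> is of the form
    \<open>p + q y\<close>.\<close>
  have "order_at (Affine a b) \<phi> \<ge> 0" if "Affine a b \<in> curve_points 1 f" for a b
    using lookup[OF that] by (simp add: lookup_minus lookup_single when_def split: if_splits)
  then obtain u where u: "\<phi> = aff.ev u" using regular_imp_polynomial[OF \<phi>] by blast
  obtain p q where pq: "u = (p, q)" by fastforce
  have u0: "u \<noteq> 0" using \<phi>(2) u by auto
  have "order_at (Affine x0 y0) \<phi> = int n" "order_at (Infinite 0) \<phi> = - int n"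
    using lookup[OF P] lookup[OF I] by (simp_all add: lookup_minus lookup_single when_def)
  then have ordP: "has_ord (Affine x0 y0) (int n) (chart_ev (Affine x0 y0) u)"
    and ordI: "has_ord (Infinite 0) (- int n) (aff.ev u)"
    using has_ord_exists[OF P \<phi>] has_ord_exists[OF I \<phi>] by (simp_all add: u chart_ev_affine)
  \<comment> \<open>At infinity \<open>x\<close> has order -2 and \<open>y\<close> has order
    \<open>- m\<close>. As \<open>m\<close> is odd, \<open>p\<close> and \<open>q y\<close> cannot
    cancel there, so the pole order \<open>n\<close> bounds each of them.\<close>
  have "2 * degree p \<le> n \<and> (q = 0 \<or> 2 * degree q + m \<le> n)"
  proof -
    define N where "N = degree p + degree q + h"
    define v where "v = (rev_poly N p, rev_poly (N - h) q)"
    have ev: "aff.ev u = coord_x ^ N * inf.ev v"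
      unfolding pq v_def h_def by (rule inf_ev) (simp_all add: N_def h_def)
    have "v \<noteq> 0" using u0 ev by auto
    then obtain r where r: "has_ord (Infinite 0) (int r) (chart_ev (Infinite 0) v)"
      using has_ord_exists_chart[OF I] by blast
    have "has_ord (Infinite 0) (int N * (- 2)) (coord_x ^ N)"
      using has_ord_power[OF I has_ord_coord_x[OF I], of N] by simp
    from has_ord_mult[OF I this r] have "has_ord (Infinite 0) (int N * (- 2) + int r) (aff.ev u)"
      by (simp add: ev chart_ev_infinite)
    with ordI have "int N * (- 2) + int r = - int n" using has_ord_unique[OF I] by blast
    then have rN: "r + n = 2 * N" by linarith
    have "poly F_inf 0 = 0" using \<open>coeff F (2 * half_degree f) = 0\<close> by (simp add: poly_F_inf_0)
    moreover have "v \<in> ideal_power F_inf 0 0 r"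
      using has_ord_ideal[OF I r, of r] by (simp add: chart_poly_def)
    ultimately have "[:-0, 1:] ^ ((r + 1) div 2) dvd fst v \<and> [:-0, 1:] ^ (r div 2) dvd snd v"
      by (rule ideal_power_ramified)
    then have dvd: "[:-0, 1:] ^ ((r + 1) div 2) dvd rev_poly N p"
      "[:-0, 1:] ^ (r div 2) dvd rev_poly (N - h) q"
      by (simp_all only: v_def fst_conv snd_conv)
    have "2 * degree p \<le> n"
    proof (cases "p = 0")
      case False
      have "coeff (rev_poly N p) (N - degree p) \<noteq> 0" using False by (simp add: coeff_rev_poly N_def)
      then have "\<not> N - degree p < (r + 1) div 2" using dvd(1) unfolding X_power_dvd_iff by blast
      moreover have "N - degree p = degree q + h" by (simp add: N_def)
      ultimately have "(r + 1) div 2 \<le> degree q + h" by simp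
      then have "r \<le> 2 * (degree q + h)" by presburger
      then show ?thesis using rN N_def by presburger
    qed simp
    moreover have "2 * degree q + m \<le> n" if "q \<noteq> 0"
    proof -
      have "coeff (rev_poly (N - h) q) (N - h - degree q) \<noteq> 0" using that by (simp add: coeff_rev_poly N_def)
      then have "\<not> N - h - degree q < r div 2" using dvd(2) unfolding X_power_dvd_iff by blast
      moreover have "N - h - degree q = degree p" by (simp add: N_def)
      ultimately have "r div 2 \<le> degree p" by simp
      then have "r \<le> 2 * degree p + 1" by presburger
      then show ?thesis using rN h N_def by presburger
    qed
    ultimately show ?thesis by blast
  qed
  define \<theta>' where "\<theta>' = x0 ^ m / y0\<^sup>2"
  define S where "S = sqrt_series \<theta>' m n"
  \<comment> \<open>\<open>l\<close> expresses \<open>z = x / x0 - 1\<close>, and \<open>Y\<close>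
    is the expansion of \<open>y\<close> at the point to precision \<open>n\<close>.\<close>
  define l where "l = [:-1, 1 / x0:]"
  define Y where "Y = smult y0 (pcompose S l)"
  obtain R where R: "S\<^sup>2 - (1 + smult \<theta>' ([:1, 1:] ^ m - 1)) = monom 1 n * R"
    using sqrt_series_square[where \<theta> = \<theta>' and n = n and m = m]
    unfolding S_def monom_eq_X_power by blast
  have ll: "pcompose [:1, 1:] l = [:0, 1 / x0:]" by (simp add: l_def pcompose_pCons)
  have lm: "[:0, 1 / x0:] ^ m = smult (1 / x0 ^ m) (monom 1 m)"
  proof -
    have "[:0, 1 / x0:] = smult (1 / x0) [:0, 1:]" by simp
    then show ?thesis by (simp only: smult_power monom_altdef power_one_over smult_1_left)
  qed
  have "pcompose (1 + smult \<theta>' ([:1, 1:] ^ m - 1)) l = 1 + smult \<theta>' (smult (1 / x0 ^ m) (monom 1 m) - 1)"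
    by (simp only: pcompose_add pcompose_smult pcompose_diff pcompose_1 pcompose_power ll lm)
  moreover have "smult (y0\<^sup>2) (1 + smult \<theta>' (smult (1 / x0 ^ m) (monom 1 m) - 1)) = f"
  proof -
    have c: "y0\<^sup>2 * \<theta>' = x0 ^ m" using y0(3) by (simp add: \<theta>'_def)
    have "smult (y0\<^sup>2) (1 + smult \<theta>' Z) = smult (y0\<^sup>2) 1 + smult (x0 ^ m) Z" for Z
      by (simp only: smult_add_right smult_smult c)
    moreover have "smult (x0 ^ m) (smult (1 / x0 ^ m) (monom 1 m) - 1) = monom 1 m - smult (x0 ^ m) 1"
      using y0(2) by (simp add: smult_diff_right)
    moreover have "smult (y0\<^sup>2) 1 + (monom 1 m - smult (x0 ^ m) 1) = f"
      unfolding y0(1) by (simp add: f_def smult_add_left one_pCons)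
    ultimately show ?thesis by (simp only:)
  qed
  ultimately have comp: "smult (y0\<^sup>2) (pcompose (1 + smult \<theta>' ([:1, 1:] ^ m - 1)) l) = f" by (simp only:)
  have "Y\<^sup>2 - F = smult (y0\<^sup>2) (pcompose (S\<^sup>2) l) - smult (y0\<^sup>2) (pcompose (1 + smult \<theta>' ([:1, 1:] ^ m - 1)) l)"
    unfolding comp F by (simp add: Y_def smult_power pcompose_power)
  also have "\<dots> = smult (y0\<^sup>2) (pcompose (monom 1 n * R) l)"
    unfolding R[symmetric] by (simp only: pcompose_diff smult_diff_right)
  also have "\<dots> = smult (y0\<^sup>2) (l ^ n * pcompose R l)"
    by (simp add: pcompose_mult pcompose_monom)
  finally have YF: "Y\<^sup>2 - F = smult (y0\<^sup>2) (l ^ n * pcompose R l)" .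
  have "poly l x0 = 0" using y0 by (simp add: l_def)
  then have "[:-x0, 1:] dvd l" by (simp add: poly_eq_0_iff_dvd)
  then have dvdY: "[:-x0, 1:] ^ n dvd Y\<^sup>2 - F"
    unfolding YF by (intro dvd_smult dvd_mult2 dvd_power_same)
  have Yx0: "poly Y x0 = y0"
    using poly_sqrt_series_0[OF n, of \<theta>' m] \<open>poly l x0 = 0\<close> by (simp add: Y_def S_def poly_pcompose)
  have "u \<in> ideal_power F x0 y0 n"
    using has_ord_ideal[OF P ordP, of n] by (simp add: chart_poly_def)
  from ideal_power_eval[OF dvdY Yx0 order_refl this]
  have "[:-x0, 1:] ^ n dvd p + q * Y" by (simp only: pq fst_conv snd_conv)
  then obtain T where T: "p + q * Y = [:-x0, 1:] ^ n * T" by (rule dvdE)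
  \<comment> \<open>The inverse substitution \<open>x = x0 (1 + z)\<close> brings the divisibility
    into the form required by \<open>sqrt_series_independent\<close>.\<close>
  define l' where "l' = [:x0, x0:]"
  have ll': "pcompose l l' = [:0, 1:]" using y0 by (simp add: l_def l'_def pcompose_pCons)
  have "pcompose Y l' = smult y0 S"
    by (simp add: Y_def pcompose_smult pcompose_assoc[symmetric] ll')
  then have "pcompose p l' + smult y0 (pcompose q l') * S = pcompose ([:-x0, 1:] ^ n * T) l'"
    unfolding T[symmetric] by (simp add: pcompose_add pcompose_mult)
  also have "\<dots> = [:0, x0:] ^ n * pcompose T l'"
    by (simp add: pcompose_mult pcompose_power pcompose_pCons l'_def)
  finally have eq: "pcompose p l' + smult y0 (pcompose q l') * S = [:0, x0:] ^ n * pcompose T l'" .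
  have "[:-0, 1:] dvd [:0, x0:]" by (simp add: poly_eq_0_iff_dvd[symmetric] del: minus_zero)
  then have "[:-0, 1:] ^ n dvd pcompose p l' + smult y0 (pcompose q l') * S"
    unfolding eq by (intro dvd_mult2 dvd_power_same)
  moreover have "degree l' = 1" using y0 by (simp add: l'_def)
  then have "degree (pcompose p l') = degree p" "degree (smult y0 (pcompose q l')) = degree q"
    using y0 by (simp_all add: degree_pcompose)
  moreover have "smult y0 (pcompose q l') = 0" if "q = 0" using that by simp
  ultimately have "pcompose p l' = 0 \<and> smult y0 (pcompose q l') = 0"
    using \<open>2 * degree p \<le> n \<and> (q = 0 \<or> 2 * degree q + m \<le> n)\<close>
    unfolding S_def \<theta>'_def by (intro sqrt_series_independent[OF m n \<theta>]) metis+
  then have "p = 0" "q = 0"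
    using pcompose_eq_0[of p l'] pcompose_eq_0[of q l'] \<open>degree l' = 1\<close> y0 by simp_all
  with u0 show False by (simp add: pq zero_prod_def)
qed

lemma to_ac_of_rat: "to_ac (of_rat r :: 'a::field_char_0) = of_rat r"
  by (cases r) (simp add: of_rat_rat)

lemma jacobian_rank_pos:
  fixes x0 y0 \<delta> :: "'a::field_char_0"
  assumes m: "odd m" "m \<ge> 3" and \<delta>: "\<delta> \<noteq> 0" and y0: "y0\<^sup>2 = x0 ^ m + \<delta>" "x0 \<noteq> 0" "y0 \<noteq> 0"
    and \<theta>: "\<And>g :: rat poly. poly g 1 \<noteq> 0 \<Longrightarrow> poly (map_poly of_rat g) (x0 ^ m / y0\<^sup>2) \<noteq> 0"
  shows "jacobian_rank 1 (monom 1 m + [:\<delta>:]) > 0"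
proof -
  let ?f = "monom 1 m + [:\<delta>:]" and ?g = "monom 1 m + [:to_ac \<delta>:]"
  have g: "map_poly to_ac ?f = ?g"
    by (rule poly_eqI) (simp add: coeff_map_poly coeff_monom coeff_pCons split: nat.split)
  have hyp: "hyperelliptic 1 ?g"
    by (rule hyperelliptic_power_plus_constant) (use m(2) \<delta> in simp_all)
  then have hyp': "hyperelliptic (to_ac 1) (map_poly to_ac ?f)" by (simp add: g)
  interpret hyperelliptic 1 ?g by fact
  let ?\<Delta> = "frag_of (Affine (to_ac x0) (to_ac y0)) - frag_of (Infinite 0)"
  have "(to_ac y0)\<^sup>2 = (to_ac x0) ^ m + to_ac \<delta>"
    unfolding to_ac_power[symmetric] y0(1) by simp
  then have P: "Affine (to_ac x0) (to_ac y0) \<in> curve_points 1 ?g"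
    by (simp add: curve_points_def poly_monom)
  have "2 * half_degree ?g = m + 1"
    using m by (auto simp: half_degree_def degree_power_plus_constant elim!: oddE)
  then have I: "Infinite 0 \<in> curve_points 1 ?g"
    using m by (simp add: curve_points_def coeff_eq_0 degree_power_plus_constant)
  have D: "?\<Delta> \<in> carrier (Div0 1 ?g)"
    using P I keys_diff[of "frag_of (Affine (to_ac x0) (to_ac y0))" "frag_of (Infinite (0 :: 'a alg_closure))"]
    by (auto simp: divisor_degree_difference)
  have \<theta>': "poly (map_poly of_rat g) (to_ac x0 ^ m / (to_ac y0)\<^sup>2) \<noteq> 0" if "poly g 1 \<noteq> 0" for g :: "rat poly"
  proof -
    interpret comm_ring_hom "to_ac :: 'a \<Rightarrow> _" by unfold_locales simp_all
    have "map_poly of_rat g = map_poly to_ac (map_poly of_rat g :: 'a poly)"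
      by (rule poly_eqI) (simp add: coeff_map_poly to_ac_of_rat)
    then have "poly (map_poly of_rat g) (to_ac x0 ^ m / (to_ac y0)\<^sup>2)
        = to_ac (poly (map_poly of_rat g) (x0 ^ m / y0\<^sup>2))"
      unfolding to_ac_power[symmetric] to_ac_divide[symmetric] by (simp only: poly_map_poly)
    then show ?thesis using \<theta>[OF that] by simp
  qed
  have "frag_cmul (int n) ?\<Delta> \<notin> principal_divisors 1 ?g" if "n \<ge> 1" for n
    using point_infinite_order[OF m _ _ _ _ \<theta>' that, of "to_ac \<delta>"] \<delta> y0
      \<open>(to_ac y0)\<^sup>2 = (to_ac x0) ^ m + to_ac \<delta>\<close> by simp
  from independent_class[OF D this]
  have ind: "int_independent (Pic0 1 ?g) {divisor_class 1 ?g ?\<Delta>}" .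
  have "map_divisor \<sigma> ?\<Delta> = ?\<Delta>" if "\<sigma> \<in> galois_group" for \<sigma>
    using galois_group_fixes[OF that] galois_group_fixes[OF that, of 0]
    by (simp add: map_divisor_diff map_divisor_frag_of)
  from galois_invariant_class[OF hyp' _ this]
  have "divisor_class 1 ?g ?\<Delta> \<in> jacobian_points 1 ?f"
    unfolding jacobian_points_def using divisor_class_in_Pic0[OF D] by (simp add: g)
  with ind show ?thesis
    unfolding jacobian_rank_def by (intro subgroup_rank_pos) (simp_all add: g)
qed

section \<open>Constant twists\<close>

text \<open>Rational points of \<open>y ^ 2 = f(x)\<close> carried to the twist by
  \<open>\<epsilon> ^ 2\<close> under the isomorphism
  \<open>(x, y) \<mapsto> (x, y / \<epsilon>)\<close>.\<close>

definition scale_point :: "'l::field_char_0 \<Rightarrow> rat curve_point \<Rightarrow> 'l curve_point" where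
  "scale_point \<epsilon> R = (case R of Affine a b \<Rightarrow> Affine (of_rat a) (of_rat b / \<epsilon>)
     | Infinite w \<Rightarrow> Infinite (of_rat w / \<epsilon>))"

text \<open>\<open>lin\<close> stands for a \<rat>-linear functional on the large field followed by
  the inclusion of the rationals. Multiplicativity is not assumed, so it acts on coefficients only,
  and what it respects are ideals with rational generators.\<close>

locale constant_twist =
  fixes f :: "rat poly" and \<epsilon> :: "'l::{alg_closed_field, field_char_0}"
    and lin :: "'l \<Rightarrow> 'k::{alg_closed_field, field_char_0}"
  assumes hyp1: "hyperelliptic (1::'k) (map_poly of_rat f)"
    and hyp2: "hyperelliptic (\<epsilon>\<^sup>2) (map_poly of_rat f)"
    and \<epsilon>_nonzero: "\<epsilon> \<noteq> 0"
    and lin_add: "lin (x + y) = lin x + lin y"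
    and lin_scale: "lin (of_rat r * x) = of_rat r * lin x"
begin

sublocale C1: hyperelliptic "1::'k" "map_poly of_rat f" by (rule hyp1)
sublocale C2: hyperelliptic "\<epsilon>\<^sup>2" "map_poly of_rat f" by (rule hyp2)

lemma lin_0 [simp]: "lin 0 = 0"
  using lin_scale[of 0 0] by simp

lemma lin_sum: "lin (sum g A) = (\<Sum>i\<in>A. lin (g i))"
  by (induction A rule: infinite_finite_induct) (simp_all add: lin_add)

definition push :: "'l poly \<Rightarrow> 'k poly" where "push p = map_poly lin p"

lemma coeff_push: "coeff (push p) i = lin (coeff p i)"
  by (simp add: push_def coeff_map_poly)

lemma push_0 [simp]: "push 0 = 0"
  by (simp add: push_def)

lemma push_add: "push (p + q) = push p + push q"
  by (rule poly_eqI) (simp add: coeff_push lin_add)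

lemma push_mult: "push (map_poly of_rat g * p) = map_poly of_rat g * push p"
  by (rule poly_eqI) (simp add: coeff_push coeff_mult coeff_map_poly lin_sum lin_scale)

lemma degree_push: "degree (push p) \<le> degree p"
  unfolding push_def by (rule degree_map_poly_le)

text \<open>In terms of \<open>y\<close> on the constant curve, \<open>q\<close> times the
  coordinate of the twist is \<open>(q / \<epsilon>) y\<close>; hence \<epsilon> is divided out
  before the functional is applied.\<close>

definition push_pair :: "'l poly \<times> 'l poly \<Rightarrow> 'k poly \<times> 'k poly" where
  "push_pair u = (push (fst u), push (smult (1 / \<epsilon>) (snd u)))"

lemma push_pair_add: "push_pair (u + v) = push_pair u + push_pair v"
  by (simp add: push_pair_def push_add smult_add_right prod_eq_iff)

lemma map_poly_of_rat_linear: "map_poly of_rat [:- a, 1:] = [:- of_rat a, 1 :: 'c::field_char_0:]"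
  by (simp add: map_poly_pCons of_rat_minus)

lemma map_poly_of_rat_const: "map_poly of_rat [:a:] = [:of_rat a :: 'c::field_char_0:]"
  by (cases "a = 0") (simp_all add: map_poly_pCons)

lemma push_mult_const: "push ([:- of_rat b:] * p) = [:- of_rat b:] * push p"
  using push_mult[of "[:- b:]" p] by (simp only: map_poly_of_rat_const of_rat_minus)

text \<open>The generators of the ideal of a rational point are rational, so a \<open>\<rat>\<close>-linear map preserves its powers.\<close>

lemma ideal_power_push:
  "u \<in> ideal_power (smult (inverse (\<epsilon>\<^sup>2)) (map_poly of_rat G)) (of_rat a) (of_rat b / \<epsilon>) n \<Longrightarrow>
    push_pair u \<in> ideal_power (map_poly of_rat G) (of_rat a) (of_rat b) n"
proof (induction n arbitrary: u)
  case (Suc n)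
  let ?F2 = "smult (inverse (\<epsilon>\<^sup>2)) (map_poly of_rat G)" and ?F1 = "map_poly of_rat G"
  from Suc.prems obtain v w where u: "u = pair_mult ?F2 ([:- of_rat a, 1:], 0) v
      + pair_mult ?F2 ([:- (of_rat b / \<epsilon>):], 1) w"
    and *: "v \<in> ideal_power ?F2 (of_rat a) (of_rat b / \<epsilon>) n" "w \<in> ideal_power ?F2 (of_rat a) (of_rat b / \<epsilon>) n"
    by (rule ideal_power_SucE)
  \<comment> \<open>Writing \<open>y - b / \<epsilon>\<close> as
    \<open>(\<epsilon> y - b) / \<epsilon>\<close> and moving \<open>1 / \<epsilon>\<close> into the
    cofactor leaves the generator of a rational point on the constant curve.\<close>
  define w' where "w' = pair_mult ?F2 ([:1 / \<epsilon>:], 0) w"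
  have w'_eq: "w' = (smult (1 / \<epsilon>) (fst w), smult (1 / \<epsilon>) (snd w))"
    by (simp add: w'_def pair_mult_def)
  have "w' \<in> ideal_power ?F2 (of_rat a) (of_rat b / \<epsilon>) n"
    unfolding w'_def by (intro ideal_power_mult *)
  have "push_pair (pair_mult ?F2 ([:- of_rat a, 1:], 0) v)
      = pair_mult ?F1 ([:- of_rat a, 1:], 0) (push_pair v)"
    using push_mult[of "[:- a, 1:]"]
    by (simp add: push_pair_def pair_mult_def map_poly_of_rat_linear mult_smult_right[symmetric]
        del: mult_pCons_left mult_smult_right)
  moreover have "push_pair (pair_mult ?F2 ([:- (of_rat b / \<epsilon>):], 1) w)
      = pair_mult ?F1 ([:- of_rat b:], 1) (push_pair w')"
  proof -
    have "[:- (of_rat b / \<epsilon>):] * fst w + snd w * ?F2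
        = map_poly of_rat [:- b:] * smult (1 / \<epsilon>) (fst w)
          + map_poly of_rat G * smult (1 / \<epsilon>) (smult (1 / \<epsilon>) (snd w))"
      using \<epsilon>_nonzero by (simp add: map_poly_of_rat_const of_rat_minus power2_eq_square field_simps)
    then have 1: "push ([:- (of_rat b / \<epsilon>):] * fst w + snd w * ?F2)
        = [:- of_rat b:] * push (smult (1 / \<epsilon>) (fst w))
          + map_poly of_rat G * push (smult (1 / \<epsilon>) (smult (1 / \<epsilon>) (snd w)))"
      by (simp only: push_add push_mult push_mult_const map_poly_of_rat_const of_rat_minus)
    have "smult (1 / \<epsilon>) ([:- (of_rat b / \<epsilon>):] * snd w + fst w)
        = map_poly of_rat [:- b:] * smult (1 / \<epsilon>) (smult (1 / \<epsilon>) (snd w)) + smult (1 / \<epsilon>) (fst w)"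
      by (simp add: map_poly_of_rat_const of_rat_minus smult_add_right smult_diff_right)
    then have 2: "push (smult (1 / \<epsilon>) ([:- (of_rat b / \<epsilon>):] * snd w + fst w))
        = [:- of_rat b:] * push (smult (1 / \<epsilon>) (smult (1 / \<epsilon>) (snd w))) + push (smult (1 / \<epsilon>) (fst w))"
      by (simp only: push_add push_mult push_mult_const map_poly_of_rat_const of_rat_minus)
    have "push_pair (pair_mult ?F2 ([:- (of_rat b / \<epsilon>):], 1) w)
        = (push ([:- (of_rat b / \<epsilon>):] * fst w + snd w * ?F2),
           push (smult (1 / \<epsilon>) ([:- (of_rat b / \<epsilon>):] * snd w + fst w)))"
      by (simp only: push_pair_def pair_mult_def fst_conv snd_conv mult_1)
    also have "\<dots> = pair_mult ?F1 ([:- of_rat b:], 1) (push_pair w')"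
      unfolding 1 2 by (simp only: push_pair_def pair_mult_def fst_conv snd_conv w'_eq mult_1 mult_ac)
    finally show ?thesis .
  qed
  ultimately have eq: "push_pair u = pair_mult ?F1 ([:- of_rat a, 1:], 0) (push_pair v)
      + pair_mult ?F1 ([:- of_rat b:], 1) (push_pair w')"
    by (simp only: u push_pair_add)
  show ?case unfolding eq
    by (intro ideal_power_SucI Suc.IH * \<open>w' \<in> _\<close>)
qed simp

lemma F1_eq: "C1.F = map_poly of_rat f"
  by (simp add: C1.F_def)

lemma half_degree_eq: "half_degree (map_poly of_rat f :: 'c::field_char_0 poly) = half_degree f"
  by (simp add: half_degree_def)

lemma rev_poly_push: "rev_poly N (push p) = push (rev_poly N p)"
  by (rule poly_eqI) (simp add: coeff_rev_poly coeff_push)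

lemma F_inf1_eq: "C1.F_inf = map_poly of_rat (rev_poly (2 * half_degree f) f)"
  by (rule poly_eqI) (simp add: C1.F_inf_def C1.F_def coeff_rev_poly coeff_map_poly half_degree_eq)

lemma F_inf2_eq: "C2.F_inf = smult (inverse (\<epsilon>\<^sup>2)) (map_poly of_rat (rev_poly (2 * half_degree f) f))"
  by (rule poly_eqI) (simp add: C2.F_inf_def C2.F_def coeff_rev_poly coeff_map_poly half_degree_eq)

definition up :: "rat curve_point \<Rightarrow> 'k curve_point" where
  "up R = map_curve_point of_rat R"

abbreviation upt :: "rat curve_point \<Rightarrow> 'l curve_point" where
  "upt \<equiv> scale_point \<epsilon>"

abbreviation "curve1 \<equiv> curve_points (1::'k) (map_poly of_rat f)"
abbreviation "curve2 \<equiv> curve_points (\<epsilon>\<^sup>2) (map_poly of_rat f)"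

lemma up_in_curve: "R \<in> curve_points 1 f \<Longrightarrow> up R \<in> curve1"
  by (cases R)
     (auto simp: up_def curve_points_def of_rat_hom.poly_map_poly half_degree_eq coeff_map_poly of_rat_power[symmetric])

lemma upt_in_curve: "R \<in> curve_points 1 f \<Longrightarrow> upt R \<in> curve2"
  using \<epsilon>_nonzero
  by (cases R)
     (auto simp: scale_point_def curve_points_def of_rat_hom.poly_map_poly half_degree_eq coeff_map_poly
       of_rat_power[symmetric] power_divide)

lemma up_eq_iff: "up R = up R' \<longleftrightarrow> R = R'"
  by (cases R; cases R') (simp_all add: up_def)

lemma upt_eq_iff: "upt R = upt R' \<longleftrightarrow> R = R'"
  using \<epsilon>_nonzero by (cases R; cases R') (simp_all add: scale_point_def)

lemma chart_le:
  assumes R: "R \<in> curve_points 1 f"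
    and m: "C2.has_ord (upt R) (int m) (C2.chart_ev (upt R) u)"
    and m': "C1.has_ord (up R) m' (C1.chart_ev (up R) (push_pair u))"
  shows "int m \<le> m'"
proof -
  have "u \<in> ideal_power (C2.chart_poly (upt R)) (fst (chart_values (upt R))) (snd (chart_values (upt R))) m"
    using C2.has_ord_ideal[OF upt_in_curve[OF R] m, of m] by simp
  then have "push_pair u \<in> ideal_power (C1.chart_poly (up R)) (fst (chart_values (up R))) (snd (chart_values (up R))) m"
  proof (cases R)
    case (Affine a b)
    then show ?thesis
      using ideal_power_push[of u f a b m] \<open>u \<in> _\<close>
      by (simp add: up_def scale_point_def C1.chart_poly_def C2.chart_poly_def F1_eq C2.F_def)
  next
    case (Infinite w)
    then show ?thesis
      using ideal_power_push[of u "rev_poly (2 * half_degree f) f" 0 w m] \<open>u \<in> _\<close>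
      by (simp add: up_def scale_point_def C1.chart_poly_def C2.chart_poly_def F_inf1_eq F_inf2_eq)
  qed
  then show ?thesis using C1.has_ord_ideal[OF up_in_curve[OF R] m', of m] by simp
qed

lemma order_le:
  assumes R: "R \<in> curve_points 1 f" and u: "u \<noteq> 0" "push_pair u \<noteq> 0"
  shows "C2.order_at (upt R) (C2.aff.ev u) \<le> C1.order_at (up R) (C1.aff.ev (push_pair u))"
proof (cases R)
  case (Affine a b)
  obtain m where m: "C2.has_ord (upt R) (int m) (C2.chart_ev (upt R) u)"
    using C2.has_ord_exists_chart[OF upt_in_curve[OF R] u(1)] by blast
  obtain m' where m': "C1.has_ord (up R) (int m') (C1.chart_ev (up R) (push_pair u))"
    using C1.has_ord_exists_chart[OF up_in_curve[OF R] u(2)] by blast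
  have "C2.order_at (upt R) (C2.aff.ev u) = int m"
    using C2.vanishing_order_eqI[OF upt_in_curve[OF R] m] by (simp add: Affine scale_point_def C2.chart_ev_affine)
  moreover have "C1.order_at (up R) (C1.aff.ev (push_pair u)) = int m'"
    using C1.vanishing_order_eqI[OF up_in_curve[OF R] m'] by (simp add: Affine up_def C1.chart_ev_affine)
  ultimately show ?thesis using chart_le[OF R m m'] by simp
next
  case (Infinite w)
  obtain p q where pq: "u = (p, q)" by fastforce
  define h where "h = half_degree f"
  \<comment> \<open>One \<open>N\<close> serves both curves, since pushing does not raise degrees;
    the factor \<open>coord_x ^ N\<close> then has the same order on both sides.\<close>
  define N where "N = degree p + degree q + h"
  define v where "v = (rev_poly N p, rev_poly (N - h) q)"
  have ev2: "C2.aff.ev u = coord_x ^ N * C2.inf.ev v"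
    unfolding pq v_def h_def half_degree_eq[symmetric, where 'c = 'l]
    by (rule C2.inf_ev) (simp_all add: N_def h_def half_degree_eq)
  have pv: "push_pair v = (rev_poly N (push p), rev_poly (N - h) (push (smult (1 / \<epsilon>) q)))"
    by (simp add: push_pair_def v_def rev_poly_push rev_poly_smult)
  have deg: "degree (push p) \<le> N" "degree (push (smult (1 / \<epsilon>) q)) + half_degree (map_poly of_rat f :: 'k poly) \<le> N"
    using degree_push[of p] degree_push[of "smult (1 / \<epsilon>) q"] degree_smult_le[of "1 / \<epsilon>" q]
    by (simp_all add: N_def h_def half_degree_eq)
  have ev1: "C1.aff.ev (push_pair u) = coord_x ^ N * C1.inf.ev (push_pair v)"
  proof -
    have "push_pair u = (push p, push (smult (1 / \<epsilon>) q))" by (simp add: push_pair_def pq)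
    with C1.inf_ev[OF deg] show ?thesis by (simp only: pv h_def half_degree_eq)
  qed
  have "v \<noteq> 0" using u(1) ev2 by auto
  have "push_pair v \<noteq> 0" using u(2) ev1 by auto
  have R2: "Infinite (of_rat w / \<epsilon>) \<in> curve2" using upt_in_curve[OF R] by (simp add: Infinite scale_point_def)
  have R1: "Infinite (of_rat w) \<in> curve1" using up_in_curve[OF R] by (simp add: Infinite up_def)
  obtain m where m: "C2.has_ord (upt R) (int m) (C2.chart_ev (upt R) v)"
    using C2.has_ord_exists_chart[OF upt_in_curve[OF R] \<open>v \<noteq> 0\<close>] by blast
  obtain m' where m': "C1.has_ord (up R) (int m') (C1.chart_ev (up R) (push_pair v))"
    using C1.has_ord_exists_chart[OF up_in_curve[OF R] \<open>push_pair v \<noteq> 0\<close>] by blast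
  have x2: "C2.has_ord (upt R) (if w = 0 then -2 else -1) coord_x"
    using C2.has_ord_coord_x[OF R2] \<epsilon>_nonzero by (simp add: Infinite scale_point_def)
  have x1: "C1.has_ord (up R) (if w = 0 then -2 else -1) coord_x"
    using C1.has_ord_coord_x[OF R1] by (simp add: Infinite up_def)
  have "C2.order_at (upt R) (C2.aff.ev u) = int N * (if w = 0 then -2 else -1) + int m"
    using C2.vanishing_order_eqI[OF upt_in_curve[OF R]
        C2.has_ord_mult[OF upt_in_curve[OF R] C2.has_ord_power[OF upt_in_curve[OF R] x2, of N] m]]
    by (simp add: ev2 Infinite scale_point_def C2.chart_ev_infinite)
  moreover have "C1.order_at (up R) (C1.aff.ev (push_pair u)) = int N * (if w = 0 then -2 else -1) + int m'"
    using C1.vanishing_order_eqI[OF up_in_curve[OF R]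
        C1.has_ord_mult[OF up_in_curve[OF R] C1.has_ord_power[OF up_in_curve[OF R] x1, of N] m']]
    by (simp add: ev1 Infinite up_def C1.chart_ev_infinite)
  ultimately show ?thesis using chart_le[OF R m m'] by simp
qed

end

section \<open>Poles at infinity, and descent of principal divisors to the rationals\<close>

context hyperelliptic
begin

text \<open>With two distinct points at infinity, the leading terms of \<open>p\<close> and
  \<open>q y\<close> may cancel at one of them but not at both, so the two pole orders bound the
  degrees.\<close>

lemma degree_bound_infinite:
  assumes w: "Infinite w \<in> curve_points d f" "w \<noteq> 0" and u: "(p, q) \<noteq> 0"
    and ge: "order_at (Infinite w) (aff.ev (p, q)) \<ge> - int n" "order_at (Infinite (- w)) (aff.ev (p, q)) \<ge> - int n"
  shows "degree p \<le> n \<and> (q = 0 \<or> degree q + half_degree f \<le> n)"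
proof -
  have w': "Infinite (- w) \<in> curve_points d f" using w by (simp add: infinite_in_curve)
  show ?thesis
  proof (cases "q = 0")
    case True
    then have "p \<noteq> 0" using u by (auto simp: zero_prod_def)
    from has_ord_poly_infinite[OF w(1) this] have "order_at (Infinite w) (aff.ev (p, q)) = - int (degree p)"
      using vanishing_order_eqI[OF w(1)] w(2) True by simp
    with ge True show ?thesis by simp
  next
    case False
    define N where "N = max (degree p) (degree q + half_degree f)"
    define v where "v = (rev_poly N p, rev_poly (N - half_degree f) q)"
    have ev: "aff.ev (p, q) = coord_x ^ N * inf.ev v"
      unfolding v_def by (rule inf_ev) (simp_all add: N_def)
    have val: "chart_val (Infinite s) v = coeff p N + s * coeff q (N - half_degree f)" for s
      by (simp add: chart_val_def pair_val_def v_def poly_0_coeff_0 coeff_rev_poly)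
    have "coeff p N \<noteq> 0 \<or> coeff q (N - half_degree f) \<noteq> 0"
    proof (cases "degree p \<le> degree q + half_degree f")
      case True
      then have "coeff q (N - half_degree f) = lead_coeff q" by (simp add: N_def)
      then show ?thesis using False by simp
    next
      case False
      then have "coeff p N = lead_coeff p" "p \<noteq> 0" by (auto simp: N_def)
      then show ?thesis by simp
    qed
    have "chart_val (Infinite w) v \<noteq> 0 \<or> chart_val (Infinite (- w)) v \<noteq> 0"
    proof (rule ccontr)
      assume "\<not> ?thesis"
      then have "chart_val (Infinite w) v = 0" "chart_val (Infinite (- w)) v = 0" by blast+
      then have 1: "coeff p N + w * coeff q (N - half_degree f) = 0"
        and 2: "coeff p N = w * coeff q (N - half_degree f)" using val[of w] val[of "- w"] by simp_all
      have "2 * (w * coeff q (N - half_degree f)) = coeff p N + w * coeff q (N - half_degree f)"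
        unfolding 2 by simp
      then have "2 * (w * coeff q (N - half_degree f)) = 0" by (simp only: 1)
      with w(2) have "coeff q (N - half_degree f) = 0" by simp
      with 1 \<open>coeff p N \<noteq> 0 \<or> _\<close> show False by simp
    qed
    then obtain s where s: "s = w \<or> s = - w" "chart_val (Infinite s) v \<noteq> 0" by blast
    have S: "Infinite s \<in> curve_points d f" and s0: "s \<noteq> 0" using s w w' by auto
    have x: "has_ord (Infinite s) (- 1) coord_x" using has_ord_coord_x[OF S] s0 by simp
    have "has_ord (Infinite s) 0 (inf.ev v)"
      using has_ord_chart_unit[OF S s(2)] by (simp add: chart_ev_infinite)
    from has_ord_mult[OF S has_ord_power[OF S x, of N] this]
    have "order_at (Infinite s) (aff.ev (p, q)) = - int N"
      using vanishing_order_eqI[OF S] by (simp add: ev)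
    then have "N \<le> n" using ge s(1) by auto
    then show ?thesis by (simp add: N_def)
  qed
qed

text \<open>The divisor of \<phi> minus \<Delta> is effective of degree 0, hence 0. Lower bounds for
  orders thus suffice to show that a divisor is principal.\<close>

lemma effective_principal:
  assumes \<phi>: "\<phi> \<in> function_field d f" "\<phi> \<noteq> 0"
    and D: "\<Delta> \<in> carrier (Div0 d f)"
    and ge: "\<And>P. P \<in> curve_points d f \<Longrightarrow> Poly_Mapping.lookup \<Delta> P \<le> order_at P \<phi>"
  shows "\<Delta> \<in> principal_divisors d f"
proof -
  obtain S where S: "finite S" "S \<subseteq> curve_points d f" "\<forall>P\<in>curve_points d f - S. order_at P \<phi> = 0"
    "(\<Sum>P\<in>S. order_at P \<phi>) = 0"
    using divisor_exists[OF \<phi>] by blast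
  have keys: "Poly_Mapping.keys \<Delta> \<subseteq> curve_points d f" and deg: "divisor_degree \<Delta> = 0" using D by simp_all
  define T where "T = S \<union> Poly_Mapping.keys \<Delta>"
  have T: "finite T" "T \<subseteq> curve_points d f" using S keys by (auto simp: T_def)
  have "(\<Sum>P\<in>T. order_at P \<phi>) = (\<Sum>P\<in>S. order_at P \<phi>)"
    by (rule sum.mono_neutral_right) (use T S keys in \<open>auto simp: T_def\<close>)
  moreover have "(\<Sum>P\<in>T. Poly_Mapping.lookup \<Delta> P) = 0"
    using divisor_degree_eq[OF T(1), of \<Delta>] deg by (simp add: T_def)
  ultimately have "(\<Sum>P\<in>T. order_at P \<phi> - Poly_Mapping.lookup \<Delta> P) = 0"
    using S(4) by (simp add: sum_subtractf)
  then have eqT: "order_at P \<phi> = Poly_Mapping.lookup \<Delta> P" if "P \<in> T" for P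
    using sum_nonneg_eq_0_iff[OF T(1), of "\<lambda>P. order_at P \<phi> - Poly_Mapping.lookup \<Delta> P"] ge T(2) that by auto
  have "Poly_Mapping.lookup \<Delta> P = order_at P \<phi>" if "P \<in> curve_points d f" for P
  proof (cases "P \<in> T")
    case False
    then have "order_at P \<phi> = 0" "Poly_Mapping.lookup \<Delta> P = 0"
      using S(3) that by (auto simp: T_def in_keys_iff)
    then show ?thesis by simp
  qed (simp add: eqT)
  then show ?thesis unfolding principal_divisors_def using \<phi> keys by auto
qed

end

context constant_twist
begin

lemma order_linear_power_affine1:
  assumes "Affine x y \<in> curve1"
  shows "C1.order_at (Affine x y) (C1.aff.ev (map_poly of_rat ([:- a, 1:] ^ n), 0))
    = (if x = of_rat a then int n * (if y = 0 then 2 else 1) else 0)"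
proof -
  have eq: "map_poly of_rat ([:- a, 1:] ^ n) = [:- of_rat a, 1 :: 'k:] ^ n"
    by (simp add: of_rat_poly_hom.hom_power map_poly_of_rat_linear)
  have "order x ([:- of_rat a, 1:] ^ n) = (if x = of_rat a then n else 0)"
    by (auto simp: order_linear_power)
  then show ?thesis
    unfolding eq using C1.vanishing_order_eqI[OF assms C1.has_ord_poly_affine[OF assms, of "[:- of_rat a, 1:] ^ n"]]
    by auto
qed

lemma order_linear_power_affine2:
  assumes "Affine x y \<in> curve2"
  shows "C2.order_at (Affine x y) (C2.aff.ev (map_poly of_rat ([:- a, 1:] ^ n), 0))
    = (if x = of_rat a then int n * (if y = 0 then 2 else 1) else 0)"
proof -
  have eq: "map_poly of_rat ([:- a, 1:] ^ n) = [:- of_rat a, 1 :: 'l:] ^ n"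
    by (simp add: of_rat_poly_hom.hom_power map_poly_of_rat_linear)
  have "order x ([:- of_rat a, 1:] ^ n) = (if x = of_rat a then n else 0)"
    by (auto simp: order_linear_power)
  then show ?thesis
    unfolding eq using C2.vanishing_order_eqI[OF assms C2.has_ord_poly_affine[OF assms, of "[:- of_rat a, 1:] ^ n"]]
    by auto
qed

lemma degree_linear_power: "degree (map_poly of_rat ([:- a, 1:] ^ n) :: 'c::field_char_0 poly) = n"
  by (simp add: degree_power_eq)

lemma order_linear_power_infinite1:
  assumes "Infinite w \<in> curve1"
  shows "C1.order_at (Infinite w) (C1.aff.ev (map_poly of_rat ([:- a, 1:] ^ n), 0))
    = int n * (if w = 0 then -2 else -1)"
proof -
  have "map_poly of_rat ([:- a, 1:] ^ n) \<noteq> (0 :: 'k poly)" by simp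
  from C1.vanishing_order_eqI[OF assms C1.has_ord_poly_infinite[OF assms this]] show ?thesis
    unfolding degree_linear_power .
qed

lemma order_linear_power_infinite2:
  assumes "Infinite w \<in> curve2"
  shows "C2.order_at (Infinite w) (C2.aff.ev (map_poly of_rat ([:- a, 1:] ^ n), 0))
    = int n * (if w = 0 then -2 else -1)"
proof -
  have "map_poly of_rat ([:- a, 1:] ^ n) \<noteq> (0 :: 'l poly)" by simp
  from C2.vanishing_order_eqI[OF assms C2.has_ord_poly_infinite[OF assms this]] show ?thesis
    unfolding degree_linear_power .
qed

lemma order_linear_power_rational:
  assumes "R \<in> curve_points 1 f"
  shows "C1.order_at (up R) (C1.aff.ev (map_poly of_rat ([:- a, 1:] ^ n), 0))
    = C2.order_at (upt R) (C2.aff.ev (map_poly of_rat ([:- a, 1:] ^ n), 0))"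
proof (cases R)
  case (Affine x y)
  then have R1: "Affine (of_rat x) (of_rat y) \<in> curve1" and R2: "Affine (of_rat x) (of_rat y / \<epsilon>) \<in> curve2"
    using up_in_curve[OF assms] upt_in_curve[OF assms] by (simp_all add: up_def scale_point_def)
  show ?thesis
    using order_linear_power_affine1[OF R1] order_linear_power_affine2[OF R2] \<epsilon>_nonzero
    by (simp add: Affine up_def scale_point_def)
next
  case (Infinite w)
  then have R1: "Infinite (of_rat w) \<in> curve1" and R2: "Infinite (of_rat w / \<epsilon>) \<in> curve2"
    using up_in_curve[OF assms] upt_in_curve[OF assms] by (simp_all add: up_def scale_point_def)
  show ?thesis
    using order_linear_power_infinite1[OF R1] order_linear_power_infinite2[OF R2] \<epsilon>_nonzero
    by (simp add: Infinite up_def scale_point_def)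
qed

lemma difference_in_Div0:
  assumes "P \<in> curve_points d g" "Q \<in> curve_points d g"
  shows "frag_cmul n (frag_of P - frag_of Q) \<in> carrier (Div0 d g)"
proof -
  interpret comm_group "Div0 d g" by (rule comm_group_Div0)
  have D: "frag_of P - frag_of Q \<in> carrier (Div0 d g)"
    using assms keys_diff[of "frag_of P" "frag_of Q"] by (auto simp: divisor_degree_difference)
  from int_pow_closed[OF this, of n] show ?thesis unfolding int_pow_Div0[OF D] .
qed

text \<open>The numerator is pushed down, while the rational denominator \<open>w0\<close>, which
  accounts for an affine pole at \<open>P0\<close>, is kept. At points that come from rational ones
  the orders do not drop. At all other points the divisor is 0 and the new function has to be shown
  regular; then \<open>effective_principal\<close> applies.\<close>

lemma principal_descends_aux:
  assumes P: "P \<in> curve_points 1 f" and P0: "P0 \<in> curve_points 1 f"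
    and \<psi>: "\<psi> = C2.aff.ev u" "u \<noteq> 0" "push_pair u \<noteq> 0"
    and w0: "w0 = [:- a, 1:] ^ k" "k = (case P0 of Affine _ _ \<Rightarrow> n | Infinite _ \<Rightarrow> 0)"
      "a = (case P0 of Affine x _ \<Rightarrow> x | Infinite _ \<Rightarrow> 0)"
    and ord: "\<And>Q. Q \<in> curve2 \<Longrightarrow> C2.order_at Q \<psi> - C2.order_at Q (C2.aff.ev (map_poly of_rat w0, 0))
      = Poly_Mapping.lookup (frag_cmul (int n) (frag_of (upt P) - frag_of (upt P0))) Q"
  shows "frag_cmul (int n) (frag_of (up P) - frag_of (up P0)) \<in> principal_divisors 1 (map_poly of_rat f)"
proof -
  let ?\<Delta>1 = "frag_cmul (int n) (frag_of (up P) - frag_of (up P0))"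
  let ?\<Delta>2 = "frag_cmul (int n) (frag_of (upt P) - frag_of (upt P0))"
  define W1 where "W1 = (map_poly of_rat w0 :: 'k poly)"
  have W1: "W1 \<noteq> 0" by (simp add: W1_def w0)
  define \<phi> where "\<phi> = C1.aff.ev (push_pair u) / C1.aff.ev (W1, 0)"
  have \<phi>0: "\<phi> \<noteq> 0" using \<psi>(3) W1 by (auto simp: \<phi>_def zero_prod_def)
  have ord\<phi>: "C1.order_at Q \<phi> = C1.order_at Q (C1.aff.ev (push_pair u)) - C1.order_at Q (C1.aff.ev (W1, 0))"
    if "Q \<in> curve1" for Q
    unfolding \<phi>_def by (rule C1.ord_divide[OF that \<psi>(3) W1])
  have rational: "Poly_Mapping.lookup ?\<Delta>1 (up R) \<le> C1.order_at (up R) \<phi>" if R: "R \<in> curve_points 1 f" for R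
  proof -
    have "Poly_Mapping.lookup ?\<Delta>1 (up R) = Poly_Mapping.lookup ?\<Delta>2 (upt R)"
      by (simp add: lookup_minus lookup_single when_def up_eq_iff upt_eq_iff)
    also have "\<dots> = C2.order_at (upt R) (C2.aff.ev u) - C2.order_at (upt R) (C2.aff.ev (map_poly of_rat w0, 0))"
      using ord[OF upt_in_curve[OF R]] \<psi>(1) by simp
    also have "\<dots> \<le> C1.order_at (up R) (C1.aff.ev (push_pair u)) - C1.order_at (up R) (C1.aff.ev (W1, 0))"
      using order_le[OF R \<psi>(2,3)] order_linear_power_rational[OF R, of a k] by (simp add: W1_def w0(1))
    finally show ?thesis by (simp add: ord\<phi>[OF up_in_curve[OF R]])
  qed
  have irrational: "Poly_Mapping.lookup ?\<Delta>1 Q \<le> C1.order_at Q \<phi>"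
    if Q: "Q \<in> curve1" and irr: "\<And>R. R \<in> curve_points 1 f \<Longrightarrow> Q \<noteq> up R" for Q
  proof -
    have lookup: "Poly_Mapping.lookup ?\<Delta>1 Q = 0"
      using irr[OF P] irr[OF P0] by (simp add: lookup_minus lookup_single when_def)
    show ?thesis
    proof (cases Q)
      case (Affine x y)
      have Q': "Affine x y \<in> curve1" using Q Affine by simp
      obtain m where "C1.has_ord Q (int m) (C1.chart_ev Q (push_pair u))"
        using C1.has_ord_exists_chart[OF Q \<psi>(3)] by blast
      then have "C1.order_at Q (C1.aff.ev (push_pair u)) = int m"
        using C1.vanishing_order_eqI[OF Q] by (simp add: Affine C1.chart_ev_affine)
      moreover have "C1.order_at Q (C1.aff.ev (W1, 0)) = 0"
      proof (cases P0)
        case (Affine a' b')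
        \<comment> \<open>Both points over the abscissa of \<open>P0\<close> are rational, so an
          irrational point avoids the zeros of the denominator.\<close>
        have "x \<noteq> of_rat a"
        proof
          assume x: "x = of_rat a"
          have "b'\<^sup>2 = poly f a'" using P0 Affine by (simp add: curve_points_def)
          have "y\<^sup>2 = poly (map_poly of_rat f) x" using Q' by (simp add: curve_points_def)
          also have "\<dots> = (of_rat b')\<^sup>2"
            unfolding x using \<open>b'\<^sup>2 = poly f a'\<close> w0(3) Affine
            by (simp add: of_rat_hom.poly_map_poly of_rat_power[symmetric])
          finally have "y = of_rat b' \<or> y = - of_rat b'" by (simp add: power2_eq_iff)
          then have "Q = up (Affine a' b') \<or> Q = up (Affine a' (- b'))"
            using x w0(3) \<open>P0 = _\<close> \<open>Q = _\<close> by (auto simp: up_def of_rat_minus)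
          moreover have "Affine a' b' \<in> curve_points 1 f" "Affine a' (- b') \<in> curve_points 1 f"
            using \<open>b'\<^sup>2 = poly f a'\<close> by (simp_all add: curve_points_def)
          ultimately show False using irr by blast
        qed
        then show ?thesis using order_linear_power_affine1[OF Q', of a k] by (simp add: W1_def w0(1) \<open>Q = _\<close>)
      next
        case (Infinite w)
        then have "k = 0" by (simp add: w0(2))
        then show ?thesis using order_linear_power_affine1[OF Q', of a k] by (simp add: W1_def w0(1) \<open>Q = _\<close>)
      qed
      ultimately show ?thesis unfolding lookup ord\<phi>[OF Q] by simp
    next
      case (Infinite w)
      define h where "h = half_degree f"
      have w2: "w\<^sup>2 = of_rat (coeff f (2 * h))"
        using Q Infinite by (simp add: curve_points_def half_degree_eq coeff_map_poly h_def)
      have irrw: "w \<noteq> of_rat s" if "s\<^sup>2 = coeff f (2 * h)" for s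
        using irr[of "Infinite s"] that Infinite by (simp add: up_def curve_points_def h_def)
      \<comment> \<open>A rational point at infinity would have the same square as \<open>w\<close>
        and make \<open>w\<close> rational. So \<open>P\<close> and \<open>P0\<close> are affine
        here; for the same reason \<open>w\<close> is not 0, and there are two points at
        infinity.\<close>
      have noinf: "R \<noteq> Infinite s" if "R \<in> curve_points 1 f" for R s
      proof
        assume R: "R = Infinite s"
        then have s2: "s\<^sup>2 = coeff f (2 * h)" using that by (simp add: curve_points_def h_def)
        then have "w\<^sup>2 = (of_rat s)\<^sup>2" using w2 by (simp add: of_rat_power[symmetric])
        then have "w = of_rat s \<or> w = of_rat (- s)" by (simp add: power2_eq_iff of_rat_minus)
        then show False using irrw[of s] irrw[of "- s"] s2 by auto
      qed
      have w0': "w \<noteq> 0"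
      proof
        assume "w = 0"
        then have "coeff f (2 * h) = 0" using w2 by simp
        with irrw[of 0] \<open>w = 0\<close> show False by simp
      qed
      obtain a' b' where P0': "P0 = Affine a' b'" using noinf[OF P0] by (cases P0) auto
      then have k: "k = n" by (simp add: w0(2))
      obtain a2 b2 where P': "P = Affine a2 b2" using noinf[OF P] by (cases P) auto
      obtain s :: 'l where s: "s ^ 2 = of_rat (coeff f (2 * h)) / \<epsilon>\<^sup>2" using nth_root_exists[of 2] by auto
      have "s \<noteq> 0" using s w2 w0' \<epsilon>_nonzero by auto
      have inf2: "Infinite r \<in> curve2" if "r\<^sup>2 = of_rat (coeff f (2 * h)) / \<epsilon>\<^sup>2" for r
        using that \<epsilon>_nonzero by (simp add: curve_points_def half_degree_eq coeff_map_poly h_def)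
      have ge: "C2.order_at (Infinite r) (C2.aff.ev u) \<ge> - int n"
        if r: "r\<^sup>2 = of_rat (coeff f (2 * h)) / \<epsilon>\<^sup>2" "r \<noteq> 0" for r
      proof -
        have l0: "Poly_Mapping.lookup ?\<Delta>2 (Infinite r) = 0"
          by (simp add: lookup_minus lookup_single when_def P0' P' scale_point_def)
        have "C2.order_at (Infinite r) (C2.aff.ev (map_poly of_rat w0, 0)) = - int n"
          using order_linear_power_infinite2[OF inf2[OF r(1)], of a k] r(2) k by (simp add: w0(1))
        then show ?thesis
          using ord[OF inf2[OF r(1)]] unfolding l0 \<psi>(1) by linarith
      qed
      obtain p q where pq: "u = (p, q)" by fastforce
      \<comment> \<open>Pole bounds at both points at infinity of the twist limit the degrees, and
        pushing does not raise degrees. The pushed numerator hence has a pole of order at most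
        \<open>n\<close>, balanced by the pole of order \<open>n\<close> of the denominator.\<close>
      have "degree p \<le> n \<and> (q = 0 \<or> degree q + half_degree (map_poly of_rat f :: 'l poly) \<le> n)"
        using C2.degree_bound_infinite[OF inf2[OF s] \<open>s \<noteq> 0\<close>, of p q n] ge[of s] ge[of "- s"] s \<open>s \<noteq> 0\<close> \<psi>(2)
        by (simp add: pq)
      then have deg: "degree p \<le> n" "q = 0 \<or> degree q + h \<le> n" by (simp_all add: half_degree_eq h_def)
      define p1 q1 where "p1 = push p" and "q1 = push (smult (1 / \<epsilon>) q)"
      have d1: "degree p1 \<le> n" using degree_push[of p] deg(1) by (simp add: p1_def)
      have d2: "q1 = 0 \<or> degree q1 + h \<le> n"
        using degree_push[of "smult (1 / \<epsilon>) q"] degree_smult_le[of "1 / \<epsilon>" q] deg(2) by (auto simp: q1_def)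
      have pu: "push_pair u = (p1, q1)" by (simp add: push_pair_def pq p1_def q1_def)
      have x: "C1.has_ord (Infinite w) (- 1) coord_x"
        using C1.has_ord_coord_x[of w] Q Infinite w0' by simp
      have Qi: "Infinite w \<in> curve1" using Q Infinite by simp
      have "C1.order_at Q (C1.aff.ev (push_pair u)) \<ge> - int n"
      proof (cases "q1 = 0")
        case True
        then have "p1 \<noteq> 0" using \<psi>(3) pu by (auto simp: zero_prod_def)
        from C1.vanishing_order_eqI[OF Qi C1.has_ord_poly_infinite[OF Qi this]] show ?thesis
          using d1 w0' by (simp add: pu True Infinite)
      next
        case False
        define v where "v = (rev_poly n p1, rev_poly (n - half_degree (map_poly of_rat f :: 'k poly)) q1)"
        have ev: "C1.aff.ev (push_pair u) = coord_x ^ n * C1.inf.ev v"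
          unfolding pu v_def by (rule C1.inf_ev) (use d1 d2 False in \<open>simp_all add: half_degree_eq h_def\<close>)
        have "v \<noteq> 0" using \<psi>(3) ev by auto
        then obtain m where "C1.has_ord (Infinite w) (int m) (C1.inf.ev v)"
          using C1.has_ord_exists_chart[OF Qi] unfolding C1.chart_ev_infinite by blast
        from C1.vanishing_order_eqI[OF Qi C1.has_ord_mult[OF Qi C1.has_ord_power[OF Qi x, of n] this]]
        show ?thesis by (simp add: ev Infinite)
      qed
      moreover have "C1.order_at Q (C1.aff.ev (W1, 0)) = - int n"
        using order_linear_power_infinite1[OF Qi, of a k] w0' k by (simp add: W1_def w0(1) Infinite)
      ultimately show ?thesis unfolding lookup ord\<phi>[OF Q] by simp
    qed
  qed
  show ?thesis
  proof (rule C1.effective_principal)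
    show "\<phi> \<in> function_field 1 (map_poly of_rat f)" unfolding \<phi>_def by (rule C1.ev_in_function_field)
    show "\<phi> \<noteq> 0" by (rule \<phi>0)
    show "?\<Delta>1 \<in> carrier (Div0 1 (map_poly of_rat f))"
      by (intro difference_in_Div0 up_in_curve P P0)
    fix Q assume "Q \<in> curve1"
    then show "Poly_Mapping.lookup ?\<Delta>1 Q \<le> C1.order_at Q \<phi>"
      using rational irrational by blast
  qed
qed

end

text \<open>The prescribed value keeps one chosen coefficient of a function alive when the
  functional is applied to all of them.\<close>

lemma exists_rat_functional:
  fixes e :: "'l::field_char_0"
  assumes "e \<noteq> 0"
  shows "\<exists>L :: 'l \<Rightarrow> rat. (\<forall>x y. L (x + y) = L x + L y) \<and> (\<forall>r x. L (of_rat r * x) = r * L x) \<and> L e = 1"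
proof -
  interpret vs: vector_space "\<lambda>(r::rat) (x::'l). of_rat r * x"
    by unfold_locales (simp_all add: algebra_simps of_rat_add of_rat_mult)
  interpret rs: vector_space "(*) :: rat \<Rightarrow> rat \<Rightarrow> rat"
    by unfold_locales (simp_all add: algebra_simps)
  interpret vp: vector_space_pair "\<lambda>(r::rat) (x::'l). of_rat r * x" "(*) :: rat \<Rightarrow> rat \<Rightarrow> rat" ..
  have "vs.independent {e}" using assms by (simp add: vs.dependent_single)
  from vp.linear_independent_extend[OF this, of "\<lambda>_. 1"]
  obtain g where g: "Vector_Spaces.linear (\<lambda>(r::rat) (x::'l). of_rat r * x) (*) g" "g e = 1" by auto
  interpret g: Vector_Spaces.linear "\<lambda>(r::rat) (x::'l). of_rat r * x" "(*)" g by (rule g(1))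
  show ?thesis using g.add g.scale g(2) by blast
qed

lemma principal_descends:
  fixes f :: "rat poly" and \<epsilon> :: "'l::{alg_closed_field, field_char_0}"
  assumes hyp1: "hyperelliptic (1::'k::{alg_closed_field, field_char_0}) (map_poly of_rat f)"
    and hyp2: "hyperelliptic (\<epsilon>\<^sup>2) (map_poly of_rat f)" and \<epsilon>: "\<epsilon> \<noteq> 0"
    and P: "P \<in> curve_points 1 f" and P0: "P0 \<in> curve_points 1 f"
    and D: "frag_cmul (int n) (frag_of (scale_point \<epsilon> P) - frag_of (scale_point \<epsilon> P0))
      \<in> principal_divisors (\<epsilon>\<^sup>2) (map_poly of_rat f)"
  shows "frag_cmul (int n) (frag_of (map_curve_point of_rat P) - frag_of (map_curve_point of_rat P0))
      \<in> principal_divisors (1::'k) (map_poly of_rat f)"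
proof -
  \<comment> \<open>The right functional can be chosen only when the function is known; until then
    the zero map gives access to the facts about both curves.\<close>
  interpret T: constant_twist f \<epsilon> "\<lambda>_. 0 :: 'k"
    by (intro constant_twist.intro hyp1 hyp2 \<epsilon>) simp_all
  let ?\<Delta> = "frag_cmul (int n) (frag_of (scale_point \<epsilon> P) - frag_of (scale_point \<epsilon> P0))"
  let ?C = "curve_points (\<epsilon>\<^sup>2) (map_poly of_rat f)"
  from D obtain \<phi> where \<phi>: "\<phi> \<in> function_field (\<epsilon>\<^sup>2) (map_poly of_rat f)" "\<phi> \<noteq> 0"
    and lookup: "\<And>Q. Q \<in> ?C \<Longrightarrow> Poly_Mapping.lookup ?\<Delta> Q = T.C2.order_at Q \<phi>"
    by (auto simp: principal_divisors_def)
  define k where "k = (case P0 of Affine _ _ \<Rightarrow> n | Infinite _ \<Rightarrow> 0)"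
  define a where "a = (case P0 of Affine x _ \<Rightarrow> x | Infinite _ \<Rightarrow> 0)"
  define w0 where "w0 = [:- a, 1:] ^ k"
  define W where "W = T.C2.aff.ev (map_poly of_rat w0, 0)"
  have "map_poly of_rat w0 \<noteq> (0 :: 'l poly)" by (simp add: w0_def)
  then have W0: "W \<noteq> 0" by (simp add: W_def zero_prod_def)
  have WF: "W \<in> function_field (\<epsilon>\<^sup>2) (map_poly of_rat f)" unfolding W_def by (rule T.C2.ev_in_ff)
  have ord: "T.C2.order_at Q (\<phi> * W) = Poly_Mapping.lookup ?\<Delta> Q + T.C2.order_at Q W" if "Q \<in> ?C" for Q
    using T.C2.ord_mult[OF that, of \<phi> W] \<phi> W0 WF lookup[OF that] by simp
  have "T.C2.order_at (Affine x y) (\<phi> * W) \<ge> 0" if Q: "Affine x y \<in> ?C" for x y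
  proof -
    have W: "T.C2.order_at (Affine x y) W = (if x = of_rat a then int k * (if y = 0 then 2 else 1) else 0)"
      unfolding W_def w0_def by (rule T.order_linear_power_affine2[OF Q])
    show ?thesis
    proof (cases "Affine x y = scale_point \<epsilon> P0")
      case True
      then have xk: "x = of_rat a" "k = n"
        by (cases P0; simp add: scale_point_def a_def k_def)+
      have "- int n \<le> Poly_Mapping.lookup ?\<Delta> (Affine x y)"
        by (simp add: lookup_minus lookup_single when_def)
      moreover have "int n \<le> T.C2.order_at (Affine x y) W" unfolding W using xk by simp
      ultimately show ?thesis unfolding ord[OF Q] by linarith
    next
      case False
      then have "0 \<le> Poly_Mapping.lookup ?\<Delta> (Affine x y)"
        by (auto simp: lookup_minus lookup_single when_def)
      moreover have "0 \<le> T.C2.order_at (Affine x y) W" unfolding W by simp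
      ultimately show ?thesis unfolding ord[OF Q] by linarith
    qed
  qed
  moreover have "\<phi> * W \<in> function_field (\<epsilon>\<^sup>2) (map_poly of_rat f)" "\<phi> * W \<noteq> 0"
    using T.C2.function_field_mult[OF \<phi>(1) WF] \<phi>(2) W0 by auto
  ultimately obtain u where u: "\<phi> * W = T.C2.aff.ev u"
    using T.C2.regular_imp_polynomial by blast
  then have "u \<noteq> 0" using \<open>\<phi> * W \<noteq> 0\<close> by auto
  obtain p q where pq: "u = (p, q)" by fastforce
  \<comment> \<open>A non-zero number among those the functional is applied to; with
    \<open>L e = 1\<close> the pushed pair cannot vanish.\<close>
  obtain e where e: "e \<noteq> 0" "(\<exists>i. e = coeff p i) \<or> (\<exists>i. e = coeff q i / \<epsilon>)"
  proof (cases "p = 0")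
    case False
    then show thesis using that[of "lead_coeff p"] by auto
  next
    case True
    then have "q \<noteq> 0" using \<open>u \<noteq> 0\<close> pq by (auto simp: zero_prod_def)
    then show thesis using that[of "lead_coeff q / \<epsilon>"] \<epsilon> by auto
  qed
  obtain L :: "'l \<Rightarrow> rat" where L: "\<And>x y. L (x + y) = L x + L y" "\<And>r x. L (of_rat r * x) = r * L x" "L e = 1"
    using exists_rat_functional[OF e(1)] by blast
  interpret S: constant_twist f \<epsilon> "\<lambda>x. of_rat (L x) :: 'k"
    by (intro constant_twist.intro hyp1 hyp2 \<epsilon>) (simp_all add: L of_rat_add of_rat_mult)
  have "S.push_pair u \<noteq> 0"
  proof
    assume "S.push_pair u = 0"
    then have 0: "S.push p = 0" "S.push (smult (1 / \<epsilon>) q) = 0"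
      by (simp_all add: S.push_pair_def pq zero_prod_def)
    have zero: "L (coeff r i) = 0" if r: "S.push r = 0" for r i
    proof -
      have c: "coeff (S.push r) i = 0" unfolding r by (rule coeff_0)
      have "of_rat (L (coeff r i)) = (0 :: 'k)"
        by (rule trans[OF S.coeff_push[symmetric] c])
      then show ?thesis by (simp only: of_rat_eq_0_iff)
    qed
    have "L (coeff p i) = 0" for i by (rule zero[OF 0(1)])
    moreover have "L (coeff q i / \<epsilon>) = 0" for i
      using zero[OF 0(2), of i] by (simp only: coeff_smult mult.commute[of "1 / \<epsilon>"] times_divide_eq_right mult_1_right)
    ultimately have "L e = 0" using e(2) by metis
    with L(3) show False by simp
  qed
  from S.principal_descends_aux[OF P P0 u \<open>u \<noteq> 0\<close> this w0_def k_def a_def]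
  have "frag_cmul (int n) (frag_of (S.up P) - frag_of (S.up P0)) \<in> principal_divisors (1::'k) (map_poly of_rat f)"
    using ord unfolding W_def by simp
  then show ?thesis by (simp add: S.up_def)
qed

section \<open>Square twists of an elliptic curve over the rationals\<close>

lemma squarefree_bezout:
  fixes f :: "rat poly"
  assumes "squarefree f"
  shows "\<exists>u v. u * f + v * pderiv f = 1"
proof -
  have "f \<noteq> 0" using assms by auto
  have "is_unit (gcd f (pderiv f))"
  proof (rule ccontr)
    assume "\<not> is_unit (gcd f (pderiv f))"
    moreover have "gcd f (pderiv f) \<noteq> 0" using \<open>f \<noteq> 0\<close> by simp
    ultimately obtain p where p: "p dvd gcd f (pderiv f)" "prime p"
      using prime_divisor_exists by blast
    from p(1) have pf: "p dvd f" and pf': "p dvd pderiv f" by auto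
    from pf obtain g where g: "f = p * g" by blast
    have "p dvd pderiv p * g"
    proof -
      have "pderiv f = p * pderiv g + pderiv p * g" unfolding g by (simp add: pderiv_mult mult.commute)
      with pf' have "p dvd p * pderiv g + pderiv p * g" by simp
      then show ?thesis by (simp add: dvd_add_right_iff)
    qed
    then have "p dvd pderiv p \<or> p dvd g" using p(2) by (simp add: prime_dvd_mult_iff)
    moreover have "\<not> p dvd pderiv p"
    proof
      assume dvd: "p dvd pderiv p"
      have "p \<noteq> 0" using p(2) by auto
      moreover have "\<not> is_unit p" using p(2) not_prime_unit[of p] by blast
      ultimately have deg: "degree p \<noteq> 0" unfolding is_unit_iff_degree[OF \<open>p \<noteq> 0\<close>] by blast
      then have "pderiv p \<noteq> 0" by (simp add: pderiv_eq_0_iff)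
      with dvd have "degree p \<le> degree (pderiv p)" by (rule dvd_imp_degree_le)
      with deg show False by (simp add: degree_pderiv)
    qed
    ultimately have "p ^ 2 dvd f" unfolding g power2_eq_square by (auto intro: mult_dvd_mono)
    with assms have "p dvd 1" by (rule squarefreeD)
    with p(2) not_prime_unit[of p] show False by blast
  qed
  then obtain c where c: "1 = gcd f (pderiv f) * c" by (rule dvdE)
  define u v where "u = fst (bezout_coefficients f (pderiv f))" and "v = snd (bezout_coefficients f (pderiv f))"
  have "u * f + v * pderiv f = gcd f (pderiv f)"
    unfolding u_def v_def by (rule bezout_coefficients_fst_snd)
  with c have "1 = (u * f + v * pderiv f) * c" by simp
  then have "(u * c) * f + (v * c) * pderiv f = 1" by (simp only: distrib_left distrib_right mult_ac)
  then show ?thesis by blast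
qed

text \<open>Coprimality with the derivative, written as a Bezout identity, passes directly to every
  extension field; squarefreeness over the extension is recovered from it.\<close>

lemma squarefree_of_rat:
  fixes f :: "rat poly"
  assumes "squarefree f"
  obtains u v :: "'a::field_char_0 poly"
  where "u * map_poly of_rat f + v * pderiv (map_poly of_rat f) = 1"
proof -
  obtain u v where uv: "u * f + v * pderiv f = 1" using squarefree_bezout[OF assms] by blast
  have "pderiv (map_poly of_rat f) = (map_poly of_rat (pderiv f) :: 'a poly)"
    by (rule poly_eqI) (simp add: coeff_pderiv coeff_map_poly of_rat_mult of_rat_add)
  with arg_cong[OF uv, of "map_poly of_rat :: _ \<Rightarrow> 'a poly"] that show thesis
    by (simp add: of_rat_poly_hom.hom_add of_rat_poly_hom.hom_mult)
qed

lemma hyperelliptic_of_squarefree: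
  fixes f :: "rat poly" and d :: "'k::{alg_closed_field, field_char_0}"
  assumes "squarefree f" "degree f \<ge> 3" "d \<noteq> 0"
  shows "hyperelliptic d (map_poly of_rat f)"
proof
  fix a :: 'k
  assume a: "poly (map_poly of_rat f) a = 0"
  obtain u v where uv: "u * map_poly of_rat f + v * pderiv (map_poly of_rat f) = (1 :: 'k poly)"
    using squarefree_of_rat[OF assms(1)] .
  show "poly (pderiv (map_poly of_rat f)) a \<noteq> 0"
    using arg_cong[OF uv, of "\<lambda>p. poly p a"] a by auto
qed (use assms in simp_all)

lemma squarefree_map_poly_of_rat:
  fixes f :: "rat poly"
  assumes "squarefree f"
  shows "squarefree (map_poly of_rat f :: 'a::field_char_0 poly)"
proof (rule squarefreeI)
  fix x :: "'a poly"
  assume "x ^ 2 dvd map_poly of_rat f"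
  then obtain g where g: "map_poly of_rat f = x * (x * g)" by (auto simp: dvd_def power2_eq_square mult.assoc)
  obtain u v where uv: "u * map_poly of_rat f + v * pderiv (map_poly of_rat f) = (1 :: 'a poly)"
    using squarefree_of_rat[OF assms] .
  have "pderiv (map_poly of_rat f) = x * pderiv (x * g) + pderiv x * (x * g)"
    unfolding g by (simp add: pderiv_mult mult.commute)
  also have "\<dots> = x * (pderiv (x * g) + pderiv x * g)" by (simp add: algebra_simps)
  finally have "x dvd pderiv (map_poly of_rat f)" by (metis dvd_triv_left)
  moreover have "x dvd map_poly of_rat f" unfolding g by (rule dvd_triv_left)
  ultimately show "x dvd 1" unfolding uv[symmetric] by (intro dvd_add dvd_mult)
qed

lemma map_to_ac_of_rat: "map_poly to_ac (map_poly of_rat f :: 'a::field_char_0 poly) = map_poly of_rat f"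
  by (rule poly_eqI) (simp add: coeff_map_poly to_ac_of_rat)

lemma to_ac_rat: "to_ac (r::rat) = of_rat r"
  using to_ac_of_rat[of r, where 'a = rat] by simp

text \<open>A point of infinite order over the rationals is scaled to the twist. If a multiple of
  its class became trivial there, \<open>principal_descends\<close> would make the same multiple
  trivial on the original curve.\<close>

lemma elliptic_rank_square_twist:
  fixes e :: "'a::field_char_0"
  assumes E: "elliptic_curve 1 f P0" and rank: "elliptic_rank 1 f P0 > 0" and e: "e \<noteq> 0"
  shows "\<exists>Q0. elliptic_curve (e\<^sup>2) (map_poly of_rat f) Q0 \<and> elliptic_rank (e\<^sup>2) (map_poly of_rat f) Q0 > 0"
proof -
  have sf: "squarefree f" and deg: "degree f \<in> {3, 4}" and P0: "P0 \<in> curve_points 1 f"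
    using E by (auto simp: elliptic_curve_def)
  let ?f1 = "map_poly of_rat f :: rat alg_closure poly" and ?f2 = "map_poly of_rat f :: 'a alg_closure poly"
  let ?\<epsilon> = "to_ac e"
  have f1: "map_poly to_ac f = ?f1" by (rule poly_eqI) (simp add: coeff_map_poly to_ac_rat)
  have hyp1: "hyperelliptic 1 ?f1" and hyp2: "hyperelliptic (?\<epsilon>\<^sup>2) ?f2"
    using sf deg e by (auto intro!: hyperelliptic_of_squarefree)
  interpret C1: hyperelliptic 1 ?f1 by (rule hyp1)
  interpret C2: hyperelliptic "?\<epsilon>\<^sup>2" ?f2 by (rule hyp2)
  have toac: "map_curve_point to_ac R = map_curve_point of_rat R" for R :: "rat curve_point"
    by (cases R) (simp_all add: to_ac_rat)
  have Rin: "map_curve_point of_rat R \<in> curve_points 1 ?f1" if "R \<in> curve_points 1 f" for R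
    using that by (cases R) (auto simp: curve_points_def of_rat_hom.poly_map_poly half_degree_def
        coeff_map_poly of_rat_power[symmetric])
  have "subgroup_rank (Pic0 1 ?f1) (elliptic_group 1 f P0) > 0"
    using rank by (simp add: elliptic_rank_def f1)
  then obtain C where C: "C \<in> elliptic_group 1 f P0"
    "\<And>n::int. C [^]\<^bsub>Pic0 1 ?f1\<^esub> n = \<one>\<^bsub>Pic0 1 ?f1\<^esub> \<Longrightarrow> n = 0"
    using subgroup_rank_posE[OF C1.comm_group_Pic0] by metis
  then obtain P where P: "P \<in> curve_points 1 f"
    and CP: "C = divisor_class 1 ?f1 (frag_of (map_curve_point of_rat P) - frag_of (map_curve_point of_rat P0))"
    by (auto simp: elliptic_group_def f1 toac)
  let ?\<Delta>1 = "frag_of (map_curve_point of_rat P) - frag_of (map_curve_point of_rat P0) :: rat alg_closure divisor"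
  have D1: "?\<Delta>1 \<in> carrier (Div0 1 ?f1)"
    using Rin[OF P] Rin[OF P0] keys_diff[of "frag_of (map_curve_point of_rat P)" "frag_of (map_curve_point of_rat P0)"]
    by (auto simp: divisor_degree_difference)
  have inf1: "frag_cmul n ?\<Delta>1 \<notin> principal_divisors 1 ?f1" if "n \<noteq> 0" for n
    using C(2)[of n] C1.divisor_class_pow_eq_one_iff[OF D1, of n] that unfolding CP by blast
  define Q0 Q where "Q0 = scale_point e P0" and "Q = scale_point e P"
  have in2: "scale_point e R \<in> curve_points (e\<^sup>2) (map_poly of_rat f)" if "R \<in> curve_points 1 f" for R
    using that e by (cases R) (auto simp: scale_point_def curve_points_def of_rat_hom.poly_map_poly half_degree_def
        coeff_map_poly of_rat_power[symmetric] power_divide)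
  have toac2: "map_curve_point to_ac (scale_point e R) = scale_point ?\<epsilon> R" for R
    by (cases R) (simp_all add: scale_point_def to_ac_of_rat)
  have in3: "scale_point ?\<epsilon> R \<in> curve_points (?\<epsilon>\<^sup>2) ?f2" if "R \<in> curve_points 1 f" for R
    using that e by (cases R) (auto simp: scale_point_def curve_points_def of_rat_hom.poly_map_poly half_degree_def
        coeff_map_poly of_rat_power[symmetric] power_divide)
  have ell: "elliptic_curve (e\<^sup>2) (map_poly of_rat f) Q0"
    using e deg squarefree_map_poly_of_rat[OF sf] in2[OF P0] by (auto simp: elliptic_curve_def Q0_def)
  let ?\<Delta>2 = "frag_of (scale_point ?\<epsilon> P) - frag_of (scale_point ?\<epsilon> P0)"
  have D2: "?\<Delta>2 \<in> carrier (Div0 (?\<epsilon>\<^sup>2) ?f2)"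
    using in3[OF P] in3[OF P0] keys_diff[of "frag_of (scale_point ?\<epsilon> P)" "frag_of (scale_point ?\<epsilon> P0)"]
    by (auto simp: divisor_degree_difference)
  have "frag_cmul (int n) ?\<Delta>2 \<notin> principal_divisors (?\<epsilon>\<^sup>2) ?f2" if "n \<ge> 1" for n
    using principal_descends[OF hyp1 hyp2 _ P P0, of n] inf1[of "int n"] that e by auto
  from C2.independent_class[OF D2 this]
  have ind: "int_independent (Pic0 (?\<epsilon>\<^sup>2) ?f2) {divisor_class (?\<epsilon>\<^sup>2) ?f2 ?\<Delta>2}" .
  have "divisor_class (?\<epsilon>\<^sup>2) ?f2 ?\<Delta>2 \<in> elliptic_group (e\<^sup>2) (map_poly of_rat f) Q0"
    unfolding elliptic_group_def using in2[OF P]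
    by (intro image_eqI[of _ _ Q]) (simp_all add: Q_def Q0_def toac2 map_to_ac_of_rat)
  with ind have "elliptic_rank (e\<^sup>2) (map_poly of_rat f) Q0 > 0"
    unfolding elliptic_rank_def by (intro subgroup_rank_pos) (simp_all add: map_to_ac_of_rat)
  with ell show ?thesis by blast
qed

section \<open>Choice of the twist\<close>

text \<open>A triangle with sides \<open>b c\<close>, \<open>u c\<close>, \<open>u b\<close> has
  sides proportional to \<open>1 / u\<close>, \<open>1 / b\<close>, \<open>1 / c\<close>. By the law
  of sines its angles satisfy \<open>u sin \<alpha> = b sin \<beta> = c sin \<gamma>\<close>, and
  \<xi> is minus the square of this common value. So
  \<open>\<xi> + u ^ 2 = (u cos \<alpha>) ^ 2\<close>, and likewise for \<open>b\<close> and
  \<open>c\<close>. Heron's formula makes \<xi> rational in \<open>u\<close>, \<open>b\<close>,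
  \<open>c\<close>, and the law of cosines does the same for the roots.\<close>

lemma heron_identities:
  fixes u b c :: "'a::field_char_0"
  assumes "u \<noteq> 0" "b \<noteq> 0" "c \<noteq> 0"
  defines "\<xi> \<equiv> ((u\<^sup>2 * b\<^sup>2 + u\<^sup>2 * c\<^sup>2 - b\<^sup>2 * c\<^sup>2)\<^sup>2 - 4 * u ^ 4 * b\<^sup>2 * c\<^sup>2) / (4 * u\<^sup>2 * b\<^sup>2 * c\<^sup>2)"
  shows "\<xi> + u\<^sup>2 = ((u\<^sup>2 * b\<^sup>2 + u\<^sup>2 * c\<^sup>2 - b\<^sup>2 * c\<^sup>2) / (2 * u * b * c))\<^sup>2"
    and "\<xi> + b\<^sup>2 = ((u\<^sup>2 * b\<^sup>2 + b\<^sup>2 * c\<^sup>2 - u\<^sup>2 * c\<^sup>2) / (2 * u * b * c))\<^sup>2"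
    and "\<xi> + c\<^sup>2 = ((u\<^sup>2 * c\<^sup>2 + b\<^sup>2 * c\<^sup>2 - u\<^sup>2 * b\<^sup>2) / (2 * u * b * c))\<^sup>2"
proof -
  let ?d = "4 * u\<^sup>2 * b\<^sup>2 * c\<^sup>2"
  have d: "?d \<noteq> 0" using assms by simp
  have sq: "(z / (2 * u * b * c))\<^sup>2 = z\<^sup>2 / ?d" for z by (simp add: power_divide power_mult_distrib)
  have add: "\<xi> + e = ((u\<^sup>2 * b\<^sup>2 + u\<^sup>2 * c\<^sup>2 - b\<^sup>2 * c\<^sup>2)\<^sup>2 - 4 * u ^ 4 * b\<^sup>2 * c\<^sup>2 + e * ?d) / ?d" for e
    unfolding \<xi>_def using d by (simp add: add_divide_distrib)
  show "\<xi> + u\<^sup>2 = ((u\<^sup>2 * b\<^sup>2 + u\<^sup>2 * c\<^sup>2 - b\<^sup>2 * c\<^sup>2) / (2 * u * b * c))\<^sup>2"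
    unfolding sq add by (rule arg_cong[of _ _ "\<lambda>z. z / ?d"]) (simp add: power2_eq_square power4_eq_xxxx)
  show "\<xi> + b\<^sup>2 = ((u\<^sup>2 * b\<^sup>2 + b\<^sup>2 * c\<^sup>2 - u\<^sup>2 * c\<^sup>2) / (2 * u * b * c))\<^sup>2"
    unfolding sq add by (rule arg_cong[of _ _ "\<lambda>z. z / ?d"]) (simp add: power2_eq_square power4_eq_xxxx algebra_simps)
  show "\<xi> + c\<^sup>2 = ((u\<^sup>2 * c\<^sup>2 + b\<^sup>2 * c\<^sup>2 - u\<^sup>2 * b\<^sup>2) / (2 * u * b * c))\<^sup>2"
    unfolding sq add by (rule arg_cong[of _ _ "\<lambda>z. z / ?d"]) (simp add: power2_eq_square power4_eq_xxxx algebra_simps)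
qed

text \<open>With \<open>M = m k\<close>, multiply
  \<open>\<xi> + a ^ 2 v ^ (2 m) = \<beta> ^ 2\<close> by
  \<open>\<xi> ^ (M - 1) / v ^ (2 m)\<close>: the first term becomes the \<open>m\<close>-th power
  of \<open>\<xi> ^ k / v ^ 2\<close>, and the right-hand side stays a square because
  \<open>M\<close> is odd.\<close>

lemma jacobian_rank_twist:
  fixes \<xi> \<beta> v :: ratfun3
  assumes m: "odd m" "m \<ge> 3" and k: "odd k" and nz: "v \<noteq> 0" "\<xi> \<noteq> 0" "\<beta> \<noteq> 0" "a \<noteq> 0"
    and eq: "\<xi> + (of_rat a * v ^ m)\<^sup>2 = \<beta>\<^sup>2"
    and \<theta>: "\<And>g :: rat poly. poly g 1 \<noteq> 0 \<Longrightarrow> poly (map_poly of_rat g) (\<xi> / \<beta>\<^sup>2) \<noteq> 0"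
  shows "jacobian_rank 1 (twist_poly m (a\<^sup>2) (\<xi> ^ (m * k - 1))) > 0"
proof -
  define M where "M = m * k"
  define r where "r = (M - 1) div 2"
  have M: "M = Suc (2 * r)" using m k by (auto simp: M_def r_def elim!: oddE)
  define x0 y0 where "x0 = \<xi> ^ k / v\<^sup>2" and "y0 = \<beta> * \<xi> ^ r / v ^ m"
  have x0: "x0 ^ m = \<xi> ^ M / (v ^ m)\<^sup>2"
    by (simp add: x0_def power_divide M_def power_mult[symmetric] mult.commute)
  have y0: "y0\<^sup>2 = \<beta>\<^sup>2 * \<xi> ^ (2 * r) / (v ^ m)\<^sup>2"
    by (simp add: y0_def power_divide power_mult_distrib power_mult[symmetric] mult.commute)
  have XM: "\<xi> ^ M = \<xi> * \<xi> ^ (2 * r)" by (simp add: M)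
  have "y0\<^sup>2 = x0 ^ m + of_rat (a\<^sup>2) * \<xi> ^ (M - 1)"
    unfolding y0 x0 eq[symmetric] XM using nz
    by (simp add: M field_simps power2_eq_square of_rat_mult)
  moreover have "x0 ^ m / y0\<^sup>2 = \<xi> / \<beta>\<^sup>2"
    unfolding y0 x0 XM using nz by simp
  moreover have "of_rat (a\<^sup>2) * \<xi> ^ (M - 1) \<noteq> 0" "x0 \<noteq> 0" "y0 \<noteq> 0"
    using nz by (simp_all add: x0_def y0_def)
  ultimately have "jacobian_rank 1 (monom 1 m + [:of_rat (a\<^sup>2) * \<xi> ^ (M - 1):]) > 0"
    using \<theta> by (intro jacobian_rank_pos[OF m, of _ y0 x0]) simp_all
  then show ?thesis by (simp add: twist_poly_def M_def)
qed

lemma of_rat_unique: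
  fixes h :: "rat \<Rightarrow> 'a::field_char_0"
  assumes "comm_ring_hom h"
  shows "h r = of_rat r"
proof -
  interpret comm_ring_hom h by fact
  have nat: "h (of_nat n) = of_nat n" for n by (induction n) (simp_all add: hom_add)
  have int: "h (of_int n) = of_int n" for n
    using nat[of "nat n"] nat[of "nat (- n)"] hom_uminus[of "of_nat (nat (- n))"] by (cases "n \<ge> 0") simp_all
  obtain p q where r: "r = Rat.Fract p q" "q > 0" by (cases r) auto
  have "r * of_int q = of_int p" using r(2) unfolding r(1) by (simp add: Fract_of_int_quotient)
  then have "h r * of_int q = of_int p" by (metis hom_mult int)
  with r(2) show ?thesis unfolding r(1) by (simp add: of_rat_rat field_simps)
qed

text \<open>The variable of the outermost polynomial ring, taken as the \<open>t\<close> of the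
  construction.\<close>

definition var_t :: ratfun3 where "var_t = to_fract [:0, 1:]"

definition eval_t :: "rat poly \<Rightarrow> ratfun3" where
  "eval_t g = poly (map_poly of_rat g) var_t"

lemma eval_t_hom: "comm_ring_hom eval_t"
  unfolding eval_t_def by (rule comm_ring_hom_eval_rat)

lemma eval_t_eq_0_iff: "eval_t g = 0 \<longleftrightarrow> g = 0"
proof -
  \<comment> \<open>The threefold embedding of constants is a ring homomorphism on the rationals and
    hence agrees with \<open>of_rat\<close>.\<close>
  define h :: "rat \<Rightarrow> ratfun3" where "h = (\<lambda>r. to_fract [:[:[:r:]:]:])"
  have "comm_ring_hom h"
    by unfold_locales (simp_all add: h_def one_pCons[symmetric] flip: to_fract_add to_fract_mult)
  then have of_rat: "of_rat r = to_fract [:[:[:r:]:]:]" for r using of_rat_unique[of h r] by (simp add: h_def)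
  have "eval_t g = to_fract (map_poly (\<lambda>r. [:[:r:]:]) g)"
  proof (induction g)
    case (pCons r g)
    define G where "G = map_poly (\<lambda>r::rat. [:[:r:]:]) g"
    have "of_rat r + var_t * eval_t g = to_fract [:[:[:r:]:]:] + to_fract [:0, 1:] * to_fract G"
      by (simp only: of_rat var_t_def pCons.IH G_def)
    also have "\<dots> = to_fract ([:[:[:r:]:]:] + [:0, 1:] * G)" by (simp only: to_fract_add to_fract_mult)
    also have "[:[:[:r:]:]:] + [:0, 1:] * G = pCons [:[:r:]:] G" by simp
    finally have "to_fract (pCons [:[:r:]:] (map_poly (\<lambda>r. [:[:r:]:]) g)) = of_rat r + var_t * eval_t g"
      unfolding G_def by (rule sym)
    with pCons.hyps show ?case by (simp add: eval_t_def map_poly_pCons)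
  qed (simp add: eval_t_def)
  moreover have "map_poly (\<lambda>r::rat. [:[:r:]:]) g = 0 \<longleftrightarrow> g = 0"
    by (rule map_poly_eq_0_iff) simp_all
  ultimately show ?thesis by simp
qed

text \<open>With \<open>n\<close> the degree of \<open>g\<close>, \<open>D ^ n g(N / D)\<close> is a
  polynomial in \<open>t\<close>. At \<open>t = 0\<close> it equals \<open>g(1) D(0) ^ n\<close>,
  because \<open>N\<close> and \<open>D\<close> agree there, and this is non-zero.\<close>

lemma specialization:
  assumes "poly N 0 = poly D 0" "poly D 0 \<noteq> 0" "poly g 1 \<noteq> 0"
  shows "poly (map_poly of_rat g) (eval_t N / eval_t D) \<noteq> 0"
proof
  interpret comm_ring_hom eval_t by (rule eval_t_hom)
  assume 0: "poly (map_poly of_rat g) (eval_t N / eval_t D) = 0"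
  define n where "n = degree g"
  define H where "H = (\<Sum>i\<le>n. smult (coeff g i) (N ^ i * D ^ (n - i)))"
  have "D \<noteq> 0" using assms(2) by auto
  then have D0: "eval_t D \<noteq> 0" by (simp add: eval_t_eq_0_iff)
  have smult: "eval_t (smult r p) = of_rat r * eval_t p" for r p
    by (simp add: eval_t_def map_poly_smult_hom[OF of_rat_hom.comm_ring_hom_axioms])
  have "eval_t H = (\<Sum>i\<le>n. of_rat (coeff g i) * (eval_t N ^ i * eval_t D ^ (n - i)))"
    by (simp add: H_def hom_sum smult hom_mult hom_power)
  also have "\<dots> = (\<Sum>i\<le>n. eval_t D ^ n * (of_rat (coeff g i) * (eval_t N / eval_t D) ^ i))"
    using D0 by (intro sum.cong) (auto simp: power_divide power_diff field_simps)
  also have "\<dots> = eval_t D ^ n * poly (map_poly of_rat g) (eval_t N / eval_t D)"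
    unfolding sum_distrib_left[symmetric]
    by (subst poly_eq_sum_le[of "map_poly of_rat g" n]) (simp_all add: n_def coeff_map_poly)
  finally have "H = 0" using 0 by (simp add: eval_t_eq_0_iff)
  then have "0 = poly H 0" by simp
  also have "\<dots> = (\<Sum>i\<le>n. coeff g i * poly D 0 ^ n)"
    using assms(1) by (simp add: H_def poly_sum power_add[symmetric])
  also have "\<dots> = poly g 1 * poly D 0 ^ n"
    by (simp add: sum_distrib_right[symmetric] n_def poly_altdef)
  finally show False using assms by simp
qed

theorem theorem3p1:
  fixes f :: "rat poly" and P0 :: "rat curve_point"
    and m1 m2 m3 :: nat and a b c :: rat
  assumes "elliptic_curve 1 f P0"
    and "elliptic_rank 1 f P0 > 0"
    and "m1 \<ge> 3" "odd m1" "m2 \<ge> 3" "odd m2" "m3 \<ge> 3" "odd m3"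
    and "a \<noteq> 0" "b \<noteq> 0" "c \<noteq> 0"
  shows "\<exists>D :: ratfun3. D \<noteq> 0 \<and>
    (\<exists>Q0. elliptic_curve D (map_poly of_rat f) Q0 \<and>
          elliptic_rank D (map_poly of_rat f) Q0 > 0) \<and>
    jacobian_rank 1 (twist_poly m1 (a\<^sup>2) D) > 0 \<and>
    jacobian_rank 1 (twist_poly m2 (b\<^sup>2) D) > 0 \<and>
    jacobian_rank 1 (twist_poly m3 (c\<^sup>2) D) > 0"
proof -
  interpret comm_ring_hom eval_t by (rule eval_t_hom)
  \<comment> \<open>Polynomials in \<open>t\<close> that mirror the numerators of
    \<open>heron_identities\<close>; setting \<open>t = 0\<close> requires them before they are
    mapped into the field.\<close>
  define U where "U = monom a m1"
  define N1 where "N1 = U\<^sup>2 * [:b\<^sup>2:] + U\<^sup>2 * [:c\<^sup>2:] - [:b\<^sup>2 * c\<^sup>2:]"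
  define N2 where "N2 = U\<^sup>2 * [:b\<^sup>2:] + [:b\<^sup>2 * c\<^sup>2:] - U\<^sup>2 * [:c\<^sup>2:]"
  define N3 where "N3 = U\<^sup>2 * [:c\<^sup>2:] + [:b\<^sup>2 * c\<^sup>2:] - U\<^sup>2 * [:b\<^sup>2:]"
  define W where "W = N1\<^sup>2 - 4 * U ^ 4 * [:b\<^sup>2:] * [:c\<^sup>2:]"
  have U0: "poly U 0 = 0" using assms(3) by (simp add: U_def poly_monom power_0_left)
  have const: "eval_t [:r:] = of_rat r" for r
    by (cases "r = 0") (simp_all add: eval_t_def map_poly_pCons)
  define u where "u = of_rat a * var_t ^ m1"
  define B C :: ratfun3 where "B = of_rat b" and "C = of_rat c"
  have eU: "eval_t U = u" by (simp add: eval_t_def U_def map_poly_monom poly_monom u_def)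
  have t0: "var_t \<noteq> 0" by (simp add: var_t_def)
  have nz: "u \<noteq> 0" "B \<noteq> 0" "C \<noteq> 0" using assms t0 by (simp_all add: u_def B_def C_def)
  have cb: "eval_t [:b\<^sup>2:] = B\<^sup>2" "eval_t [:c\<^sup>2:] = C\<^sup>2" "eval_t [:b\<^sup>2 * c\<^sup>2:] = B\<^sup>2 * C\<^sup>2"
    by (simp_all add: const B_def C_def of_rat_power of_rat_mult)
  have four: "eval_t 4 = 4" using const[of 4] by (simp add: numeral_poly)
  define n1 where "n1 = u\<^sup>2 * B\<^sup>2 + u\<^sup>2 * C\<^sup>2 - B\<^sup>2 * C\<^sup>2"
  define n2 where "n2 = u\<^sup>2 * B\<^sup>2 + B\<^sup>2 * C\<^sup>2 - u\<^sup>2 * C\<^sup>2"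
  define n3 where "n3 = u\<^sup>2 * C\<^sup>2 + B\<^sup>2 * C\<^sup>2 - u\<^sup>2 * B\<^sup>2"
  have eN: "eval_t N1 = n1" "eval_t N2 = n2" "eval_t N3 = n3"
    by (simp_all add: N1_def N2_def N3_def n1_def n2_def n3_def hom_add hom_minus hom_mult hom_power eU cb
        del: mult_pCons_right)
  have eW: "eval_t W = n1\<^sup>2 - 4 * u ^ 4 * B\<^sup>2 * C\<^sup>2"
    by (simp add: W_def hom_minus hom_mult hom_power eN eU cb four del: mult_pCons_right)
  define \<xi> where "\<xi> = eval_t W / (4 * u\<^sup>2 * B\<^sup>2 * C\<^sup>2)"
  define \<beta> where "\<beta> z = z / (2 * u * B * C)" for z :: ratfun3
  have id: "\<xi> + u\<^sup>2 = (\<beta> n1)\<^sup>2" "\<xi> + B\<^sup>2 = (\<beta> n2)\<^sup>2" "\<xi> + C\<^sup>2 = (\<beta> n3)\<^sup>2"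
    using heron_identities[OF nz] unfolding \<xi>_def eW \<beta>_def n1_def n2_def n3_def by blast+
  \<comment> \<open>At \<open>t = 0\<close> only the terms free of \<open>u\<close> survive. The
    numerator of \<xi> and the squares of \<open>N1\<close>, \<open>N2\<close>, \<open>N3\<close>
    then share the value \<open>(b\<^sup>2 * c\<^sup>2)\<^sup>2\<close>, which makes every ratio
    specialize to 1.\<close>
  have vals: "poly N1 0 = - (b\<^sup>2 * c\<^sup>2)" "poly N2 0 = b\<^sup>2 * c\<^sup>2" "poly N3 0 = b\<^sup>2 * c\<^sup>2"
    by (simp_all add: N1_def N2_def N3_def U0)
  have W0: "poly W 0 = (b\<^sup>2 * c\<^sup>2)\<^sup>2" by (simp add: W_def vals U0)
  have bc: "b\<^sup>2 * c\<^sup>2 \<noteq> 0" using assms by simp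
  have Wnz: "eval_t W \<noteq> 0" using W0 bc by (auto simp: eval_t_eq_0_iff)
  have X0: "\<xi> \<noteq> 0" using Wnz nz by (simp add: \<xi>_def)
  have "N1 \<noteq> 0" "N2 \<noteq> 0" "N3 \<noteq> 0" using vals bc by auto
  then have n0: "n1 \<noteq> 0" "n2 \<noteq> 0" "n3 \<noteq> 0" unfolding eN[symmetric] by (simp_all add: eval_t_eq_0_iff)
  then have \<beta>0: "\<beta> n1 \<noteq> 0" "\<beta> n2 \<noteq> 0" "\<beta> n3 \<noteq> 0" using nz by (simp_all add: \<beta>_def)
  have ratio: "\<xi> / (\<beta> (eval_t N))\<^sup>2 = eval_t W / eval_t (N\<^sup>2)" for N
    using nz by (simp add: \<xi>_def \<beta>_def hom_power power_divide power_mult_distrib)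
  have \<theta>: "poly (map_poly of_rat g) (\<xi> / (\<beta> (eval_t N))\<^sup>2) \<noteq> 0"
    if "poly g 1 \<noteq> 0" "(poly N 0)\<^sup>2 = (b\<^sup>2 * c\<^sup>2)\<^sup>2" for g N
    unfolding ratio using that W0 bc by (intro specialization) simp_all
  define M where "M = m1 * (m2 * m3)"
  have M2: "m2 * (m1 * m3) = M" and M3: "m3 * (m1 * m2) = M" by (simp_all add: M_def mult_ac)
  define D where "D = \<xi> ^ (M - 1)"
  \<comment> \<open>In the identity for the first curve \<open>a\<close> is accompanied by
    \<open>var_t ^ m1\<close>, hence the rescaling by \<open>v = var_t\<close>; the other two
    identities contain the constants themselves, hence \<open>v = 1\<close>.\<close>
  have J1: "jacobian_rank 1 (twist_poly m1 (a\<^sup>2) D) > 0"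
    unfolding D_def M_def
    by (rule jacobian_rank_twist[where \<beta> = "\<beta> n1" and v = var_t])
       (use assms t0 X0 \<beta>0 id(1) \<theta>[where N = N1, unfolded eN] vals in \<open>simp_all add: u_def\<close>)
  have J2: "jacobian_rank 1 (twist_poly m2 (b\<^sup>2) D) > 0"
    unfolding D_def M2[symmetric]
    by (rule jacobian_rank_twist[where \<beta> = "\<beta> n2" and v = 1])
       (use assms X0 \<beta>0 id(2) \<theta>[where N = N2, unfolded eN] vals in \<open>simp_all add: B_def\<close>)
  have J3: "jacobian_rank 1 (twist_poly m3 (c\<^sup>2) D) > 0"
    unfolding D_def M3[symmetric]
    by (rule jacobian_rank_twist[where \<beta> = "\<beta> n3" and v = 1])
       (use assms X0 \<beta>0 id(3) \<theta>[where N = N3, unfolded eN] vals in \<open>simp_all add: C_def\<close>)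
  define e where "e = \<xi> ^ ((M - 1) div 2)"
  have "odd M" using assms by (simp add: M_def)
  then have "2 * ((M - 1) div 2) = M - 1" by (auto elim!: oddE)
  then have De: "D = e\<^sup>2" by (simp add: D_def e_def power_mult[symmetric] mult.commute)
  have "e \<noteq> 0" using X0 by (simp add: e_def)
  from elliptic_rank_square_twist[OF assms(1,2) this] J1 J2 J3 X0 show ?thesis
    unfolding De[symmetric] by (intro exI[of _ D]) (simp add: D_def)
qed

end
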